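(* Let $X$ be a centered random vector in $\mathbb{R}^d$ with finite Poincaré constant $\mathrm{C_p}(X)<\infty$, and let $G$ be a standard Gaussian vector independent of $X$. Then for every $\lambda\in(0,1)$, $$\delta_{EPI,\lambda}(X,G)\geq\left(\lambda-\frac{\lambda(\mathrm{C_p}(X)-1)-\ln\big(\lambda(\mathrm{C_p}(X)-1)+1\big)}{\mathrm{C_p}(X)-\ln(\mathrm{C_p}(X))-1}\right)\mathrm{D}(X\|G).$$
   Context: The Poincaré constant $\mathrm{C_p}(X)$ is the smallest $C$ with $\mathrm{Var}(\psi(X))\leq C\,\mathbb{E}\|\nabla\psi(X)\|_2^2$ for all test functions $\psi$. $\mathrm{D}(U\|V)=\int\ln\frac{d\mu}{d\nu}d\mu$ for $U\sim\mu,V\sim\nu$. For independent $X,Y$: $\delta_{EPI,\lambda}(X,Y)=\lambda\mathrm{D}(X\|G)+(1-\lambda)\mathrm{D}(Y\|G)-\mathrm{D}(\sqrt{\lambda}X+\sqrt{1-\lambda}Y\|G)$, so in particular $\delta_{EPI,\lambda}(X,G)=\lambda\mathrm{D}(X\|G)-\mathrm{D}(\sqrt{\lambda}X+\sqrt{1-\lambda}G'\|G)$ with $G'$ an independent copy of $G$.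
   Formalization: The case of Poincaré constant exactly 1 is excluded, since there the fraction in the bound is 0/0 and the stated inequality is undefined (for example for X standard Gaussian). *)

theory Defs
  imports "HOL-Probability.Probability"
begin

definition std_gauss :: "'a::euclidean_space measure" where
  "std_gauss = density lborel
     (\<lambda>x. ennreal ((2 * pi) powr (- real DIM('a) / 2) * exp (- (norm x)\<^sup>2 / 2)))"

definition poincare_test :: "'a::euclidean_space measure \<Rightarrow> ('a \<Rightarrow> real) \<Rightarrow> ('a \<Rightarrow> 'a) \<Rightarrow> bool" where
  "poincare_test \<mu> \<psi> g \<longleftrightarrow>
     continuous_on UNIV g \<and> (\<forall>x. (\<psi> has_derivative (\<lambda>v. g x \<bullet> v)) (at x)) \<and>
     integrable \<mu> (\<lambda>x. (\<psi> x)\<^sup>2) \<and> integrable \<mu> (\<lambda>x. (norm (g x))\<^sup>2)"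

definition poincare_ineq :: "'a::euclidean_space measure \<Rightarrow> real \<Rightarrow> bool" where
  "poincare_ineq \<mu> C \<longleftrightarrow>
     (\<forall>\<psi> g. poincare_test \<mu> \<psi> g \<longrightarrow>
        (\<integral>x. (\<psi> x - (\<integral>y. \<psi> y \<partial>\<mu>))\<^sup>2 \<partial>\<mu>) \<le> C * (\<integral>x. (norm (g x))\<^sup>2 \<partial>\<mu>))"

text \<open>Poincare constant: the smallest such C (infimum; finite iff some C works).\<close>
definition poincare_const :: "'a::euclidean_space measure \<Rightarrow> real" where
  "poincare_const \<mu> = Inf {C. C \<ge> 0 \<and> poincare_ineq \<mu> C}"

definition rel_entropy :: "'a measure \<Rightarrow> 'a measure \<Rightarrow> ereal" where
  "rel_entropy \<mu> \<nu> =
     (if sets \<mu> = sets \<nu> \<and> absolutely_continuous \<nu> \<mu> then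
        (let h = (\<lambda>x. ln (enn2real (RN_deriv \<nu> \<mu> x))) in
          enn2ereal (\<integral>\<^sup>+x. ennreal (max 0 (h x)) \<partial>\<mu>)
          - enn2ereal (\<integral>\<^sup>+x. ennreal (max 0 (- h x)) \<partial>\<mu>))
      else \<infinity>)"

end

theory Submission
  imports Defs
begin

text \<open>
  Write \<open>X\<^sub>s = sqrt s X + sqrt (1 - s) G\<close>, let \<open>f\<^sub>s\<close> be its density with respect to the
  Gaussian, \<open>D(s)\<close> its relative entropy, \<open>v\<^sub>s\<close> the gradient of \<open>ln f\<^sub>s\<close>, \<open>I(s) = E |v\<^sub>s(X\<^sub>s)|\<^sup>2\<close>, and
  \<open>\<phi>(s) = s(C - 1) - ln(1 + s(C - 1))\<close>. Since \<open>D'(s) = I(s) / (2s)\<close> and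
  \<open>\<phi>'(s) = (C - 1)\<^sup>2 s / (1 + s(C - 1))\<close>, the claim \<open>D(s) \<phi>(1) \<le> \<phi>(s) D(1)\<close> follows once
  \<open>D' / \<phi>'\<close>, that is \<open>I(s) (1 + s(C - 1)) / s\<^sup>2\<close>, is nondecreasing.

  As \<open>v\<^sub>s(X\<^sub>s)\<close> is up to a factor a conditional expectation of \<open>v\<^sub>t(X\<^sub>t)\<close> for \<open>s < t\<close>, the monotonicity
  is a bound on the maximal correlation of \<open>X\<^sub>s\<close> and \<open>X\<^sub>t\<close>. Set \<open>Y\<^sub>r = X + sqrt r G\<close> and
  \<open>A(r) = Var E[k(Y\<^sub>T) | Y\<^sub>r]\<close>. The Poincare inequality for \<open>x \<mapsto> E[k(Y\<^sub>T) | X = x]\<close>, whose gradient is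
  controlled by Bessel's inequality for the Gaussian coordinates, gives \<open>r A(0) \<le> C (A(r) - A(0))\<close>,
  and the Efron-Stein inequality for two equal noise increments says that \<open>A\<close> is midpoint convex.
  Together they give \<open>(C + T) A(r) \<le> (C + r) A(T)\<close>.

  De Bruijn's identity is only needed in a weak form: by Gibbs' inequality the function
  \<open>r \<mapsto> E ln f\<^sub>s(X\<^sub>r)\<close> touches \<open>D\<close> from below at \<open>s\<close>, and its derivative at \<open>s\<close> is \<open>I(s) / (2s)\<close>.
\<close>

section \<open>The standard Gaussian measure\<close>

text \<open>The constants are those of the Gaussian case. If each coordinate of X is an independent
  normal of variance C, then \<open>X\<^sub>s\<close> has variance \<open>1 + s(C - 1)\<close>, its
  entropy per coordinate is \<open>\<phi>(s) / 2\<close>, and \<open>Y\<^sub>r\<close>,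
  \<open>Y\<^sub>T\<close> have squared correlation \<open>(C + r) / (C + T)\<close>; for linear k
  both inequalities behind the correlation bound are then equalities. So the theorem says that
  entropy decays at least as fast as for this Gaussian. The two time scales are tied by
  \<open>X\<^sub>s = sqrt s Y\<^sub>T\<close> with \<open>T = 1/s - 1\<close>, whence
  \<open>(C + T) / s = (1 + s(C - 1)) / s\<^sup>2\<close>. The obstacle is the endpoint s = 1, where
  the density of X need not be regular. All calculus therefore stays at s < 1, where the smoothed
  density is differentiable and its score grows linearly. At 1 only the limit of
  \<open>\<phi>\<close> is taken, after data processing has given \<open>D(c) \<le> D(1)\<close> for
  c < 1. The second moments behind the growth bounds are extracted from the finiteness of
  \<open>D(1)\<close>.\<close>

lemma sets_std_gauss [simp, measurable_cong]: "sets std_gauss = sets borel"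
  and space_std_gauss [simp]: "space std_gauss = UNIV"
  by (simp_all add: std_gauss_def)

lemma prob_space_std_gauss: "prob_space (std_gauss :: 'a::euclidean_space measure)"
proof (rule prob_spaceI)
  have eq: "(2 * pi) powr (- real DIM('a) / 2) * exp (- (norm x)\<^sup>2 / 2)
      = (\<Prod>b\<in>Basis. normal_density 0 1 (x \<bullet> b))" for x :: 'a
  proof -
    have "(norm x)\<^sup>2 = (\<Sum>b\<in>Basis. (x \<bullet> b)\<^sup>2)"
      unfolding power2_norm_eq_inner by (subst euclidean_inner) (simp add: power2_eq_square)
    then have "exp (- (norm x)\<^sup>2 / 2) = (\<Prod>b\<in>Basis. exp (- (x \<bullet> b)\<^sup>2 / 2))"
      by (simp add: exp_sum[symmetric] sum_negf sum_divide_distrib)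
    moreover have "(2 * pi) powr (- real DIM('a) / 2) = (\<Prod>b\<in>(Basis::'a set). 1 / sqrt (2 * pi))"
      by (simp add: powr_half_sqrt[symmetric] powr_minus_divide[symmetric] powr_powr
          powr_realpow[symmetric] mult.commute)
    ultimately show ?thesis
      by (simp add: normal_density_def prod_dividef power_one_over)
  qed
  have one: "(\<integral>\<^sup>+x. ennreal (normal_density 0 1 x) \<partial>lborel) = 1"
  proof -
    interpret N: prob_space "density lborel (normal_density 0 1)"
      by (rule prob_space_normal_density) simp
    show ?thesis using N.emeasure_space_1 by (simp add: emeasure_density)
  qed
  have "emeasure (std_gauss :: 'a measure) (space std_gauss)
      = (\<integral>\<^sup>+x. (\<Prod>b\<in>Basis. ennreal (normal_density 0 1 ((x::'a) \<bullet> b))) \<partial>lborel)"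
    unfolding std_gauss_def eq by (simp add: emeasure_density prod_ennreal)
  also have "\<dots> = 1"
    by (subst nn_integral_lborel_prod) (simp_all add: one)
  finally show "emeasure (std_gauss :: 'a measure) (space std_gauss) = 1" .
qed

interpretation std_gauss: prob_space "std_gauss :: 'a::euclidean_space measure"
  by (rule prob_space_std_gauss)

lemma measure_std_gauss_UNIV [simp]: "measure std_gauss (UNIV :: 'a::euclidean_space set) = 1"
  using std_gauss.prob_space by simp

text \<open>One change of variables serves all Gaussian integrals: \<open>c = 1\<close> is the
  translation formula, \<open>c = -1\<close> the symmetry, \<open>c = sqrt 2\<close> the
  integrability of \<open>exp ((norm z)\<^sup>2 / 4)\<close>, and \<open>c = sqrt (1 - s)\<close>
  the Mehler kernel.\<close>

lemma distr_std_gauss_affine: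
  fixes m :: "'a::euclidean_space"
  assumes c: "c \<noteq> 0"
  shows "distr std_gauss borel (\<lambda>z. m + c *\<^sub>R z) = density std_gauss
    (\<lambda>y. ennreal (inverse \<bar>c\<bar> ^ DIM('a) * exp ((norm y)\<^sup>2 / 2 - (norm (y - m))\<^sup>2 / (2 * c\<^sup>2))))"
    (is "?L = density _ ?K")
proof (rule measure_eqI)
  show "sets ?L = sets (density std_gauss ?K)" by simp
  let ?T = "\<lambda>z. m + c *\<^sub>R z"
  let ?g = "\<lambda>x::'a. ennreal ((2 * pi) powr (- real DIM('a) / 2) * exp (- (norm x)\<^sup>2 / 2))"
  fix A assume "A \<in> sets ?L"
  then have A [measurable]: "A \<in> sets borel" by simp
  have pt: "ennreal (\<bar>c\<bar> ^ DIM('a)) * (?g (?T z) * (?K (?T z) * indicator A (?T z)))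
      = ?g z * indicator A (?T z)" for z
  proof -
    have "(norm (c *\<^sub>R z))\<^sup>2 / (2 * c\<^sup>2) = (norm z)\<^sup>2 / 2"
      using c by (simp add: power_mult_distrib)
    then have "exp (- (norm (?T z))\<^sup>2 / 2) * exp ((norm (?T z))\<^sup>2 / 2 - (norm (?T z - m))\<^sup>2 / (2 * c\<^sup>2))
        = exp (- (norm z)\<^sup>2 / 2)"
      unfolding exp_add[symmetric] by simp
    moreover have "\<bar>c\<bar> ^ DIM('a) * inverse \<bar>c\<bar> ^ DIM('a) = 1"
      using c by (simp add: power_mult_distrib[symmetric])
    moreover have "a * (p * e1 * (b * e2)) = (a * b) * (p * (e1 * e2))" for a b p e1 e2 :: real
      by (simp add: ac_simps)
    ultimately have "\<bar>c\<bar> ^ DIM('a) * ((2 * pi) powr (- real DIM('a) / 2) * exp (- (norm (?T z))\<^sup>2 / 2)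
       * (inverse \<bar>c\<bar> ^ DIM('a) * exp ((norm (?T z))\<^sup>2 / 2 - (norm (?T z - m))\<^sup>2 / (2 * c\<^sup>2))))
      = (2 * pi) powr (- real DIM('a) / 2) * exp (- (norm z)\<^sup>2 / 2)"
      by (simp only: mult_1_left)
    then show ?thesis
      by (auto simp add: ennreal_mult[symmetric] mult.assoc split: split_indicator)
  qed
  have "emeasure ?L A = (\<integral>\<^sup>+z. ?g z * indicator A (?T z) \<partial>lborel)"
  proof -
    have [measurable]: "?T -` A \<in> sets borel"
      using A by (rule measurable_sets_borel[rotated]) simp
    show ?thesis unfolding std_gauss_def
      by (simp add: emeasure_distr emeasure_density indicator_def)
  qed
  also have "\<dots> = (\<integral>\<^sup>+z. ennreal (\<bar>c\<bar> ^ DIM('a)) * (?g (?T z) * (?K (?T z) * indicator A (?T z))) \<partial>lborel)"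
    by (simp only: pt)
  also have "\<dots> = (\<integral>\<^sup>+y. ?g y * (?K y * indicator A y) \<partial>density (distr lborel borel ?T) (\<lambda>_. \<bar>c\<bar>^DIM('a)))"
    by (subst nn_integral_density; (subst nn_integral_distr)?) simp_all
  also have "\<dots> = (\<integral>\<^sup>+y. ?g y * (?K y * indicator A y) \<partial>lborel)"
    using lborel_affine[OF c, of m] by simp
  also have "\<dots> = emeasure (density std_gauss ?K) A"
    unfolding std_gauss_def by (simp add: emeasure_density nn_integral_density)
  finally show "emeasure ?L A = emeasure (density std_gauss ?K) A" .
qed

lemma nn_integral_affine_kernel:
  fixes m :: "'a::euclidean_space"
  assumes c: "c \<noteq> 0"
  shows "(\<integral>\<^sup>+y. ennreal (inverse \<bar>c\<bar> ^ DIM('a) * exp ((norm y)\<^sup>2 / 2 - (norm (y - m))\<^sup>2 / (2 * c\<^sup>2)))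
    \<partial>std_gauss) = 1"
proof -
  interpret L: prob_space "distr std_gauss borel (\<lambda>z::'a. m + c *\<^sub>R z)"
    by (rule std_gauss.prob_space_distr) simp
  show ?thesis
    using L.emeasure_space_1 unfolding distr_std_gauss_affine[OF c]
    by (simp add: emeasure_density)
qed

lemma has_bochner_integral_of_nn_integral:
  assumes [measurable]: "f \<in> borel_measurable M" and "\<And>x. 0 \<le> f x"
    and "(\<integral>\<^sup>+x. ennreal (f x) \<partial>M) = ennreal c" "0 \<le> c"
  shows "has_bochner_integral M f c"
  using assms by (intro has_bochner_integral_nn_integral) auto

text \<open>The Cameron-Martin formula. It moves a shift in the argument of a merely measurable
  function onto a smooth weight.\<close>

lemma std_gauss_shift:
  fixes h :: "'a::euclidean_space"
  shows "distr std_gauss borel (\<lambda>z. h + z) = density std_gauss (\<lambda>y. ennreal (exp (h \<bullet> y - (norm h)\<^sup>2 / 2)))"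
proof -
  have "(norm y)\<^sup>2 / 2 - (norm (y - h))\<^sup>2 / 2 = h \<bullet> y - (norm h)\<^sup>2 / 2" for y
    by (simp add: power2_norm_eq_inner algebra_simps inner_commute diff_divide_distrib add_divide_distrib)
  then show ?thesis using distr_std_gauss_affine[of 1 h] by simp
qed

lemma std_gauss_mgf:
  "has_bochner_integral std_gauss (\<lambda>z::'a::euclidean_space. exp (h \<bullet> z)) (exp ((norm h)\<^sup>2 / 2))"
proof -
  have eq: "(norm y)\<^sup>2 / 2 - (norm (y - h))\<^sup>2 / 2 = h \<bullet> y - (norm h)\<^sup>2 / 2" for y
    by (simp add: power2_norm_eq_inner algebra_simps inner_commute diff_divide_distrib add_divide_distrib)
  have "has_bochner_integral std_gauss (\<lambda>y. exp (h \<bullet> y - (norm h)\<^sup>2 / 2)) 1"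
    using nn_integral_affine_kernel[of 1 h]
    by (intro has_bochner_integral_of_nn_integral) (simp_all add: eq)
  from has_bochner_integral_mult_left[OF this, of "exp ((norm h)\<^sup>2 / 2)"]
  show ?thesis by (simp add: exp_diff)
qed

lemma std_gauss_uminus: "distr std_gauss borel uminus = (std_gauss :: 'a::euclidean_space measure)"
  using distr_std_gauss_affine[of "-1" "0::'a"] by (simp add: density_1)

lemma integrable_std_gauss_exp_norm:
  "integrable std_gauss (\<lambda>z::'a::euclidean_space. exp ((norm z)\<^sup>2 / 4))"
proof -
  let ?k = "inverse \<bar>sqrt 2\<bar> ^ DIM('a)"
  have "has_bochner_integral std_gauss (\<lambda>z::'a. ?k * exp ((norm z)\<^sup>2 / 4)) 1"
    using nn_integral_affine_kernel[of "sqrt 2" "0::'a"]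
    by (intro has_bochner_integral_of_nn_integral) simp_all
  then have "has_bochner_integral std_gauss (\<lambda>z::'a. inverse ?k * (?k * exp ((norm z)\<^sup>2 / 4))) (inverse ?k * 1)"
    by (rule has_bochner_integral_mult_right)
  moreover have "inverse ?k * (?k * e) = e" for e by simp
  ultimately show ?thesis by (simp only: has_bochner_integral_iff)
qed

section \<open>Moments of the standard Gaussian\<close>

lemma integrable_std_gauss_norm_sq: "integrable std_gauss (\<lambda>z::'a::euclidean_space. (norm z)\<^sup>2)"
proof (rule Bochner_Integration.integrable_bound)
  show "integrable std_gauss (\<lambda>z::'a. 4 * exp ((norm z)\<^sup>2 / 4))"
    by (intro integrable_mult_right integrable_std_gauss_exp_norm)
  have "x \<le> 4 * exp (x/4)" for x :: real using exp_ge_add_one_self[of "x/4"] by linarith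
  then show "AE z::'a in std_gauss. norm ((norm z)\<^sup>2) \<le> norm (4 * exp ((norm z)\<^sup>2 / 4))" by simp
qed simp

lemma integrable_std_gauss_norm: "integrable std_gauss (\<lambda>z::'a::euclidean_space. norm z)"
proof (rule Bochner_Integration.integrable_bound)
  show "integrable std_gauss (\<lambda>z::'a. 1 + (norm z)\<^sup>2)"
    by (intro Bochner_Integration.integrable_add integrable_std_gauss_norm_sq) simp
  have "x \<le> 1 + x\<^sup>2" for x :: real using sum_squares_bound[of x 1] zero_le_power2[of x] by (simp add: power2_eq_square) (smt (verit) mult_nonneg_nonneg mult_le_cancel_right1)
  then show "AE z::'a in std_gauss. norm (norm z) \<le> norm (1 + (norm z)\<^sup>2)" by simp
qed simp

lemma integrable_std_gauss_id [simp]: "integrable std_gauss (\<lambda>z::'a::euclidean_space. z)"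
  using integrable_std_gauss_norm by (simp add: integrable_norm_iff)

lemma std_gauss_mean_zero: "(\<integral>z. z \<partial>std_gauss) = (0::'a::euclidean_space)"
proof -
  have "(\<integral>z. z \<partial>std_gauss) = (\<integral>z. z \<partial>distr std_gauss borel (uminus :: 'a \<Rightarrow> 'a))"
    by (simp add: std_gauss_uminus)
  also have "\<dots> = - (\<integral>z. z \<partial>std_gauss)" by (subst integral_distr) auto
  finally have "2 *\<^sub>R (\<integral>z. z \<partial>std_gauss) = (0::'a)"
    by (simp only: scaleR_2 eq_neg_iff_add_eq_0)
  then show ?thesis by simp
qed

lemma integrable_std_gauss_inner_sq: "integrable std_gauss (\<lambda>z::'a::euclidean_space. (z \<bullet> h)\<^sup>2)"
proof (rule Bochner_Integration.integrable_bound)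
  show "integrable std_gauss (\<lambda>z::'a. (norm h)\<^sup>2 * (norm z)\<^sup>2)"
    by (intro integrable_mult_right integrable_std_gauss_norm_sq)
  show "AE z::'a in std_gauss. norm ((z \<bullet> h)\<^sup>2) \<le> norm ((norm h)\<^sup>2 * (norm z)\<^sup>2)"
    using Cauchy_Schwarz_ineq2
    by (auto simp flip: power_mult_distrib simp: abs_le_square_iff[symmetric] abs_mult mult.commute)
qed simp

text \<open>The right side is the square of \<open>2 sinh (x/2)\<close>, and
  \<open>2 sinh (x/2) \<ge> x\<close> for \<open>x \<ge> 0\<close>. This bounds a second moment by
  exponential moments.\<close>

lemma square_le_exp_sum: "x\<^sup>2 \<le> exp x + exp (- x) - 2" for x :: real
proof -
  have *: "x\<^sup>2 \<le> exp x + exp (- x) - 2" if "x \<ge> 0" for x :: real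
  proof -
    have "exp (x/2) - exp (-(x/2)) - x \<ge> exp (0/2) - exp (-(0/2)) - (0::real)"
    proof (rule DERIV_nonneg_imp_nondecreasing[OF that])
      fix u :: real assume "0 \<le> u"
      have "0 \<le> (exp (u/4) - exp (-(u/4)))\<^sup>2" by simp
      then have "exp (u/2) + exp (-(u/2)) \<ge> 2"
        by (simp add: power2_eq_square algebra_simps exp_add[symmetric])
      then show "\<exists>y. DERIV (\<lambda>x. exp (x/2) - exp (-(x/2)) - x) u :> y \<and> 0 \<le> y"
        by (intro exI[of _ "exp (u/2)/2 + exp (-(u/2))/2 - 1"]) (auto intro!: derivative_eq_intros)
    qed
    then have "x\<^sup>2 \<le> (exp (x/2) - exp (-(x/2)))\<^sup>2" using that by (intro power_mono) auto
    also have "\<dots> = exp x + exp (- x) - 2"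
      by (simp add: power2_eq_square algebra_simps exp_add[symmetric])
    finally show ?thesis .
  qed
  show ?thesis using *[of x] *[of "-x"] by (cases "x \<ge> 0") auto
qed

text \<open>The covariance bound is read off the moment generating function: compare the square of
  \<open>sqrt t * (z \<bullet> h)\<close> with \<open>2 cosh - 2\<close>, divide by t and let t tend
  to 0.\<close>

lemma std_gauss_inner_sq_le: "(\<integral>z. (z \<bullet> h)\<^sup>2 \<partial>std_gauss) \<le> (norm h)\<^sup>2" for h :: "'a::euclidean_space"
proof (rule tendsto_lowerbound)
  let ?c = "(norm h)\<^sup>2"
  show "((\<lambda>t. ?c + t * ?c\<^sup>2) \<longlongrightarrow> ?c) (at_right 0)"
    by (auto intro!: tendsto_eq_intros)
  \<comment> \<open>The restriction on t keeps \<open>t * ?c / 2\<close> in the range where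
    \<open>exp_bound\<close> gives \<open>exp x \<le> 1 + x + x\<^sup>2\<close>.\<close>
  have bound: "(\<integral>z. (z \<bullet> h)\<^sup>2 \<partial>std_gauss) \<le> ?c + t * ?c\<^sup>2"
    if t: "0 < t" "t * ?c \<le> 1" for t
  proof -
    define s where "s = sqrt t"
    have s: "s\<^sup>2 = t" "s \<noteq> 0" using t by (auto simp: s_def)
    have h1: "has_bochner_integral std_gauss (\<lambda>z::'a. exp ((s *\<^sub>R h) \<bullet> z)) (exp (t * ?c / 2))"
      and h2: "has_bochner_integral std_gauss (\<lambda>z::'a. exp ((- s *\<^sub>R h) \<bullet> z)) (exp (t * ?c / 2))"
      using std_gauss_mgf[of "s *\<^sub>R h"] std_gauss_mgf[of "- s *\<^sub>R h"] s by (simp_all add: power_mult_distrib)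
    have "t * (\<integral>z. (z \<bullet> h)\<^sup>2 \<partial>std_gauss) = (\<integral>z. (s * (z \<bullet> h))\<^sup>2 \<partial>std_gauss)"
      by (simp add: power_mult_distrib s)
    also have "\<dots> \<le> (\<integral>z. exp ((s *\<^sub>R h) \<bullet> z) + exp ((- s *\<^sub>R h) \<bullet> z) - 2 \<partial>std_gauss)"
    proof (rule integral_mono)
      show "integrable std_gauss (\<lambda>z. (s * (z \<bullet> h))\<^sup>2)"
        by (simp add: power_mult_distrib integrable_std_gauss_inner_sq)
      show "integrable std_gauss (\<lambda>z. exp ((s *\<^sub>R h) \<bullet> z) + exp ((- s *\<^sub>R h) \<bullet> z) - 2)"
        using h1 h2 by (auto simp: has_bochner_integral_iff)
      show "(s * (z \<bullet> h))\<^sup>2 \<le> exp ((s *\<^sub>R h) \<bullet> z) + exp ((- s *\<^sub>R h) \<bullet> z) - 2" for z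
        using square_le_exp_sum[of "s * (z \<bullet> h)"] by (simp add: inner_commute)
    qed
    also have "\<dots> = exp (t * ?c / 2) + exp (t * ?c / 2) - 2"
      using h1 h2 by (simp add: has_bochner_integral_iff)
    also have "\<dots> \<le> 2 * (t * ?c / 2 + (t * ?c / 2)\<^sup>2)"
      using exp_bound[of "t * ?c / 2"] t by simp
    also have "\<dots> \<le> t * (?c + t * ?c\<^sup>2)"
      using t by (simp add: power2_eq_square algebra_simps zero_le_mult_iff)
    finally show ?thesis using t by simp
  qed
  have "eventually (\<lambda>t. t * ?c < 1) (at_right 0)"
    by (rule order_tendstoD[where y=0]) (auto intro!: tendsto_eq_intros)
  moreover have "eventually (\<lambda>t::real. 0 < t) (at_right 0)" by (simp add: eventually_at_right_less)
  ultimately show "\<forall>\<^sub>F t in at_right 0. (\<integral>z. (z \<bullet> h)\<^sup>2 \<partial>std_gauss) \<le> ?c + t * ?c\<^sup>2"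
    by eventually_elim (rule bound, auto)
qed simp

section \<open>The Mehler kernel and the Gaussian channel\<close>

text \<open>The density of \<open>sqrt s x + sqrt (1 - s) G\<close> relative to the Gaussian, not to
  Lebesgue measure. With this reference measure the kernel is symmetric and relative entropy is the
  mean of a log density.\<close>

definition mehler :: "real \<Rightarrow> 'a::euclidean_space \<Rightarrow> 'a \<Rightarrow> real" where
  "mehler s x y = inverse (sqrt (1 - s)) ^ DIM('a)
     * exp ((norm y)\<^sup>2 / 2 - (norm (y - sqrt s *\<^sub>R x))\<^sup>2 / (2 * (1 - s)))"

lemma mehler_pos: "s < 1 \<Longrightarrow> 0 < mehler s x y"
  by (simp add: mehler_def)

text \<open>Expanding the square turns the exponent into \<open>(2 sqrt s (x \<bullet> y) - s (x
  \<bullet> x) - s (y \<bullet> y)) / (2 (1 - s))\<close>. The symmetry is the reversibility of the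
  channel under the Gaussian.\<close>

lemma mehler_sym:
  assumes "0 \<le> s" "s < 1"
  shows "mehler s x y = mehler s y x"
proof -
  have "(norm (y - sqrt s *\<^sub>R x))\<^sup>2 = y \<bullet> y - 2 * sqrt s * (x \<bullet> y) + s * (x \<bullet> x)" for x y :: 'a
  proof -
    have "sqrt s * (sqrt s * c) = s * c" for c
      using assms by (simp add: mult.assoc[symmetric] del: mult_cancel_right)
    with assms show ?thesis
      unfolding power2_norm_eq_inner
      by (simp add: inner_diff_left inner_diff_right inner_commute)
  qed
  moreover have "a / 2 - b / (2 * (1 - s)) = ((1 - s) * a - b) / (2 * (1 - s))" for a b
    using assms by (simp add: field_simps)
  ultimately have "(norm y)\<^sup>2 / 2 - (norm (y - sqrt s *\<^sub>R x))\<^sup>2 / (2 * (1 - s))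
     = (2 * sqrt s * (x \<bullet> y) - s * (x \<bullet> x) - s * (y \<bullet> y)) / (2 * (1 - s))" for x y :: 'a
    by (simp add: power2_norm_eq_inner left_diff_distrib)
  then show ?thesis by (simp add: mehler_def inner_commute diff_diff_eq add.commute)
qed

lemma measurable_mehler [measurable]:
  "(\<lambda>p. mehler s (fst p) (snd p)) \<in> borel_measurable (borel \<Otimes>\<^sub>M borel)"
  "mehler s x \<in> borel_measurable borel"
  "(\<lambda>x. mehler s x y) \<in> borel_measurable borel"
  unfolding mehler_def by measurable

lemma distr_mehler:
  assumes "s < 1"
  shows "distr std_gauss borel (\<lambda>z. sqrt s *\<^sub>R x + sqrt (1 - s) *\<^sub>R z) = density std_gauss (mehler s x)"
  using distr_std_gauss_affine[of "sqrt (1 - s)" "sqrt s *\<^sub>R x"] assms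
  by (simp add: mehler_def[abs_def])

lemma nn_integral_mehler: "s < 1 \<Longrightarrow> (\<integral>\<^sup>+y. ennreal (mehler s x y) \<partial>std_gauss) = 1"
  using nn_integral_affine_kernel[of "sqrt (1 - s)" "sqrt s *\<^sub>R x"]
  by (simp add: mehler_def)

lemma nn_integral_mehler': "0 \<le> s \<Longrightarrow> s < 1 \<Longrightarrow> (\<integral>\<^sup>+x. ennreal (mehler s x y) \<partial>std_gauss) = 1"
  by (subst mehler_sym) (simp_all add: nn_integral_mehler)

definition chan :: "real \<Rightarrow> 'a::euclidean_space \<times> 'a \<Rightarrow> 'a" where
  "chan s p = sqrt s *\<^sub>R fst p + sqrt (1 - s) *\<^sub>R snd p"

lemma measurable_chan [measurable]: "chan s \<in> borel_measurable (borel \<Otimes>\<^sub>M borel)"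
  unfolding chan_def[abs_def] by measurable

lemma norm_chan_le: "0 \<le> s \<Longrightarrow> s \<le> 1 \<Longrightarrow> norm (chan s p) \<le> norm (fst p) + norm (snd p)"
  for p :: "'a::euclidean_space \<times> 'a"
proof -
  assume s: "0 \<le> s" "s \<le> 1"
  have "norm (chan s p) \<le> sqrt s * norm (fst p) + sqrt (1 - s) * norm (snd p)"
    unfolding chan_def using norm_triangle_ineq[of "sqrt s *\<^sub>R fst p" "sqrt (1 - s) *\<^sub>R snd p"] s by simp
  also have "\<dots> \<le> 1 * norm (fst p) + 1 * norm (snd p)"
    using s by (intro add_mono mult_right_mono) auto
  finally show ?thesis by simp
qed

lemma norm_chan_diff: "norm (chan r p - chan s p)
    \<le> (\<bar>sqrt r - sqrt s\<bar> + \<bar>sqrt (1 - r) - sqrt (1 - s)\<bar>) * (norm (fst p) + norm (snd p))"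
  for p :: "'a::euclidean_space \<times> 'a"
proof -
  have "chan r p - chan s p = (sqrt r - sqrt s) *\<^sub>R fst p + (sqrt (1 - r) - sqrt (1 - s)) *\<^sub>R snd p"
    by (simp add: chan_def algebra_simps)
  then have "norm (chan r p - chan s p) \<le> \<bar>sqrt r - sqrt s\<bar> * norm (fst p) + \<bar>sqrt (1 - r) - sqrt (1 - s)\<bar> * norm (snd p)"
    using norm_triangle_ineq[of "(sqrt r - sqrt s) *\<^sub>R fst p" "(sqrt (1 - r) - sqrt (1 - s)) *\<^sub>R snd p"] by simp
  also have "\<dots> \<le> (\<bar>sqrt r - sqrt s\<bar> + \<bar>sqrt (1 - r) - sqrt (1 - s)\<bar>) * (norm (fst p) + norm (snd p))"
    by (simp add: algebra_simps)
  finally show ?thesis .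
qed

lemma sum_sq_le: "(a + b)\<^sup>2 \<le> 2 * (a\<^sup>2 + b\<^sup>2)" for a b :: real
  using sum_squares_bound[of a b] by (simp add: power2_sum)

section \<open>The channel with an arbitrary input law\<close>

locale borel_prob = prob_space \<mu> for \<mu> :: "'a::euclidean_space measure" +
  assumes sets_mu [simp, measurable_cong]: "sets \<mu> = sets borel"
begin

lemma space_mu [simp]: "space \<mu> = UNIV"
  using sets_mu by (rule sets_eq_imp_space_eq[THEN trans]) simp

lemma measure_mu_UNIV [simp]: "measure \<mu> UNIV = 1"
  using prob_space by simp

abbreviation P :: "('a \<times> 'a) measure" where "P \<equiv> \<mu> \<Otimes>\<^sub>M std_gauss"

sublocale P: pair_prob_space \<mu> "std_gauss :: 'a measure" ..

lemma sets_P: "sets P = sets (borel \<Otimes>\<^sub>M borel)"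
  by (intro sets_pair_measure_cong) simp_all

lemma space_P [simp]: "space P = UNIV"
  by (simp add: space_pair_measure)

lemma measure_P_UNIV [simp]: "measure P UNIV = 1"
  using P.prob_space by simp

text \<open>An explicit joint density of input and output lets conditioning on the output be done by
  exchanging the order of integration.\<close>

lemma distr_joint:
  assumes s: "s < 1"
  shows "distr P (borel \<Otimes>\<^sub>M borel) (\<lambda>p. (fst p, chan s p))
    = density P (\<lambda>p. ennreal (mehler s (fst p) (snd p)))" (is "?L = ?R")
proof (rule measure_eqI)
  show "sets ?L = sets ?R" by (simp add: sets_P)
  fix A assume "A \<in> sets ?L"
  then have A [measurable]: "A \<in> sets (borel \<Otimes>\<^sub>M borel)" by simp
  have "emeasure ?L A = (\<integral>\<^sup>+p. indicator A p \<partial>?L)"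
    using A by simp
  also have "\<dots> = (\<integral>\<^sup>+p. indicator A (fst p, chan s p) \<partial>P)"
    by (subst nn_integral_distr) auto
  also have "\<dots> = (\<integral>\<^sup>+x. (\<integral>\<^sup>+z. indicator A (x, chan s (x, z)) \<partial>std_gauss) \<partial>\<mu>)"
    by (subst std_gauss.nn_integral_fst[symmetric]) auto
  also have "\<dots> = (\<integral>\<^sup>+x. (\<integral>\<^sup>+y. ennreal (mehler s x y) * indicator A (x, y) \<partial>std_gauss) \<partial>\<mu>)"
  proof (rule nn_integral_cong)
    fix x
    have "(\<integral>\<^sup>+z. indicator A (x, chan s (x, z)) \<partial>std_gauss)
      = (\<integral>\<^sup>+y. indicator A (x, y) \<partial>distr std_gauss borel (\<lambda>z. sqrt s *\<^sub>R x + sqrt (1 - s) *\<^sub>R z))"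
      by (subst nn_integral_distr) (auto simp: chan_def)
    then show "(\<integral>\<^sup>+z. indicator A (x, chan s (x, z)) \<partial>std_gauss)
      = (\<integral>\<^sup>+y. ennreal (mehler s x y) * indicator A (x, y) \<partial>std_gauss)"
      unfolding distr_mehler[OF s] by (simp add: nn_integral_density)
  qed
  also have "\<dots> = (\<integral>\<^sup>+p. ennreal (mehler s (fst p) (snd p)) * indicator A p \<partial>P)"
    by (subst std_gauss.nn_integral_fst[symmetric]) auto
  also have "\<dots> = emeasure ?R A"
    by (subst emeasure_density) auto
  finally show "emeasure ?L A = emeasure ?R A" .
qed

lemma integral_joint:
  fixes F :: "'a \<times> 'a \<Rightarrow> 'b::{banach, second_countable_topology}"
  assumes s: "s < 1" and [measurable]: "F \<in> borel_measurable (borel \<Otimes>\<^sub>M borel)"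
  shows "(\<integral>p. F (fst p, chan s p) \<partial>P) = (\<integral>p. mehler s (fst p) (snd p) *\<^sub>R F p \<partial>P)"
    and "integrable P (\<lambda>p. F (fst p, chan s p)) \<longleftrightarrow> integrable P (\<lambda>p. mehler s (fst p) (snd p) *\<^sub>R F p)"
proof -
  have "(\<integral>p. F (fst p, chan s p) \<partial>P) = (\<integral>p. F p \<partial>distr P (borel \<Otimes>\<^sub>M borel) (\<lambda>p. (fst p, chan s p)))"
    by (subst integral_distr) auto
  also have "\<dots> = (\<integral>p. mehler s (fst p) (snd p) *\<^sub>R F p \<partial>P)"
    unfolding distr_joint[OF s]
    by (subst integral_density) (auto simp: mehler_pos[OF s, THEN less_imp_le])
  finally show "(\<integral>p. F (fst p, chan s p) \<partial>P) = (\<integral>p. mehler s (fst p) (snd p) *\<^sub>R F p \<partial>P)" .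
  have "integrable P (\<lambda>p. F (fst p, chan s p))
      \<longleftrightarrow> integrable (distr P (borel \<Otimes>\<^sub>M borel) (\<lambda>p. (fst p, chan s p))) F"
    by (subst integrable_distr_eq) auto
  also have "\<dots> \<longleftrightarrow> integrable P (\<lambda>p. mehler s (fst p) (snd p) *\<^sub>R F p)"
    unfolding distr_joint[OF s]
    by (subst integrable_density) (auto simp: mehler_pos[OF s, THEN less_imp_le])
  finally show "integrable P (\<lambda>p. F (fst p, chan s p))
    \<longleftrightarrow> integrable P (\<lambda>p. mehler s (fst p) (snd p) *\<^sub>R F p)" .
qed

definition dens :: "real \<Rightarrow> 'a \<Rightarrow> real" where
  "dens s y = (\<integral>x. mehler s x y \<partial>\<mu>)"

lemma mehler_le: "s < 1 \<Longrightarrow> mehler s x y \<le> inverse (sqrt (1 - s)) ^ DIM('a) * exp ((norm y)\<^sup>2 / 2)"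
  for x y :: 'a
  unfolding mehler_def by (intro mult_left_mono) auto

lemma integrable_mehler: "s < 1 \<Longrightarrow> integrable \<mu> (\<lambda>x. mehler s x y)"
  by (rule integrable_const_bound[where B="inverse (sqrt (1 - s)) ^ DIM('a) * exp ((norm y)\<^sup>2 / 2)"])
     (auto simp: mehler_le abs_of_pos[OF mehler_pos])

lemma dens_pos: 
  assumes s: "s < 1" shows "0 < dens s y"
proof -
  have "dens s y \<noteq> 0"
  proof
    assume "dens s y = 0"
    then have "AE x in \<mu>. mehler s x y = 0"
      unfolding dens_def
      by (subst (asm) integral_nonneg_eq_0_iff_AE)
         (auto simp: integrable_mehler[OF s] mehler_pos[OF s, THEN less_imp_le])
    then have "AE x in \<mu>. False"
      by eventually_elim (use mehler_pos[OF s] in \<open>metis less_irrefl\<close>)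
    then show False by simp
  qed
  moreover have "0 \<le> dens s y"
    unfolding dens_def by (rule Bochner_Integration.integral_nonneg) (simp add: mehler_pos[OF s] less_imp_le)
  ultimately show ?thesis by simp
qed

lemma measurable_dens [measurable]: "dens s \<in> borel_measurable borel"
proof -
  have "(\<lambda>(y, x). mehler s x y) \<in> borel_measurable (borel \<Otimes>\<^sub>M \<mu>)"
    unfolding mehler_def by measurable
  then show ?thesis unfolding dens_def[abs_def] by (rule borel_measurable_lebesgue_integral)
qed

lemma distr_chan:
  assumes s: "s < 1"
  shows "distr P borel (chan s) = density std_gauss (dens s)" (is "?L = ?R")
proof (rule measure_eqI)
  fix A assume "A \<in> sets ?L"
  then have A [measurable]: "A \<in> sets borel" by simp
  have "emeasure ?L A = (\<integral>\<^sup>+p. indicator A (snd p) \<partial>distr P (borel \<Otimes>\<^sub>M borel) (\<lambda>p. (fst p, chan s p)))"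
    using A by (simp add: nn_integral_distr nn_integral_indicator[symmetric] del: nn_integral_indicator)
  also have "\<dots> = (\<integral>\<^sup>+p. ennreal (mehler s (fst p) (snd p)) * indicator A (snd p) \<partial>P)"
    unfolding distr_joint[OF s] by (subst nn_integral_density) auto
  also have "\<dots> = (\<integral>\<^sup>+y. (\<integral>\<^sup>+x. ennreal (mehler s x y) * indicator A y \<partial>\<mu>) \<partial>std_gauss)"
    by (subst P.nn_integral_snd[symmetric]) (auto simp: split_beta')
  also have "\<dots> = (\<integral>\<^sup>+y. ennreal (dens s y) * indicator A y \<partial>std_gauss)"
    unfolding dens_def
    by (simp add: nn_integral_multc nn_integral_eq_integral integrable_mehler[OF s] mehler_pos[OF s, THEN less_imp_le])
  also have "\<dots> = emeasure ?R A" by (simp add: emeasure_density)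
  finally show "emeasure ?L A = emeasure ?R A" .
qed simp

lemma integral_chan:
  fixes F :: "'a \<Rightarrow> 'b::{banach, second_countable_topology}"
  assumes s: "s < 1" and [measurable]: "F \<in> borel_measurable borel"
  shows "(\<integral>p. F (chan s p) \<partial>P) = (\<integral>y. dens s y *\<^sub>R F y \<partial>std_gauss)"
    and "integrable P (\<lambda>p. F (chan s p)) \<longleftrightarrow> integrable std_gauss (\<lambda>y. dens s y *\<^sub>R F y)"
proof -
  have "(\<integral>p. F (chan s p) \<partial>P) = (\<integral>p. F p \<partial>distr P borel (chan s))"
    by (subst integral_distr) auto
  then show "(\<integral>p. F (chan s p) \<partial>P) = (\<integral>y. dens s y *\<^sub>R F y \<partial>std_gauss)"
    unfolding distr_chan[OF s]
    by (subst (asm) integral_density) (auto simp: dens_pos[OF s, THEN less_imp_le])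
  have "integrable P (\<lambda>p. F (chan s p)) \<longleftrightarrow> integrable (distr P borel (chan s)) F"
    by (subst integrable_distr_eq) auto
  then show "integrable P (\<lambda>p. F (chan s p)) \<longleftrightarrow> integrable std_gauss (\<lambda>y. dens s y *\<^sub>R F y)"
    unfolding distr_chan[OF s]
    by (subst (asm) integrable_density) (auto simp: dens_pos[OF s, THEN less_imp_le])
qed

lemma integrable_bounded:
  fixes F :: "'a \<times> 'a \<Rightarrow> 'b::{banach, second_countable_topology}"
  assumes [measurable]: "F \<in> borel_measurable (borel \<Otimes>\<^sub>M borel)" and "\<And>p. norm (F p) \<le> B"
  shows "integrable P F"
  using assms(2) by (intro P.integrable_const_bound[where B=B]) auto

end

interpretation G: borel_prob "std_gauss :: 'a::euclidean_space measure"
  by unfold_locales simp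

text \<open>Stationarity of the Gaussian, from the symmetry of the kernel. Both the semigroup law
  \<open>heat_heat\<close> and the mass computation in \<open>data_processing\<close> rest on
  it.\<close>

lemma dens_std_gauss: "0 \<le> s \<Longrightarrow> s < 1 \<Longrightarrow> G.dens s y = 1"
  unfolding G.dens_def
  using nn_integral_eq_integral[OF G.integrable_mehler, of s y] nn_integral_mehler'[of s y]
  by (simp add: mehler_pos[THEN less_imp_le])

lemma integral_chan_std_gauss:
  fixes F :: "'a::euclidean_space \<Rightarrow> 'b::{banach, second_countable_topology}"
  assumes s: "0 \<le> s" "s < 1" and [measurable]: "F \<in> borel_measurable borel"
  shows "(\<integral>p. F (chan s p) \<partial>(std_gauss \<Otimes>\<^sub>M std_gauss)) = (\<integral>y. F y \<partial>std_gauss)"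
  using assms by (simp add: G.integral_chan dens_std_gauss)

section \<open>The heat semigroup\<close>

text \<open>This class is closed under squares, affine substitution and the heat flow, so
  integrability is automatic under every probability measure that occurs.\<close>

definition bdd_meas :: "('a::euclidean_space \<Rightarrow> real) \<Rightarrow> bool" where
  "bdd_meas k \<longleftrightarrow> k \<in> borel_measurable borel \<and> (\<exists>B. \<forall>x. \<bar>k x\<bar> \<le> B)"

lemma bdd_meas_measurable: "bdd_meas k \<Longrightarrow> k \<in> borel_measurable borel"
  by (simp add: bdd_meas_def)

lemma bdd_meas_bound: 
  assumes "bdd_meas k" obtains B where "0 \<le> B" "\<And>x. \<bar>k x\<bar> \<le> B"
proof -
  from assms obtain B where "\<And>x. \<bar>k x\<bar> \<le> B" by (auto simp: bdd_meas_def)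
  moreover from this have "0 \<le> B" using order_trans[OF abs_ge_zero] by blast
  ultimately show ?thesis using that by blast
qed

lemma bdd_meas_power2: "bdd_meas k \<Longrightarrow> bdd_meas (\<lambda>x. (k x)\<^sup>2)"
proof -
  assume k: "bdd_meas k"
  then obtain B where B: "0 \<le> B" "\<And>x. \<bar>k x\<bar> \<le> B" by (rule bdd_meas_bound) blast
  have "\<bar>(k x)\<^sup>2\<bar> \<le> B\<^sup>2" for x
    using power_mono[OF B(2)[of x], of 2] by simp
  then show ?thesis using k unfolding bdd_meas_def by auto
qed

lemma bdd_meas_comp_affine: "bdd_meas k \<Longrightarrow> bdd_meas (\<lambda>x. k (a + c *\<^sub>R x))"
  unfolding bdd_meas_def by auto

lemma (in prob_space) bdd_meas_integrable:
  assumes "bdd_meas k" "g \<in> borel_measurable M"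
  shows "integrable M (\<lambda>x. k (g x))"
proof -
  note [measurable] = bdd_meas_measurable[OF assms(1)] assms(2)
  obtain B where "0 \<le> B" "\<And>x. \<bar>k x\<bar> \<le> B" using assms(1) by (rule bdd_meas_bound) blast
  then show ?thesis by (intro integrable_const_bound[where B=B]) auto
qed

text \<open>Here r is a noise variance: when \<open>Y\<^sub>T\<close> arises from
  \<open>Y\<^sub>r\<close> by independent noise, \<open>heat (T - r) k y\<close> is the conditional
  expectation of \<open>k(Y\<^sub>T)\<close> given \<open>Y\<^sub>r = y\<close>.\<close>

definition heat :: "real \<Rightarrow> ('a::euclidean_space \<Rightarrow> real) \<Rightarrow> 'a \<Rightarrow> real" where
  "heat r k x = (\<integral>z. k (x + sqrt r *\<^sub>R z) \<partial>std_gauss)"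

lemma heat_0 [simp]: "heat 0 k = k"
  by (simp add: heat_def fun_eq_iff)

lemma heat_bdd_meas: 
  assumes k: "bdd_meas k" shows "bdd_meas (heat r k)"
proof -
  note [measurable] = bdd_meas_measurable[OF k]
  obtain B where B: "0 \<le> B" "\<And>x. \<bar>k x\<bar> \<le> B" using k by (rule bdd_meas_bound) blast
  have "(\<lambda>(x, z). k (x + sqrt r *\<^sub>R z)) \<in> borel_measurable (borel \<Otimes>\<^sub>M std_gauss)" by measurable
  then have "heat r k \<in> borel_measurable borel"
    unfolding heat_def[abs_def] by (rule std_gauss.borel_measurable_lebesgue_integral)
  moreover have "\<bar>heat r k x\<bar> \<le> B" for x
  proof -
    have "\<bar>heat r k x\<bar> \<le> (\<integral>z. \<bar>k (x + sqrt r *\<^sub>R z)\<bar> \<partial>std_gauss)"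
      unfolding heat_def using integral_norm_bound[of std_gauss "\<lambda>z. k (x + sqrt r *\<^sub>R z)"] by simp
    also have "\<dots> \<le> (\<integral>z. B \<partial>(std_gauss :: 'a measure))"
      using B by (intro integral_mono integrable_abs std_gauss.bdd_meas_integrable[OF k]) auto
    finally show ?thesis by simp
  qed
  ultimately show ?thesis unfolding bdd_meas_def by blast
qed

lemma heat_mono:
  assumes "bdd_meas k" "bdd_meas l" "\<And>x. k x \<le> l x"
  shows "heat r k x \<le> heat r l x"
  unfolding heat_def using assms
  by (intro integral_mono std_gauss.bdd_meas_integrable) auto

lemma heat_as_pair:
  assumes k: "bdd_meas k" 
  shows "heat a (heat b k) x
    = (\<integral>p. k (x + sqrt a *\<^sub>R fst p + sqrt b *\<^sub>R snd p) \<partial>(std_gauss \<Otimes>\<^sub>M std_gauss))"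
proof -
  note [measurable] = bdd_meas_measurable[OF k]
  have "integrable (std_gauss \<Otimes>\<^sub>M std_gauss) (\<lambda>(y, z). k (x + sqrt a *\<^sub>R y + sqrt b *\<^sub>R z))"
    unfolding split_beta' by (rule G.P.bdd_meas_integrable[OF k]) measurable
  from G.P.integral_fst'[OF this] show ?thesis
    unfolding heat_def by (simp add: split_beta')
qed

text \<open>After division by \<open>sqrt (a + b)\<close>, two independent Gaussian increments form
  the channel with \<open>s = a / (a + b)\<close> applied to a Gaussian input, and that channel
  preserves the Gaussian.\<close>

lemma heat_heat:
  assumes k: "bdd_meas k" and ab: "0 \<le> a" "0 \<le> b"
  shows "heat a (heat b k) x = heat (a + b) k x"
\<comment> \<open>For \<open>b = 0\<close> and \<open>a > 0\<close> the parameter s would be 1,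
  outside the range of the channel lemmas.\<close>
proof (cases "b = 0")
  case False
  note [measurable] = bdd_meas_measurable[OF k]
  define s where "s = a / (a + b)"
  have s: "0 \<le> s" "s < 1" "1 - s = b / (a + b)" and pos: "a + b > 0"
    using ab False by (auto simp: s_def field_simps)
  have "x + sqrt a *\<^sub>R fst p + sqrt b *\<^sub>R snd p = x + sqrt (a + b) *\<^sub>R chan s p" for p :: "'a \<times> 'a"
    unfolding chan_def s(3) unfolding s_def using pos
    by (simp add: scaleR_add_right real_sqrt_mult[symmetric])
  then have "heat a (heat b k) x = (\<integral>p. k (x + sqrt (a + b) *\<^sub>R chan s p) \<partial>(std_gauss \<Otimes>\<^sub>M std_gauss))"
    by (simp only: heat_as_pair[OF k])
  also have "\<dots> = heat (a + b) k x"
    unfolding heat_def by (subst integral_chan_std_gauss[OF s(1,2), symmetric]) auto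
  finally show ?thesis .
qed simp

lemma heat_square_le:
  assumes k: "bdd_meas k"
  shows "(heat r k x)\<^sup>2 \<le> heat r (\<lambda>y. (k y)\<^sup>2) x"
proof -
  have i: "integrable std_gauss (\<lambda>z. k (x + sqrt r *\<^sub>R z))"
    "integrable std_gauss (\<lambda>z. (k (x + sqrt r *\<^sub>R z))\<^sup>2)"
    by (auto intro!: std_gauss.bdd_meas_integrable[OF k] std_gauss.bdd_meas_integrable[OF bdd_meas_power2[OF k]])
  show ?thesis
    using std_gauss.variance_positive[of "\<lambda>z. k (x + sqrt r *\<^sub>R z)"] std_gauss.variance_eq[OF i]
    by (simp add: heat_def)
qed

text \<open>Expand the mean square of \<open>a - e1 - e2 + m\<close>, the pure interaction term of
  the Hoeffding decomposition. After subtracting squared means, the claim is that the variances of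
  the two partial averages add up to at most the variance of \<open>a\<close>.\<close>

lemma (in pair_prob_space) efron_stein:
  fixes a :: "'a \<times> 'b \<Rightarrow> real"
  assumes [measurable]: "a \<in> borel_measurable (M1 \<Otimes>\<^sub>M M2)" and B: "\<And>p. \<bar>a p\<bar> \<le> B"
  shows "(\<integral>x. (\<integral>y. a (x, y) \<partial>M2)\<^sup>2 \<partial>M1) + (\<integral>y. (\<integral>x. a (x, y) \<partial>M1)\<^sup>2 \<partial>M2)
    \<le> (\<integral>p. (a p)\<^sup>2 \<partial>(M1 \<Otimes>\<^sub>M M2)) + (\<integral>p. a p \<partial>(M1 \<Otimes>\<^sub>M M2))\<^sup>2"
proof -
  let ?P = "M1 \<Otimes>\<^sub>M M2"
  define e1 where "e1 x = (\<integral>y. a (x, y) \<partial>M2)" for x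
  define e2 where "e2 y = (\<integral>x. a (x, y) \<partial>M1)" for y
  define m where "m = (\<integral>p. a p \<partial>?P)"
  have B0: "0 \<le> B" using order_trans[OF abs_ge_zero B] .
  have m1 [measurable]: "e1 \<in> borel_measurable M1"
    unfolding e1_def[abs_def] by measurable
  have m2 [measurable]: "e2 \<in> borel_measurable M2"
    unfolding e2_def[abs_def] by measurable
  \<comment> \<open>A Bochner integral of a non-integrable function is 0, which also obeys the
    bound, so integrability of the slices need not be settled first.\<close>
  have bnd: "\<bar>\<integral>y. f y \<partial>N\<bar> \<le> B"
    if N: "prob_space N" and f: "\<And>y. \<bar>f y\<bar> \<le> B" for N :: "'z measure" and f
  proof -
    interpret N: prob_space N by (rule N)
    show ?thesis
    proof (cases "integrable N f")
      case True
      have "\<bar>\<integral>y. f y \<partial>N\<bar> \<le> (\<integral>y. \<bar>f y\<bar> \<partial>N)" using integral_norm_bound[of N f] by simp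
      also have "\<dots> \<le> (\<integral>y. B \<partial>N)" using True f by (intro integral_mono) auto
      finally show ?thesis by (simp add: N.prob_space)
    qed (simp add: not_integrable_integral_eq B0)
  qed
  have b1: "\<bar>e1 x\<bar> \<le> B" for x unfolding e1_def by (rule bnd) (auto intro: M2.prob_space_axioms B)
  have b2: "\<bar>e2 x\<bar> \<le> B" for x unfolding e2_def by (rule bnd) (auto intro: M1.prob_space_axioms B)
  have int: "integrable ?P f" if [measurable]: "f \<in> borel_measurable ?P" and "\<And>p. \<bar>f p\<bar> \<le> B * B" for f :: "_ \<Rightarrow> real"
    using that by (intro P.integrable_const_bound[where B="B * B"]) auto
  have int': "integrable ?P f" if [measurable]: "f \<in> borel_measurable ?P" and "\<And>p. \<bar>f p\<bar> \<le> B" for f :: "_ \<Rightarrow> real"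
    using that by (intro P.integrable_const_bound[where B=B]) auto
  have prod: "\<bar>u * v\<bar> \<le> B * B" if "\<bar>u\<bar> \<le> B" "\<bar>v\<bar> \<le> B" for u v
    using that B0 by (simp add: abs_mult mult_mono)
  have ia [simp]: "integrable ?P a" by (rule int') (auto intro: B)
  have i1 [simp]: "integrable ?P (\<lambda>p. e1 (fst p))" by (rule int') (auto intro: b1)
  have i2 [simp]: "integrable ?P (\<lambda>p. e2 (snd p))" by (rule int') (auto intro: b2)
  have iaa [simp]: "integrable ?P (\<lambda>p. a p * a p)" by (rule int) (measurable, intro prod B)
  have ia1 [simp]: "integrable ?P (\<lambda>p. a p * e1 (fst p))" by (rule int) (measurable, intro prod B b1)
  have ia2 [simp]: "integrable ?P (\<lambda>p. a p * e2 (snd p))" by (rule int) (measurable, intro prod B b2)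
  have i11 [simp]: "integrable ?P (\<lambda>p. e1 (fst p) * e1 (fst p))" by (rule int) (measurable, intro prod b1)
  have i22 [simp]: "integrable ?P (\<lambda>p. e2 (snd p) * e2 (snd p))" by (rule int) (measurable, intro prod b2)
  have i12 [simp]: "integrable ?P (\<lambda>p. e1 (fst p) * e2 (snd p))" by (rule int) (measurable, intro prod b1 b2)
  have fub1: "(\<integral>p. f p \<partial>?P) = (\<integral>x. \<integral>y. f (x, y) \<partial>M2 \<partial>M1)" if "integrable ?P f" for f :: "_ \<Rightarrow> real"
    using integral_fst'[OF that] by simp
  have fub2: "(\<integral>p. f p \<partial>?P) = (\<integral>y. \<integral>x. f (x, y) \<partial>M1 \<partial>M2)" if "integrable ?P f" for f :: "_ \<Rightarrow> real"
    using integral_snd[of "\<lambda>x y. f (x, y)"] that by simp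
  have E1: "(\<integral>p. e1 (fst p) \<partial>?P) = m"
    unfolding m_def using fub1[OF i1] fub1[OF ia] by (simp add: M2.prob_space e1_def[symmetric])
  have E2: "(\<integral>p. e2 (snd p) \<partial>?P) = m"
    unfolding m_def using fub2[OF i2] fub2[OF ia] by (simp add: M1.prob_space e2_def[symmetric])
  have E11: "(\<integral>p. e1 (fst p) * e1 (fst p) \<partial>?P) = (\<integral>x. e1 x * e1 x \<partial>M1)"
    by (simp add: fub1 M2.prob_space)
  have E22: "(\<integral>p. e2 (snd p) * e2 (snd p) \<partial>?P) = (\<integral>x. e2 x * e2 x \<partial>M2)"
    by (simp add: fub2 M1.prob_space)
  have Ea1: "(\<integral>p. a p * e1 (fst p) \<partial>?P) = (\<integral>x. e1 x * e1 x \<partial>M1)"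
    by (simp add: fub1) (simp add: e1_def)
  have Ea2: "(\<integral>p. a p * e2 (snd p) \<partial>?P) = (\<integral>x. e2 x * e2 x \<partial>M2)"
    by (simp add: fub2) (simp add: e2_def)
  have E12: "(\<integral>p. e1 (fst p) * e2 (snd p) \<partial>?P) = m * m"
  proof -
    have "(\<integral>p. e1 (fst p) * e2 (snd p) \<partial>?P) = (\<integral>x. e1 x \<partial>M1) * (\<integral>y. e2 y \<partial>M2)"
      by (simp add: fub1)
    also have "\<dots> = m * m"
      using E1 E2 by (simp add: fub1[OF i1] fub2[OF i2] M1.prob_space M2.prob_space)
    finally show ?thesis .
  qed
  have "0 \<le> (\<integral>p. (a p - e1 (fst p) - e2 (snd p) + m)\<^sup>2 \<partial>?P)" by simp
  also have "\<dots> = (\<integral>p. a p * a p + e1 (fst p) * e1 (fst p) + e2 (snd p) * e2 (snd p) + m * m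
      - 2 * (a p * e1 (fst p)) - 2 * (a p * e2 (snd p)) + 2 * m * a p
      + 2 * (e1 (fst p) * e2 (snd p)) - 2 * m * e1 (fst p) - 2 * m * e2 (snd p) \<partial>?P)"
    by (intro Bochner_Integration.integral_cong refl) (simp add: power2_eq_square algebra_simps)
  also have "\<dots> = (\<integral>p. a p * a p \<partial>?P) + m * m - (\<integral>x. e1 x * e1 x \<partial>M1) - (\<integral>y. e2 y * e2 y \<partial>M2)"
    by (simp add: E1 E2 E11 E22 Ea1 Ea2 E12 P.prob_space) (simp add: m_def[symmetric])
  finally show ?thesis
    by (simp add: e1_def e2_def m_def power2_eq_square)
qed

text \<open>Apply \<open>efron_stein\<close> to two noise increments of the same variance d. The
  integrand is symmetric in them, so the two partial averages have equal square means; this is the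
  factor 2.\<close>

lemma heat_midpoint:
  assumes k: "bdd_meas k" and d: "0 \<le> d"
  shows "2 * heat d (\<lambda>y. (heat d k y)\<^sup>2) x \<le> heat (d + d) (\<lambda>y. (k y)\<^sup>2) x + (heat (d + d) k x)\<^sup>2"
proof -
  note [measurable] = bdd_meas_measurable[OF k]
  obtain B where B: "0 \<le> B" "\<And>x. \<bar>k x\<bar> \<le> B" using k by (rule bdd_meas_bound) blast
  let ?a = "\<lambda>p. k (x + sqrt d *\<^sub>R fst p + sqrt d *\<^sub>R snd p)"
  have "(\<integral>u. (\<integral>v. ?a (u, v) \<partial>std_gauss)\<^sup>2 \<partial>std_gauss) + (\<integral>v. (\<integral>u. ?a (u, v) \<partial>std_gauss)\<^sup>2 \<partial>std_gauss)
    \<le> (\<integral>p. (?a p)\<^sup>2 \<partial>(std_gauss \<Otimes>\<^sub>M std_gauss)) + (\<integral>p. ?a p \<partial>(std_gauss \<Otimes>\<^sub>M std_gauss))\<^sup>2"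
    by (rule G.P.efron_stein[where B=B]) (use B in auto)
  moreover have "(\<integral>u. (\<integral>v. ?a (u, v) \<partial>std_gauss)\<^sup>2 \<partial>std_gauss) = heat d (\<lambda>y. (heat d k y)\<^sup>2) x"
    by (simp add: heat_def)
  moreover have "(\<integral>v. (\<integral>u. ?a (u, v) \<partial>std_gauss)\<^sup>2 \<partial>std_gauss) = heat d (\<lambda>y. (heat d k y)\<^sup>2) x"
    by (simp add: heat_def ac_simps)
  moreover have "(\<integral>p. (?a p)\<^sup>2 \<partial>(std_gauss \<Otimes>\<^sub>M std_gauss)) = heat (d + d) (\<lambda>y. (k y)\<^sup>2) x"
    using heat_as_pair[OF bdd_meas_power2[OF k], of d d x] heat_heat[OF bdd_meas_power2[OF k] d d, of x] by simp
  moreover have "(\<integral>p. ?a p \<partial>(std_gauss \<Otimes>\<^sub>M std_gauss)) = heat (d + d) k x"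
    using heat_as_pair[OF k, of d d x] heat_heat[OF k d d, of x] by simp
  ultimately show ?thesis by simp
qed

text \<open>The gradient of \<open>heat r k\<close> after Gaussian integration by parts: k itself is
  never differentiated.\<close>

definition heat_grad :: "real \<Rightarrow> ('a::euclidean_space \<Rightarrow> real) \<Rightarrow> 'a \<Rightarrow> 'a" where
  "heat_grad r k x = (1 / sqrt r) *\<^sub>R (\<integral>z. k (x + sqrt r *\<^sub>R z) *\<^sub>R z \<partial>std_gauss)"

lemma integrable_bdd_times_id:
  assumes k: "bdd_meas k"
  shows "integrable std_gauss (\<lambda>z. k z *\<^sub>R z)"
proof -
  note [measurable] = bdd_meas_measurable[OF k]
  obtain B where B: "0 \<le> B" "\<And>x. \<bar>k x\<bar> \<le> B" using k by (rule bdd_meas_bound) blast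
  show ?thesis
  proof (rule Bochner_Integration.integrable_bound)
    show "integrable std_gauss (\<lambda>z::'a. B * norm z)"
      by (intro integrable_mult_right integrable_std_gauss_norm)
    show "AE z in std_gauss. norm (k z *\<^sub>R z) \<le> norm (B * norm z)"
      using B by (auto simp: abs_mult intro!: mult_right_mono)
  qed measurable
qed

lemma mult_le_half_squares: "u * v \<le> (u\<^sup>2 + v\<^sup>2) / 2" for u v :: real
  using sum_squares_bound[of u v] by simp

text \<open>The norm of the projection of k onto the centered Gaussian coordinates is at most its
  standard deviation. Pair \<open>k - c\<close> with the linear function in the direction
  \<open>e\<close> of the projection itself; half of \<open>(norm e)\<^sup>2\<close> is then
  absorbed on the left.\<close>

lemma std_gauss_bessel:
  assumes k: "bdd_meas k"
  shows "(norm (\<integral>z. k z *\<^sub>R z \<partial>std_gauss))\<^sup>2 \<le> (\<integral>z. (k z)\<^sup>2 \<partial>std_gauss) - (\<integral>z. k z \<partial>std_gauss)\<^sup>2"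
proof -
  note [measurable] = bdd_meas_measurable[OF k]
  define e where "e = (\<integral>z. k z *\<^sub>R z \<partial>std_gauss)"
  define c where "c = (\<integral>z. k z \<partial>std_gauss)"
  have i: "integrable std_gauss k" "integrable std_gauss (\<lambda>z. (k z)\<^sup>2)"
    by (auto intro!: std_gauss.bdd_meas_integrable[OF k] std_gauss.bdd_meas_integrable[OF bdd_meas_power2[OF k]])
  note ik = integrable_bdd_times_id[OF k]
  have ike: "integrable std_gauss (\<lambda>z. k z * (z \<bullet> e))"
    using integrable_inner_left[of e, OF ik] by simp
  have "(norm e)\<^sup>2 = (\<integral>z. k z *\<^sub>R z \<partial>std_gauss) \<bullet> e" by (simp add: e_def power2_norm_eq_inner)
  also have "\<dots> = (\<integral>z. k z * (z \<bullet> e) \<partial>std_gauss)"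
    using integral_inner_left[of e, OF ik] by simp
  also have "\<dots> = (\<integral>z. (k z - c) * (z \<bullet> e) \<partial>std_gauss)"
    using ike by (simp add: left_diff_distrib std_gauss_mean_zero)
  also have "\<dots> \<le> (\<integral>z. ((k z - c)\<^sup>2 + (z \<bullet> e)\<^sup>2) / 2 \<partial>std_gauss)"
  proof (rule integral_mono)
    show "integrable std_gauss (\<lambda>z. (k z - c) * (z \<bullet> e))"
      using ike by (simp add: left_diff_distrib)
    show "integrable std_gauss (\<lambda>z. ((k z - c)\<^sup>2 + (z \<bullet> e)\<^sup>2) / 2)"
      using i by (simp add: power2_diff integrable_std_gauss_inner_sq)
    show "(k z - c) * (z \<bullet> e) \<le> ((k z - c)\<^sup>2 + (z \<bullet> e)\<^sup>2) / 2" for z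
      by (rule mult_le_half_squares)
  qed
  also have "\<dots> = ((\<integral>z. (k z - c)\<^sup>2 \<partial>std_gauss) + (\<integral>z. (z \<bullet> e)\<^sup>2 \<partial>std_gauss)) / 2"
    using i by (simp add: power2_diff integrable_std_gauss_inner_sq)
  also have "\<dots> \<le> ((\<integral>z. (k z - c)\<^sup>2 \<partial>std_gauss) + (norm e)\<^sup>2) / 2"
    using std_gauss_inner_sq_le[of e] by simp
  finally have "(norm e)\<^sup>2 \<le> (\<integral>z. (k z - c)\<^sup>2 \<partial>std_gauss)" by simp
  then show ?thesis
    using std_gauss.variance_eq[OF i] by (simp add: c_def e_def)
qed

lemma heat_grad_sq_le:
  assumes k: "bdd_meas k" and r: "0 < r"
  shows "r * (norm (heat_grad r k x))\<^sup>2 \<le> heat r (\<lambda>y. (k y)\<^sup>2) x - (heat r k x)\<^sup>2"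
  using std_gauss_bessel[OF bdd_meas_comp_affine[OF k, of x "sqrt r"]] r
  by (simp add: heat_grad_def heat_def power_mult_distrib power_divide)

lemma bdd_meas_heat_grad_bound:
  assumes k: "bdd_meas k" and r: "0 < r"
  obtains B where "\<And>x. norm (heat_grad r k x) \<le> B"
proof -
  obtain B where B: "0 \<le> B" "\<And>x. \<bar>heat r (\<lambda>y. (k y)\<^sup>2) x\<bar> \<le> B"
    using heat_bdd_meas[OF bdd_meas_power2[OF k]] by (rule bdd_meas_bound) blast
  have "norm (heat_grad r k x) \<le> sqrt (B / r)" for x
  proof (rule real_le_rsqrt)
    have "r * (norm (heat_grad r k x))\<^sup>2 \<le> B"
      using heat_grad_sq_le[OF k r, of x] B(2)[of x] zero_le_power2[of "heat r k x"] by linarith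
    then show "(norm (heat_grad r k x))\<^sup>2 \<le> B / r" using r by (simp add: field_simps)
  qed
  then show ?thesis using that by blast
qed

lemma has_derivative_quadratic_remainder:
  fixes f :: "'a::euclidean_space \<Rightarrow> real"
  assumes e: "0 < e" and bound: "\<And>h. norm h \<le> e \<Longrightarrow> \<bar>f (x + h) - f x - g \<bullet> h\<bar> \<le> K * (norm h)\<^sup>2"
  shows "(f has_derivative (\<lambda>h. g \<bullet> h)) (at x)"
proof (rule has_derivativeI_sandwich[OF e])
  show "bounded_linear (\<lambda>h. g \<bullet> h)" by (rule bounded_linear_inner_right)
  show "((\<lambda>y. K * norm (y - x)) \<longlongrightarrow> 0) (at x)"
    by (auto intro!: tendsto_eq_intros)
  fix y assume "y \<noteq> x" "dist y x < e"
  then show "norm (f y - f x - g \<bullet> (y - x)) / norm (y - x) \<le> K * norm (y - x)"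
    using bound[of "y - x"] by (simp add: dist_norm field_simps power2_eq_square)
qed

text \<open>The square mean of the remainder is explicit. With \<open>n = (norm h)\<^sup>2\<close>
  it is at most \<open>exp n - 1 - n \<le> n\<^sup>2\<close>, where the mixed term comes from the
  shift formula. Jensen's inequality passes to the first absolute moment.\<close>

lemma std_gauss_exp_remainder:
  fixes h :: "'a::euclidean_space"
  assumes h: "norm h \<le> 1"
  shows "integrable std_gauss (\<lambda>z. \<bar>exp (h \<bullet> z - (norm h)\<^sup>2 / 2) - 1 - h \<bullet> z\<bar>)"
    and "(\<integral>z. \<bar>exp (h \<bullet> z - (norm h)\<^sup>2 / 2) - 1 - h \<bullet> z\<bar> \<partial>std_gauss) \<le> (norm h)\<^sup>2"
proof -
  let ?n = "(norm h)\<^sup>2"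
  let ?e = "\<lambda>z::'a. exp (h \<bullet> z - (norm h)\<^sup>2 / 2)"
  let ?g = "\<lambda>z. ?e z - 1 - h \<bullet> z"
  have nonneg: "0 \<le> ?e z" for z by simp
  have n1: "?n \<le> 1" using power_mono[OF h, of 2] by simp
  have i1: "integrable std_gauss ?e" and e1: "(\<integral>z. ?e z \<partial>std_gauss) = 1"
    using std_gauss_mgf[of h] by (auto simp: has_bochner_integral_iff exp_diff)
  have "(?e z)\<^sup>2 = exp ((2 *\<^sub>R h) \<bullet> z) * exp (- ?n)" for z
    by (simp add: power2_eq_square exp_add[symmetric])
  moreover have "exp (2 * ?n) * exp (- ?n) = exp ?n"
    unfolding exp_add[symmetric] by simp
  ultimately have i2: "integrable std_gauss (\<lambda>z. (?e z)\<^sup>2)" and e2: "(\<integral>z. (?e z)\<^sup>2 \<partial>std_gauss) = exp ?n"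
    using std_gauss_mgf[of "2 *\<^sub>R h"] by (auto simp: has_bochner_integral_iff power_mult_distrib)
  have ih: "integrable std_gauss (\<lambda>z. h \<bullet> z)" and eh: "(\<integral>z. h \<bullet> z \<partial>std_gauss) = 0"
    by (simp_all add: std_gauss_mean_zero)
  have ih2: "integrable std_gauss (\<lambda>z. (h \<bullet> z)\<^sup>2)" and eh2: "(\<integral>z. (h \<bullet> z)\<^sup>2 \<partial>std_gauss) \<le> ?n"
    using integrable_std_gauss_inner_sq[of h] std_gauss_inner_sq_le[of h] by (simp_all add: inner_commute)
  have ish: "integrable std_gauss (\<lambda>z. h \<bullet> (h + z))" and esh: "(\<integral>z. h \<bullet> (h + z) \<partial>std_gauss) = ?n"
    using ih eh by (simp_all add: inner_add_right power2_norm_eq_inner)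
  have "integrable (distr std_gauss borel (\<lambda>z. h + z)) (\<lambda>z. h \<bullet> z)"
    using ish by (subst integrable_distr_eq) auto
  then have ieh: "integrable std_gauss (\<lambda>z. ?e z * (h \<bullet> z))"
    unfolding std_gauss_shift by (subst (asm) integrable_density) auto
  have "(\<integral>z. h \<bullet> z \<partial>distr std_gauss borel (\<lambda>z. h + z)) = ?n"
    unfolding esh[symmetric] by (subst integral_distr) auto
  then have eeh: "(\<integral>z. ?e z * (h \<bullet> z) \<partial>std_gauss) = ?n"
    unfolding std_gauss_shift by (subst (asm) integral_density) auto
  have sq: "(?g z)\<^sup>2 = (?e z)\<^sup>2 + 1 + (h \<bullet> z)\<^sup>2 - 2 * ?e z - 2 * (?e z * (h \<bullet> z)) + 2 * (h \<bullet> z)" for z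
    by (simp add: power2_eq_square algebra_simps)
  have ig2: "integrable std_gauss (\<lambda>z. (?g z)\<^sup>2)"
    unfolding sq using i1 i2 ih ih2 ieh by simp
  have "(\<integral>z. (?g z)\<^sup>2 \<partial>std_gauss) = exp ?n + 1 + (\<integral>z. (h \<bullet> z)\<^sup>2 \<partial>std_gauss) - 2 - 2 * ?n"
    unfolding sq using i1 i2 ih ih2 ieh e1 e2 eh eeh by simp
  also have "\<dots> \<le> exp ?n - 1 - ?n" using eh2 by simp
  also have "\<dots> \<le> ?n\<^sup>2" using exp_bound[of ?n] n1 by simp
  finally have eg2: "(\<integral>z. (?g z)\<^sup>2 \<partial>std_gauss) \<le> ?n\<^sup>2" .
  have ig: "integrable std_gauss ?g" using i1 ih by simp
  then show iag: "integrable std_gauss (\<lambda>z. \<bar>?g z\<bar>)" by simp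
  have "(\<integral>z. \<bar>?g z\<bar> \<partial>std_gauss)\<^sup>2 \<le> (\<integral>z. \<bar>?g z\<bar>\<^sup>2 \<partial>std_gauss)"
    using std_gauss.variance_positive[of "\<lambda>z. \<bar>?g z\<bar>"] std_gauss.variance_eq[OF iag] ig2 by simp
  then have "(\<integral>z. \<bar>?g z\<bar> \<partial>std_gauss)\<^sup>2 \<le> ?n\<^sup>2" using eg2 by simp
  then show "(\<integral>z. \<bar>?g z\<bar> \<partial>std_gauss) \<le> ?n" by (rule power2_le_imp_le) simp
qed

text \<open>As k is only bounded and measurable, the increment \<open>h = sqrt r *\<^sub>R u\<close>
  is moved onto the weight \<open>exp (u \<bullet> z - (norm u)\<^sup>2 / 2)\<close>, and it is this
  weight that is expanded to first order.\<close>

lemma heat_has_derivative: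
  fixes k :: "'a::euclidean_space \<Rightarrow> real"
  assumes k: "bdd_meas k" and r: "0 < r"
  shows "(heat r k has_derivative (\<lambda>h. heat_grad r k x \<bullet> h)) (at x)"
proof -
  note [measurable] = bdd_meas_measurable[OF k]
  obtain B where B: "0 \<le> B" "\<And>x. \<bar>k x\<bar> \<le> B" using k by (rule bdd_meas_bound) blast
  define F where "F z = k (x + sqrt r *\<^sub>R z)" for z
  have F: "bdd_meas F" unfolding F_def[abs_def] by (rule bdd_meas_comp_affine[OF k])
  have [measurable]: "F \<in> borel_measurable borel" by (rule bdd_meas_measurable[OF F])
  have FB: "\<bar>F z\<bar> \<le> B" for z by (simp add: F_def B)
  have iF: "integrable std_gauss F"
    using std_gauss.bdd_meas_integrable[OF F, of "\<lambda>z. z"] by simp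
  have "\<bar>heat r k (x + h) - heat r k x - heat_grad r k x \<bullet> h\<bar> \<le> (B / r) * (norm h)\<^sup>2"
    if h: "norm h \<le> sqrt r" for h
  proof -
    define u where "u = (1 / sqrt r) *\<^sub>R h"
    have hu: "h = sqrt r *\<^sub>R u" and u1: "norm u \<le> 1" using h r by (auto simp: u_def)
    have nu: "(norm u)\<^sup>2 = (norm h)\<^sup>2 / r" using r by (simp add: u_def power_divide)
    let ?e = "\<lambda>z::'a. exp (u \<bullet> z - (norm u)\<^sup>2 / 2)"
    have ie: "integrable std_gauss (\<lambda>z. ?e z * F z)"
    proof (rule Bochner_Integration.integrable_bound)
      show "integrable std_gauss (\<lambda>z. B * ?e z)"
        using std_gauss_mgf[of u] by (auto simp: has_bochner_integral_iff exp_diff)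
      show "AE z in std_gauss. norm (?e z * F z) \<le> norm (B * ?e z)"
        using FB B by (auto simp: abs_mult intro!: mult_right_mono)
    qed measurable
    have iz: "integrable std_gauss (\<lambda>z. F z * (u \<bullet> z))"
      using integrable_inner_right[of u, OF integrable_bdd_times_id[OF F]] by simp
    have "heat r k (x + h) = (\<integral>z. F (u + z) \<partial>std_gauss)"
      by (simp add: heat_def F_def hu scaleR_add_right add.assoc)
    also have "\<dots> = (\<integral>z. F z \<partial>distr std_gauss borel (\<lambda>z. u + z))"
      by (subst integral_distr) auto
    also have "\<dots> = (\<integral>z. ?e z * F z \<partial>std_gauss)"
      unfolding std_gauss_shift by (subst integral_density) auto
    finally have 1: "heat r k (x + h) = (\<integral>z. ?e z * F z \<partial>std_gauss)" .
    have 2: "heat r k x = (\<integral>z. F z \<partial>std_gauss)" by (simp add: heat_def F_def)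
    have "heat_grad r k x \<bullet> h = u \<bullet> (\<integral>z. F z *\<^sub>R z \<partial>std_gauss)"
      using r by (simp add: heat_grad_def F_def[symmetric] hu inner_commute)
    also have "\<dots> = (\<integral>z. F z * (u \<bullet> z) \<partial>std_gauss)"
      using integral_inner_right[of u, OF integrable_bdd_times_id[OF F]] by simp
    finally have 3: "heat_grad r k x \<bullet> h = (\<integral>z. F z * (u \<bullet> z) \<partial>std_gauss)" .
    have "heat r k (x + h) - heat r k x - heat_grad r k x \<bullet> h
        = (\<integral>z. F z * (?e z - 1 - u \<bullet> z) \<partial>std_gauss)"
      unfolding 1 2 3 using ie iz iF by (simp add: right_diff_distrib mult.commute)
    also have "\<bar>\<dots>\<bar> \<le> (\<integral>z. \<bar>F z * (?e z - 1 - u \<bullet> z)\<bar> \<partial>std_gauss)"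
      using integral_norm_bound[of std_gauss "\<lambda>z. F z * (?e z - 1 - u \<bullet> z)"] by simp
    also have "\<dots> \<le> (\<integral>z. B * \<bar>?e z - 1 - u \<bullet> z\<bar> \<partial>std_gauss)"
    proof (rule integral_mono)
      show "integrable std_gauss (\<lambda>z. \<bar>F z * (?e z - 1 - u \<bullet> z)\<bar>)"
        using ie iz iF by (intro integrable_abs) (simp add: right_diff_distrib mult.commute)
      show "integrable std_gauss (\<lambda>z. B * \<bar>?e z - 1 - u \<bullet> z\<bar>)"
        by (intro integrable_mult_right std_gauss_exp_remainder u1)
      show "\<bar>F z * (?e z - 1 - u \<bullet> z)\<bar> \<le> B * \<bar>?e z - 1 - u \<bullet> z\<bar>" for z
        using FB by (simp add: abs_mult mult_right_mono)
    qed
    also have "\<dots> \<le> B * (norm u)\<^sup>2"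
      using std_gauss_exp_remainder(2)[OF u1] B(1) by (simp add: mult_left_mono)
    finally show ?thesis by (simp add: nu)
  qed
  then show ?thesis
    using has_derivative_quadratic_remainder[of "sqrt r"] r real_sqrt_gt_zero by blast
qed

lemma continuous_heat_grad_of_continuous:
  fixes k :: "'a::euclidean_space \<Rightarrow> real"
  assumes k: "bdd_meas k" and cont: "\<And>x. isCont k x" and r: "0 < r"
  shows "isCont (heat_grad r k) x"
proof -
  note [measurable] = bdd_meas_measurable[OF k]
  obtain B where B: "0 \<le> B" "\<And>x. \<bar>k x\<bar> \<le> B" using k by (rule bdd_meas_bound) blast
  have "isCont (\<lambda>x. \<integral>z. k (x + sqrt r *\<^sub>R z) *\<^sub>R z \<partial>std_gauss) x"
    unfolding continuous_at_sequentially comp_def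
  proof (intro allI impI)
    fix X assume X: "X \<longlonglongrightarrow> x"
    show "(\<lambda>n. \<integral>z. k (X n + sqrt r *\<^sub>R z) *\<^sub>R z \<partial>std_gauss) \<longlonglongrightarrow> (\<integral>z. k (x + sqrt r *\<^sub>R z) *\<^sub>R z \<partial>std_gauss)"
    proof (rule integral_dominated_convergence)
      show "integrable std_gauss (\<lambda>z::'a. B * norm z)"
        by (intro integrable_mult_right integrable_std_gauss_norm)
      show "AE z in std_gauss. norm (k (X n + sqrt r *\<^sub>R z) *\<^sub>R z) \<le> B * norm z" for n
        using B by (auto intro!: mult_right_mono)
      show "AE z in std_gauss. (\<lambda>n. k (X n + sqrt r *\<^sub>R z) *\<^sub>R z) \<longlonglongrightarrow> k (x + sqrt r *\<^sub>R z) *\<^sub>R z"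
        by (intro AE_I2 tendsto_intros isCont_tendsto_compose[OF cont] X)
    qed measurable
  qed
  then show ?thesis unfolding heat_grad_def[abs_def] by (intro continuous_intros)
qed

text \<open>Spend half of the time on making k continuous; dominated convergence treats the other
  half. \<open>poincare_test\<close> asks for a continuous gradient.\<close>

lemma continuous_heat_grad:
  fixes k :: "'a::euclidean_space \<Rightarrow> real"
  assumes k: "bdd_meas k" and r: "0 < r"
  shows "isCont (heat_grad r k) x"
proof -
  have r2: "0 < r / 2" and rr: "r / 2 + r / 2 = r" using r by simp_all
  have eq: "heat r k = heat (r / 2) (heat (r / 2) k)"
    using heat_heat[OF k, of "r/2" "r/2"] r by (simp add: fun_eq_iff)
  have k2: "bdd_meas (heat (r / 2) k)" by (rule heat_bdd_meas[OF k])
  have "heat_grad r k = heat_grad (r / 2) (heat (r / 2) k)"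
  proof
    fix x
    have "(\<lambda>h. heat_grad r k x \<bullet> h) = (\<lambda>h. heat_grad (r / 2) (heat (r / 2) k) x \<bullet> h)"
      by (rule has_derivative_unique[OF heat_has_derivative[OF k r]])
         (unfold eq, rule heat_has_derivative[OF k2 r2])
    then show "heat_grad r k x = heat_grad (r / 2) (heat (r / 2) k) x"
      using vector_eq_rdot by (metis inner_commute)
  qed
  then show ?thesis
    using continuous_heat_grad_of_continuous[OF k2 _ r2] has_derivative_continuous[OF heat_has_derivative[OF k r2]]
    by simp
qed

section \<open>The Poincare inequality along the heat flow\<close>

context borel_prob
begin

text \<open>Smoothing makes any bounded measurable k admissible, and \<open>heat_grad_sq_le\<close>
  trades the squared gradient for the conditional variance. With \<open>heat (T - r) k\<close> in
  place of k this is \<open>r A(0) \<le> C (A(r) - A(0))\<close>.\<close>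

lemma poincare_heat:
  assumes C: "poincare_ineq \<mu> C" "0 \<le> C" and k: "bdd_meas k" and r: "0 < r"
  shows "r * ((\<integral>x. (heat r k x)\<^sup>2 \<partial>\<mu>) - (\<integral>x. heat r k x \<partial>\<mu>)\<^sup>2)
    \<le> C * ((\<integral>x. heat r (\<lambda>y. (k y)\<^sup>2) x \<partial>\<mu>) - (\<integral>x. (heat r k x)\<^sup>2 \<partial>\<mu>))"
proof -
  have hk: "bdd_meas (heat r k)" by (rule heat_bdd_meas[OF k])
  have i: "integrable \<mu> (heat r k)" "integrable \<mu> (\<lambda>x. (heat r k x)\<^sup>2)"
    "integrable \<mu> (heat r (\<lambda>y. (k y)\<^sup>2))"
    using bdd_meas_integrable[OF hk, of "\<lambda>x. x"] bdd_meas_integrable[OF bdd_meas_power2[OF hk], of "\<lambda>x. x"]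
      bdd_meas_integrable[OF heat_bdd_meas[OF bdd_meas_power2[OF k]], of "\<lambda>x. x"] by simp_all
  have cg: "continuous_on UNIV (heat_grad r k)"
    by (simp add: continuous_on_eq_continuous_at continuous_heat_grad[OF k r])
  have [measurable]: "heat_grad r k \<in> borel_measurable borel"
    by (rule borel_measurable_continuous_onI[OF cg])
  obtain B where B: "\<And>x. norm (heat_grad r k x) \<le> B" using bdd_meas_heat_grad_bound[OF k r] by blast
  have ig: "integrable \<mu> (\<lambda>x. (norm (heat_grad r k x))\<^sup>2)"
    by (rule integrable_const_bound[where B="B\<^sup>2"]) (auto intro!: power_mono B)
  have "poincare_test \<mu> (heat r k) (heat_grad r k)"
    unfolding poincare_test_def using cg heat_has_derivative[OF k r] i ig by auto
  with C(1) have "(\<integral>x. (heat r k x - (\<integral>y. heat r k y \<partial>\<mu>))\<^sup>2 \<partial>\<mu>) \<le> C * (\<integral>x. (norm (heat_grad r k x))\<^sup>2 \<partial>\<mu>)"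
    by (simp add: poincare_ineq_def)
  then have "(\<integral>x. (heat r k x)\<^sup>2 \<partial>\<mu>) - (\<integral>x. heat r k x \<partial>\<mu>)\<^sup>2 \<le> C * (\<integral>x. (norm (heat_grad r k x))\<^sup>2 \<partial>\<mu>)"
    using variance_eq[OF i(1,2)] by simp
  then have "r * ((\<integral>x. (heat r k x)\<^sup>2 \<partial>\<mu>) - (\<integral>x. heat r k x \<partial>\<mu>)\<^sup>2)
      \<le> r * (C * (\<integral>x. (norm (heat_grad r k x))\<^sup>2 \<partial>\<mu>))"
    using r by (intro mult_left_mono) auto
  also have "\<dots> = C * (\<integral>x. r * (norm (heat_grad r k x))\<^sup>2 \<partial>\<mu>)" by simp
  also have "\<dots> \<le> C * (\<integral>x. heat r (\<lambda>y. (k y)\<^sup>2) x - (heat r k x)\<^sup>2 \<partial>\<mu>)"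
    using ig i C(2) by (intro mult_left_mono integral_mono heat_grad_sq_le k r) auto
  also have "\<dots> = C * ((\<integral>x. heat r (\<lambda>y. (k y)\<^sup>2) x \<partial>\<mu>) - (\<integral>x. (heat r k x)\<^sup>2 \<partial>\<mu>))"
    using i by simp
  finally show ?thesis .
qed

end

text \<open>Increments are nondecreasing, so each of the j increments before index j is at most each
  of the \<open>N - j\<close> increments after it; summing over all such pairs gives the
  claim.\<close>

lemma convex_sequence_chord:
  fixes a :: "nat \<Rightarrow> real"
  assumes conv: "\<And>i. i + 2 \<le> N \<Longrightarrow> 2 * a (i + 1) \<le> a i + a (i + 2)" and j: "j \<le> N"
  shows "real j * (a N - a j) \<ge> real (N - j) * (a j - a 0)"
proof -
  have inc: "i \<le> m \<Longrightarrow> m < N \<Longrightarrow> a (Suc i) - a i \<le> a (Suc m) - a m" for i m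
  proof (induction m rule: dec_induct)
    case (step m)
    then show ?case using conv[of m] by simp
  qed simp
  have first: "i \<le> m \<Longrightarrow> m < N \<Longrightarrow> a i - a 0 \<le> real i * (a (Suc m) - a m)" for i m
  proof (induction i)
    case (Suc i)
    then show ?case using inc[of i m] by (simp add: algebra_simps)
  qed simp
  have "m \<le> N \<Longrightarrow> real (m - j) * (a j - a 0) \<le> real j * (a m - a j)" if "j \<le> m" for m
    using that
  proof (induction m rule: dec_induct)
    case (step m)
    then show ?case using first[of j m] by (simp add: Suc_diff_le algebra_simps)
  qed simp
  with j show ?thesis by simp
qed

section \<open>Conditional variances as a function of the noise level\<close>

context borel_prob
begin

lemma integrable_bdd_meas: "bdd_meas f \<Longrightarrow> integrable \<mu> f"
  using bdd_meas_integrable[of f "\<lambda>x. x"] by simp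

context
  fixes k :: "'a \<Rightarrow> real" and T :: real
  assumes k: "bdd_meas k" and T: "0 < T"
begin

text \<open>The mean square of the conditional expectation of \<open>k(Y\<^sub>T)\<close> given
  \<open>Y\<^sub>t\<close>, that is \<open>A(t)\<close> plus a squared mean that does not depend on
  t.\<close>

definition energy :: "real \<Rightarrow> real" where
  "energy t = (\<integral>x. heat t (\<lambda>y. (heat (T - t) k y)\<^sup>2) x \<partial>\<mu>)"

lemma bdd_meas_heat_sq: "bdd_meas (\<lambda>y. (heat t k y)\<^sup>2)"
  by (intro bdd_meas_power2 heat_bdd_meas k)

lemma energy_mono:
  assumes "0 \<le> s" "s \<le> t" "t \<le> T"
  shows "energy s \<le> energy t"
  unfolding energy_def
proof (intro integral_mono integrable_bdd_meas heat_bdd_meas bdd_meas_heat_sq)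
  fix x
  have eq: "heat (T - s) k = heat (t - s) (heat (T - t) k)"
    using heat_heat[OF k, of "t - s" "T - t"] assms by (simp add: fun_eq_iff)
  have "heat s (\<lambda>y. (heat (T - s) k y)\<^sup>2) x \<le> heat s (heat (t - s) (\<lambda>y. (heat (T - t) k y)\<^sup>2)) x"
    unfolding eq
    by (intro heat_mono heat_square_le heat_bdd_meas bdd_meas_power2 k)
  also have "\<dots> = heat t (\<lambda>y. (heat (T - t) k y)\<^sup>2) x"
    using heat_heat[OF bdd_meas_heat_sq, of s "t - s"] assms by simp
  finally show "heat s (\<lambda>y. (heat (T - s) k y)\<^sup>2) x \<le> heat t (\<lambda>y. (heat (T - t) k y)\<^sup>2) x" .
qed

lemma energy_midpoint:
  assumes "0 \<le> s" "0 \<le> d" "s + 2 * d \<le> T"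
  shows "2 * energy (s + d) \<le> energy s + energy (s + 2 * d)"
proof -
  \<comment> \<open>\<open>w\<close> is k already averaged down to time \<open>s + 2 * d\<close>;
    from time s two increments of variance d remain, as \<open>heat_midpoint\<close>
    requires.\<close>
  define w where "w = heat (T - (s + 2 * d)) k"
  have w: "bdd_meas w" unfolding w_def by (rule heat_bdd_meas[OF k])
  have w1: "heat (T - (s + d)) k = heat d w" and w2: "heat (T - s) k = heat (d + d) w"
    unfolding w_def using heat_heat[OF k, of d "T - (s + 2 * d)"] heat_heat[OF k, of "d + d" "T - (s + 2 * d)"] assms
    by (simp_all add: fun_eq_iff algebra_simps)
  have bm: "bdd_meas (\<lambda>y. (w y)\<^sup>2)" "bdd_meas (\<lambda>y. (heat d w y)\<^sup>2)" "bdd_meas (\<lambda>y. (heat (d + d) w y)\<^sup>2)"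
    by (intro bdd_meas_power2 heat_bdd_meas w)+
  have i: "bdd_meas g \<Longrightarrow> integrable std_gauss (\<lambda>z. g (x + sqrt s *\<^sub>R z))" for x and g :: "'a \<Rightarrow> real"
    by (rule std_gauss.bdd_meas_integrable) auto
  have pt: "2 * heat s (heat d (\<lambda>y. (heat d w y)\<^sup>2)) x
    \<le> heat s (\<lambda>y. (heat (d + d) w y)\<^sup>2) x + heat s (heat (d + d) (\<lambda>y. (w y)\<^sup>2)) x" for x
  proof -
    let ?a = "\<lambda>z. x + sqrt s *\<^sub>R z"
    have "(\<integral>z. 2 * heat d (\<lambda>y. (heat d w y)\<^sup>2) (?a z) \<partial>std_gauss)
      \<le> (\<integral>z. heat (d + d) (\<lambda>y. (w y)\<^sup>2) (?a z) + (heat (d + d) w (?a z))\<^sup>2 \<partial>std_gauss)"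
      by (intro integral_mono integrable_mult_right Bochner_Integration.integrable_add
          i heat_bdd_meas bm heat_midpoint w assms)
    also have "\<dots> = (\<integral>z. heat (d + d) (\<lambda>y. (w y)\<^sup>2) (?a z) \<partial>std_gauss) + (\<integral>z. (heat (d + d) w (?a z))\<^sup>2 \<partial>std_gauss)"
      by (intro Bochner_Integration.integral_add i heat_bdd_meas bm)
    finally show ?thesis by (simp add: heat_def[of s])
  qed
  have h1: "heat s (heat d (\<lambda>y. (heat d w y)\<^sup>2)) = heat (s + d) (\<lambda>y. (heat d w y)\<^sup>2)"
    and h2: "heat s (heat (d + d) (\<lambda>y. (w y)\<^sup>2)) = heat (s + 2 * d) (\<lambda>y. (w y)\<^sup>2)"
    using heat_heat[OF bm(2), of s d] heat_heat[OF bm(1), of s "d + d"] assms by (simp_all add: fun_eq_iff)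
  have "2 * energy (s + d) = (\<integral>x. 2 * heat (s + d) (\<lambda>y. (heat d w y)\<^sup>2) x \<partial>\<mu>)"
    by (simp add: energy_def w1)
  also have "\<dots> \<le> (\<integral>x. heat s (\<lambda>y. (heat (d + d) w y)\<^sup>2) x + heat (s + 2 * d) (\<lambda>y. (w y)\<^sup>2) x \<partial>\<mu>)"
    using pt unfolding h1 h2
    by (intro integral_mono integrable_mult_right Bochner_Integration.integrable_add
          integrable_bdd_meas heat_bdd_meas bm)
  also have "\<dots> = energy s + energy (s + 2 * d)"
    unfolding energy_def w2 w_def[symmetric]
    by (intro Bochner_Integration.integral_add integrable_bdd_meas heat_bdd_meas bm)
  finally show ?thesis .
qed

text \<open>Midpoint convexity gives the chord inequality on a grid of mesh \<open>T / N\<close>.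
  Monotonicity carries it from the grid to r with an error of order \<open>1 / N\<close>, so
  continuity of \<open>energy\<close> is not invoked.\<close>

lemma energy_chord:
  assumes r: "0 < r" "r \<le> T"
  shows "T * (energy r - energy 0) \<le> r * (energy T - energy 0)"
proof -
  let ?D = "energy T - energy 0"
  have D: "0 \<le> ?D" using energy_mono[of 0 T] T by simp
  have "energy r - energy 0 \<le> (r / T + 1 / real N) * ?D" if N: "0 < N" for N
  proof -
    define d where "d = T / real N"
    have d: "0 < d" "real N * d = T" using T N by (auto simp: d_def)
    \<comment> \<open>Rounding up bounds \<open>energy r\<close> from above by monotonicity and
      costs at most one cell, the share \<open>1 / real N\<close> of the total increment.\<close>
    define j where "j = nat \<lceil>r / d\<rceil>"
    have j: "r / d \<le> real j" "real j \<le> r / d + 1"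
      using r d by (auto simp: j_def of_nat_nat) (linarith+)?
    have "r / d \<le> real_of_int (int N)"
      using r d by (simp add: pos_divide_le_eq)
    then have jN: "j \<le> N" unfolding j_def by (simp only: ceiling_le_iff[symmetric] nat_le_iff)
    have rj: "r \<le> real j * d" using j d by (simp add: field_simps)
    have mul: "real i * d \<le> T" if "i \<le> N" for i
      using mult_right_mono[of "real i" "real N" d] that d by simp
    have chord: "real (N - j) * (energy (real j * d) - energy (real 0 * d))
      \<le> real j * (energy (real N * d) - energy (real j * d))"
    proof (rule convex_sequence_chord[where a="\<lambda>i. energy (real i * d)" and N=N and j=j, OF _ jN])
      fix i assume "i + 2 \<le> N"
      then show "2 * energy (real (i + 1) * d) \<le> energy (real i * d) + energy (real (i + 2) * d)"
        using energy_midpoint[of "real i * d" d] mul[of "i + 2"] d by (simp add: algebra_simps)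
    qed
    have "energy r \<le> energy (real j * d)" using energy_mono[OF _ rj mul[OF jN]] r by simp
    then have "real N * (energy r - energy 0) \<le> real N * (energy (real j * d) - energy 0)"
      by (intro mult_left_mono) auto
    also have "\<dots> \<le> real j * ?D"
      using chord jN d by (simp add: of_nat_diff algebra_simps)
    also have "\<dots> \<le> (r / d + 1) * ?D" using j D by (intro mult_right_mono) auto
    also have "\<dots> = real N * ((r / T + 1 / real N) * ?D)"
      using N T by (simp add: d_def field_simps)
    finally show ?thesis using N by simp
  qed
  then have ev: "eventually (\<lambda>N. energy r - energy 0 \<le> (r / T + 1 / real N) * ?D) sequentially"
    by (intro eventually_sequentiallyI[of 1]) auto
  have "(\<lambda>N. (r / T + 1 / real N) * ?D) \<longlonglongrightarrow> (r / T + 0) * ?D"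
    by (intro tendsto_intros lim_1_over_n)
  from tendsto_lowerbound[OF this ev] have "energy r - energy 0 \<le> r / T * ?D" by simp
  then show ?thesis using T by (simp add: field_simps)
qed

text \<open>This bounds the squared maximal correlation of \<open>Y\<^sub>r\<close> and
  \<open>Y\<^sub>T\<close> by \<open>(C + r) / (C + T)\<close>: the left bracket is the variance of
  the conditional expectation of \<open>k(Y\<^sub>T)\<close> given \<open>Y\<^sub>r\<close>.\<close>

lemma poincare_correlation:
  assumes C: "poincare_ineq \<mu> C" "0 \<le> C" and r: "0 < r" "r \<le> T"
  shows "(C + T) * ((\<integral>x. heat r (\<lambda>y. (heat (T - r) k y)\<^sup>2) x \<partial>\<mu>) - (\<integral>x. heat T k x \<partial>\<mu>)\<^sup>2)
    \<le> (C + r) * ((\<integral>x. heat T (\<lambda>y. (k y)\<^sup>2) x \<partial>\<mu>) - (\<integral>x. heat T k x \<partial>\<mu>)\<^sup>2)"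
proof -
  define m where "m = (\<integral>x. heat T k x \<partial>\<mu>)\<^sup>2"
  have eq: "heat r (heat (T - r) k) = heat T k"
    using heat_heat[OF k, of r "T - r"] r by (simp add: fun_eq_iff)
  have E: "energy 0 = (\<integral>x. (heat T k x)\<^sup>2 \<partial>\<mu>)" "energy T = (\<integral>x. heat T (\<lambda>y. (k y)\<^sup>2) x \<partial>\<mu>)"
    by (simp_all add: energy_def)
  have 1: "r * (energy 0 - m) \<le> C * (energy r - energy 0)"
    using poincare_heat[OF C heat_bdd_meas[OF k] r(1), of "T - r"] unfolding eq
    by (simp add: E m_def energy_def)
  \<comment> \<open>The identity isolates the chord inequality with weight \<open>C + r\<close> and
    the Poincare inequality with weight \<open>T - r\<close>; both weights are nonnegative.\<close>
  have "r * ((C + T) * (energy r - m)) = (C + r) * (T * (energy r - energy 0))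
      + (T - r) * (r * (energy 0 - m) - C * (energy r - energy 0)) + r * (C + r) * (energy 0 - m)"
    by (simp add: algebra_simps)
  also have "\<dots> \<le> (C + r) * (r * (energy T - energy 0)) + (T - r) * 0 + r * (C + r) * (energy 0 - m)"
    using energy_chord[OF r] 1 C r by (intro add_mono mult_left_mono) auto
  also have "\<dots> = r * ((C + r) * (energy T - m))"
    by (simp add: algebra_simps)
  finally have "(C + T) * (energy r - m) \<le> (C + r) * (energy T - m)" using r by simp
  then show ?thesis by (simp add: E m_def energy_def)
qed

end

end

section \<open>Scores of the smoothed law\<close>

text \<open>Both sides are gradients of the one function \<open>heat (r + q) k\<close>, and
  derivatives are unique.\<close>

lemma heat_grad_heat:
  assumes k: "bdd_meas k" and r: "0 < r" "0 \<le> q"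
  shows "heat_grad r (heat q k) = heat_grad (r + q) k"
proof
  fix x
  have eq: "heat r (heat q k) = heat (r + q) k"
    using heat_heat[OF k, of r q] r by (simp add: fun_eq_iff)
  have "(\<lambda>h. heat_grad r (heat q k) x \<bullet> h) = (\<lambda>h. heat_grad (r + q) k x \<bullet> h)"
    by (rule has_derivative_unique[OF heat_has_derivative[OF heat_bdd_meas[OF k] r(1)]])
       (unfold eq, rule heat_has_derivative[OF k], use r in simp)
  then show "heat_grad r (heat q k) x = heat_grad (r + q) k x"
    using vector_eq_rdot by (metis inner_commute)
qed

section \<open>Elementary bounds for Gaussian kernels\<close>

lemma exp_remainder_le: "0 \<le> exp a - 1 - a" "exp a - 1 - a \<le> a\<^sup>2 * max 1 (exp a)" for a :: real
proof -
  show "0 \<le> exp a - 1 - a" using exp_ge_add_one_self[of a] by linarith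
  show "exp a - 1 - a \<le> a\<^sup>2 * max 1 (exp a)"
  proof (cases "0 \<le> a")
    case True
    have "(1 + a) * (1 - a) \<le> (1 + a) * exp (- a)"
      using exp_ge_add_one_self[of "-a"] True by (intro mult_left_mono) auto
    then have "(1 + a) * (1 - a) * exp a \<le> (1 + a) * exp (- a) * exp a" by (intro mult_right_mono) auto
    then have "exp a - 1 - a \<le> a\<^sup>2 * exp a"
      by (simp add: exp_minus power2_eq_square algebra_simps)
    also have "\<dots> \<le> a\<^sup>2 * max 1 (exp a)" by (intro mult_left_mono) auto
    finally show ?thesis .
  next
    case False
    define b where "b = - a"
    have b: "0 < b" using False by (simp add: b_def)
    have "exp a = 1 / exp b" by (simp add: b_def exp_minus inverse_eq_divide)
    also have "\<dots> \<le> 1 / (1 + b)" using exp_ge_add_one_self[of b] b by (intro divide_left_mono) auto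
    also have "\<dots> \<le> 1 - b + b\<^sup>2"
    proof -
      have "1 \<le> (1 - b + b\<^sup>2) * (1 + b)" using b by (simp add: power2_eq_square algebra_simps)
      then show ?thesis using b by (simp add: pos_divide_le_eq)
    qed
    finally have "exp a - 1 - a \<le> a\<^sup>2 * 1" by (simp add: b_def)
    also have "\<dots> \<le> a\<^sup>2 * max 1 (exp a)" by (intro mult_left_mono) auto
    finally show ?thesis .
  qed
qed

lemma sq_times_exp_le: "t\<^sup>2 * exp (- t\<^sup>2 / 2) \<le> 1" for t :: real
proof -
  have "t\<^sup>2 \<le> (1 + t\<^sup>2 / 4)\<^sup>2"
    using zero_le_power2[of "1 - t\<^sup>2 / 4"] by (simp add: power2_sum power2_diff)
  also have "\<dots> \<le> (exp (t\<^sup>2 / 4))\<^sup>2" by (intro power_mono exp_ge_add_one_self) simp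
  also have "\<dots> = exp (t\<^sup>2 / 2)" by (simp add: power2_eq_square exp_add[symmetric])
  finally show ?thesis by (simp add: exp_minus field_simps)
qed

text \<open>The bound is uniform in u, so it integrates against any probability measure and permits
  differentiation of \<open>dens\<close> under the integral. The constant 3 is 5/2 from the
  exponential remainder plus 1/2 from the quadratic part of the exponent.\<close>

lemma gauss_kernel_remainder:
  fixes u h :: "'a::euclidean_space"
  assumes h: "norm h \<le> 1"
  defines "Q \<equiv> \<lambda>u::'a. exp (- (norm u)\<^sup>2 / 2)"
  shows "\<bar>Q (u + h) - Q u + Q u * (u \<bullet> h)\<bar> \<le> 3 * (norm h)\<^sup>2"
proof -
  define a where "a = - (u \<bullet> h) - (norm h)\<^sup>2 / 2"
  have Q1: "0 < Q m" "Q m \<le> 1" for m by (auto simp: Q_def)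
  have Qa: "Q (u + h) = Q u * exp a"
    unfolding Q_def a_def exp_add[symmetric]
    by (simp add: power2_norm_eq_inner inner_add_left inner_add_right inner_commute field_simps)
  have hh: "(norm h)\<^sup>2 / 2 \<le> norm h / 2"
    using mult_left_mono[OF h norm_ge_zero[of h]] by (simp add: power2_eq_square)
  \<comment> \<open>Needed at both ends, \<open>m = u\<close> and \<open>m = u + h\<close>. The
    decay of \<open>Q m\<close> absorbs the growth of \<open>a\<close> in m; the constant is
    \<open>2 * 1 + 1 / 2 * 1\<close>.\<close>
  have bnd: "a\<^sup>2 * Q m \<le> 5 / 2 * (norm h)\<^sup>2" if m: "\<bar>a\<bar> \<le> norm h * (norm m + 1 / 2)" for m :: 'a
  proof -
    have "a\<^sup>2 \<le> (norm h * (norm m + 1 / 2))\<^sup>2" using power_mono[OF m, of 2] by simp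
    also have "\<dots> = (norm h)\<^sup>2 * (norm m + 1 / 2)\<^sup>2" by (simp add: power_mult_distrib)
    also have "\<dots> \<le> (norm h)\<^sup>2 * (2 * (norm m)\<^sup>2 + 1 / 2)"
      using sum_squares_bound[of "norm m" "1/2"]
      by (intro mult_left_mono) (auto simp: power2_sum power_divide)
    finally have "a\<^sup>2 * Q m \<le> (norm h)\<^sup>2 * (2 * (norm m)\<^sup>2 + 1 / 2) * Q m"
      using Q1[of m] by (intro mult_right_mono) auto
    also have "\<dots> = (norm h)\<^sup>2 * (2 * ((norm m)\<^sup>2 * Q m) + 1 / 2 * Q m)" by (simp add: algebra_simps)
    also have "\<dots> \<le> (norm h)\<^sup>2 * (2 * 1 + 1 / 2 * 1)"
      using sq_times_exp_le[of "norm m"] Q1[of m]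
      by (intro mult_left_mono add_mono) (auto simp: Q_def)
    finally show ?thesis by simp
  qed
  have ca: "\<bar>u \<bullet> h\<bar> \<le> norm h * norm u" using Cauchy_Schwarz_ineq2[of u h] by (simp add: mult.commute)
  have cb: "\<bar>(u + h) \<bullet> h\<bar> \<le> norm h * norm (u + h)" using Cauchy_Schwarz_ineq2[of "u + h" h] by (simp add: mult.commute)
  have "\<bar>a\<bar> \<le> \<bar>u \<bullet> h\<bar> + (norm h)\<^sup>2 / 2"
    using zero_le_power2[of "norm h"] unfolding a_def by linarith
  also have "\<dots> \<le> norm h * (norm u + 1 / 2)" using ca hh by (simp add: algebra_simps)
  finally have 1: "a\<^sup>2 * Q u \<le> 5 / 2 * (norm h)\<^sup>2" by (rule bnd)
  have "a = - ((u + h) \<bullet> h) + (norm h)\<^sup>2 / 2"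
    by (simp add: a_def inner_add_left power2_norm_eq_inner)
  then have "\<bar>a\<bar> \<le> \<bar>(u + h) \<bullet> h\<bar> + (norm h)\<^sup>2 / 2"
    using zero_le_power2[of "norm h"] by linarith
  also have "\<dots> \<le> norm h * (norm (u + h) + 1 / 2)" using cb hh by (simp add: algebra_simps)
  finally have 2: "a\<^sup>2 * Q (u + h) \<le> 5 / 2 * (norm h)\<^sup>2" by (rule bnd)
  \<comment> \<open>Since \<open>Q u * exp a = Q (u + h)\<close>, whichever entry the maximum
    selects is covered by one of the two bounds just shown.\<close>
  have "Q u * (exp a - 1 - a) \<le> Q u * (a\<^sup>2 * max 1 (exp a))"
    using exp_remainder_le(2)[of a] Q1[of u] by (intro mult_left_mono) auto
  also have "\<dots> \<le> 5 / 2 * (norm h)\<^sup>2"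
    using 1 2 unfolding Qa by (auto simp: max_def algebra_simps)
  finally have 3: "Q u * (exp a - 1 - a) \<le> 5 / 2 * (norm h)\<^sup>2" .
  have 4: "0 \<le> Q u * (exp a - 1 - a)"
    using exp_remainder_le(1)[of a] Q1[of u] by simp
  have 5: "0 \<le> Q u * (norm h)\<^sup>2 / 2" "Q u * (norm h)\<^sup>2 / 2 \<le> (norm h)\<^sup>2 / 2"
    using Q1[of u] mult_right_mono[of "Q u" 1 "(norm h)\<^sup>2"] by auto
  have "Q (u + h) - Q u + Q u * (u \<bullet> h) = Q u * (exp a - 1 - a) - Q u * (norm h)\<^sup>2 / 2"
    unfolding Qa by (simp add: a_def algebra_simps)
  then show ?thesis using 3 4 5 by linarith
qed

text \<open>Beyond \<open>L + 1\<close> one has \<open>z\<^sup>2 \<ge> L\<^sup>2 + z\<close>, so the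
  factor z is paid for by the surplus decay, as \<open>z * exp (- (z / 2)) \<le> 2\<close>. In the
  score bound the last term is compared with a lower bound of the density.\<close>

lemma gauss_moment_truncation:
  fixes z L v :: real
  assumes "0 \<le> z" "0 \<le> L" "0 < v" "v \<le> 1"
  shows "z * exp (- z\<^sup>2 / (2 * v)) \<le> (L + 1) * exp (- z\<^sup>2 / (2 * v)) + 2 * exp (- L\<^sup>2 / (2 * v))"
proof (cases "z \<le> L + 1")
  case True
  then have "z * exp (- z\<^sup>2 / (2 * v)) \<le> (L + 1) * exp (- z\<^sup>2 / (2 * v))" by (intro mult_right_mono) auto
  then show ?thesis by (smt (verit) exp_gt_zero)
next
  case False
  have "z * 1 \<le> (z + L) * (z - L)" using False assms by (intro mult_mono) auto
  then have "L\<^sup>2 + z \<le> z\<^sup>2" by (simp add: power2_eq_square algebra_simps)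
  then have "- z\<^sup>2 / (2 * v) \<le> - L\<^sup>2 / (2 * v) - z / (2 * v)"
    using assms by (simp add: field_simps)
  also have "\<dots> \<le> - L\<^sup>2 / (2 * v) - z / 2"
    using assms mult_right_mono[of v 1 z] by (simp add: field_simps)
  finally have "exp (- z\<^sup>2 / (2 * v)) \<le> exp (- L\<^sup>2 / (2 * v)) * exp (- (z / 2))"
    by (simp add: exp_add[symmetric])
  then have "z * exp (- z\<^sup>2 / (2 * v)) \<le> z * (exp (- L\<^sup>2 / (2 * v)) * exp (- (z / 2)))"
    using assms by (intro mult_left_mono) auto
  also have "\<dots> = exp (- L\<^sup>2 / (2 * v)) * (z * exp (- (z / 2)))" by simp
  also have "\<dots> \<le> exp (- L\<^sup>2 / (2 * v)) * 2"
  proof (intro mult_left_mono)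
    have "z / 2 \<le> exp (z / 2)" using exp_ge_add_one_self[of "z / 2"] by linarith
    then show "z * exp (- (z / 2)) \<le> 2" by (simp add: exp_minus field_simps)
  qed simp
  finally show ?thesis using assms by (smt (verit) exp_gt_zero mult_nonneg_nonneg)
qed

text \<open>The gradient in y of \<open>ln (mehler s x y)\<close>, in a form that is linear in x and
  y; \<open>obs_score_alt\<close> is the form in which this can be seen.\<close>

definition obs_score :: "real \<Rightarrow> 'a::euclidean_space \<Rightarrow> 'a \<Rightarrow> 'a" where
  "obs_score s x y = (1 / (1 - s)) *\<^sub>R (sqrt s *\<^sub>R x - s *\<^sub>R y)"

lemma measurable_obs_score [measurable]:
  "(\<lambda>p. obs_score s (fst p) (snd p)) \<in> borel_measurable (borel \<Otimes>\<^sub>M borel)"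
  "(\<lambda>x. obs_score s x y) \<in> borel_measurable borel"
  unfolding obs_score_def by measurable

lemma obs_score_alt: "s < 1 \<Longrightarrow> obs_score s x y = y - (1 / (1 - s)) *\<^sub>R (y - sqrt s *\<^sub>R x)"
proof -
  assume "s < 1"
  then have "y - (1 / (1 - s)) *\<^sub>R (y - sqrt s *\<^sub>R x)
      = (1 / (1 - s)) *\<^sub>R ((1 - s) *\<^sub>R y) - (1 / (1 - s)) *\<^sub>R (y - sqrt s *\<^sub>R x)"
    by simp
  also have "\<dots> = (1 / (1 - s)) *\<^sub>R ((1 - s) *\<^sub>R y - (y - sqrt s *\<^sub>R x))"
    by (simp only: scaleR_right_diff_distrib)
  also have "(1 - s) *\<^sub>R y - (y - sqrt s *\<^sub>R x) = sqrt s *\<^sub>R x - s *\<^sub>R y"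
    by (simp add: scaleR_left_diff_distrib)
  finally show ?thesis by (simp only: obs_score_def)
qed

text \<open>The right side is \<open>2 * s\<close> times the derivative of \<open>chan s p\<close>
  in s. This is where the factor \<open>1 / (2s)\<close> of de Bruijn's identity comes from.\<close>

lemma obs_score_chan:
  assumes s: "0 \<le> s" "s < 1"
  shows "obs_score s (fst p) (chan s p) = sqrt s *\<^sub>R fst p - (s / sqrt (1 - s)) *\<^sub>R snd p"
proof -
  have "sqrt s *\<^sub>R fst p - s *\<^sub>R chan s p = (1 - s) *\<^sub>R (sqrt s *\<^sub>R fst p) - (s * sqrt (1 - s)) *\<^sub>R snd p"
    by (simp add: chan_def scaleR_add_right left_diff_distrib scaleR_left_diff_distrib)
  moreover have "s * sqrt (1 - s) / (1 - s) = s / sqrt (1 - s)"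
    using s by (simp add: real_div_sqrt field_simps)
  ultimately show ?thesis using s by (simp add: obs_score_def scaleR_diff_right)
qed

text \<open>The finite second moment is not a hypothesis of the theorem;
  \<open>integrable_norm_sq_of_entropy\<close> supplies it when the entropy is finite.\<close>

locale centered_prob = borel_prob +
  assumes integrable_norm_sq: "integrable \<mu> (\<lambda>x. (norm x)\<^sup>2)"
    and mean_zero: "(\<integral>x. x \<partial>\<mu>) = 0"
begin

lemma integrable_P_quadratic:
  fixes F :: "'a \<times> 'a \<Rightarrow> 'b::{banach, second_countable_topology}"
  assumes [measurable]: "F \<in> borel_measurable (borel \<Otimes>\<^sub>M borel)"
    and bound: "\<And>p. norm (F p) \<le> A + B * ((norm (fst p))\<^sup>2 + (norm (snd p))\<^sup>2)"
  shows "integrable P F"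
proof (rule Bochner_Integration.integrable_bound)
  have "integrable P (\<lambda>p. (norm (fst p))\<^sup>2)"
  proof (rule integrableI_nonneg)
    have "(\<integral>\<^sup>+p. ennreal ((norm (fst p))\<^sup>2) \<partial>P) = (\<integral>\<^sup>+x. ennreal ((norm x)\<^sup>2) \<partial>\<mu>)"
      by (subst std_gauss.nn_integral_fst[symmetric]) (auto simp: std_gauss.emeasure_space_1[simplified])
    also have "\<dots> < \<infinity>" using integrable_norm_sq by (simp add: integrable_iff_bounded)
    finally show "(\<integral>\<^sup>+p. ennreal ((norm (fst p))\<^sup>2) \<partial>P) < \<infinity>" .
  qed auto
  moreover have "integrable P (\<lambda>p. (norm (snd p))\<^sup>2)"
  proof (rule integrableI_nonneg)
    have "(\<integral>\<^sup>+p. ennreal ((norm (snd p))\<^sup>2) \<partial>P) = (\<integral>\<^sup>+x. ennreal ((norm x)\<^sup>2) \<partial>(std_gauss :: 'a measure))"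
      by (subst P.nn_integral_snd[symmetric]) (auto simp: split_beta' emeasure_space_1[simplified])
    also have "\<dots> < \<infinity>" using integrable_std_gauss_norm_sq by (simp add: integrable_iff_bounded)
    finally show "(\<integral>\<^sup>+p. ennreal ((norm (snd p))\<^sup>2) \<partial>P) < \<infinity>" .
  qed auto
  ultimately show "integrable P (\<lambda>p. A + B * ((norm (fst p))\<^sup>2 + (norm (snd p))\<^sup>2))" by simp
  show "AE p in P. norm (F p) \<le> norm (A + B * ((norm (fst p))\<^sup>2 + (norm (snd p))\<^sup>2))"
    using bound by (intro AE_I2) (metis abs_ge_self order_trans real_norm_def)
qed measurable

lemma integrable_norm_mu: "integrable \<mu> norm"
proof (rule Bochner_Integration.integrable_bound)
  show "integrable \<mu> (\<lambda>z. 1 + (norm z)\<^sup>2)" using integrable_norm_sq by simp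
  have "x \<le> 1 + x\<^sup>2" for x :: real
    using zero_le_power2[of "x - 1/2"] by (simp add: power2_eq_square algebra_simps)
  then show "AE z in \<mu>. norm (norm z) \<le> norm (1 + (norm z)\<^sup>2)" by simp
qed simp

lemma integrable_id: "integrable \<mu> (\<lambda>x. x)"
  using integrable_norm_mu by (simp add: integrable_norm_iff)

text \<open>The \<open>v\<^sub>s\<close> of the overview, taken as the posterior mean of
  \<open>obs_score\<close> given the output y. That it is the gradient of \<open>ln (dens s)\<close>
  is the content of \<open>ln_dens_has_derivative\<close>.\<close>

definition score :: "real \<Rightarrow> 'a \<Rightarrow> 'a" where
  "score s y = (1 / dens s y) *\<^sub>R (\<integral>x. mehler s x y *\<^sub>R obs_score s x y \<partial>\<mu>)"

lemma measurable_score [measurable]: "score s \<in> borel_measurable borel"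
proof -
  have "(\<lambda>(y, x). mehler s x y *\<^sub>R obs_score s x y) \<in> borel_measurable (borel \<Otimes>\<^sub>M \<mu>)"
    unfolding mehler_def obs_score_def by measurable
  then have [measurable]: "(\<lambda>y. \<integral>x. mehler s x y *\<^sub>R obs_score s x y \<partial>\<mu>) \<in> borel_measurable borel"
    by (rule borel_measurable_lebesgue_integral)
  show ?thesis unfolding score_def[abs_def] by measurable
qed

lemma integrable_mehler_obs_score:
  assumes s: "s < 1"
  shows "integrable \<mu> (\<lambda>x. mehler s x y *\<^sub>R obs_score s x y)"
proof (rule Bochner_Integration.integrable_bound)
  let ?K = "inverse (sqrt (1 - s)) ^ DIM('a) * exp ((norm y)\<^sup>2 / 2)"
  show "integrable \<mu> (\<lambda>x. ?K * (1 / (1 - s) * (\<bar>sqrt s\<bar> * norm x + \<bar>s\<bar> * norm y)))"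
    using integrable_norm_mu by simp
  show "AE x in \<mu>. norm (mehler s x y *\<^sub>R obs_score s x y)
      \<le> norm (?K * (1 / (1 - s) * (\<bar>sqrt s\<bar> * norm x + \<bar>s\<bar> * norm y)))"
  proof (rule AE_I2)
    fix x
    have "norm (obs_score s x y) \<le> 1 / (1 - s) * (\<bar>sqrt s\<bar> * norm x + \<bar>s\<bar> * norm y)"
      unfolding obs_score_def using s norm_triangle_ineq4[of "sqrt s *\<^sub>R x" "s *\<^sub>R y"]
      by (simp add: divide_right_mono)
    then have "norm (mehler s x y *\<^sub>R obs_score s x y)
        \<le> ?K * (1 / (1 - s) * (\<bar>sqrt s\<bar> * norm x + \<bar>s\<bar> * norm y))"
      using mehler_le[OF s, of x y] mehler_pos[OF s, of x y] s
      by (simp only: norm_scaleR) (intro mult_mono, auto)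
    then show "norm (mehler s x y *\<^sub>R obs_score s x y)
      \<le> norm (?K * (1 / (1 - s) * (\<bar>sqrt s\<bar> * norm x + \<bar>s\<bar> * norm y)))"
      by (metis abs_ge_self order_trans real_norm_def)
  qed
qed simp

text \<open>Under the joint density the inner integral over the input is
  \<open>dens s y * (g y \<bullet> score s y)\<close>. The lemma thus does the work of the tower
  property of conditional expectation given the output.\<close>

lemma score_tower:
  fixes g :: "'a \<Rightarrow> 'a"
  assumes s: "s < 1" and [measurable]: "g \<in> borel_measurable borel"
    and int: "integrable P (\<lambda>p. g (chan s p) \<bullet> obs_score s (fst p) (chan s p))"
  shows "(\<integral>p. g (chan s p) \<bullet> obs_score s (fst p) (chan s p) \<partial>P) = (\<integral>p. g (chan s p) \<bullet> score s (chan s p) \<partial>P)"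
proof -
  let ?F = "\<lambda>p. g (snd p) \<bullet> obs_score s (fst p) (snd p)"
  have int': "integrable P (\<lambda>(x, y). mehler s x y * (g y \<bullet> obs_score s x y))"
    using int integral_joint(2)[OF s, of ?F] by (simp add: split_beta')
  have "(\<integral>p. g (chan s p) \<bullet> obs_score s (fst p) (chan s p) \<partial>P)
      = (\<integral>(x, y). mehler s x y * (g y \<bullet> obs_score s x y) \<partial>P)"
    using integral_joint(1)[OF s, of ?F] by (simp add: split_beta')
  also have "\<dots> = (\<integral>y. \<integral>x. mehler s x y * (g y \<bullet> obs_score s x y) \<partial>\<mu> \<partial>std_gauss)"
    using P.integral_snd[OF int'] by simp
  also have "\<dots> = (\<integral>y. dens s y *\<^sub>R (g y \<bullet> score s y) \<partial>std_gauss)"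
  proof (intro Bochner_Integration.integral_cong refl)
    fix y
    have "(\<integral>x. mehler s x y * (g y \<bullet> obs_score s x y) \<partial>\<mu>) = g y \<bullet> (\<integral>x. mehler s x y *\<^sub>R obs_score s x y \<partial>\<mu>)"
      using integral_inner_right[of "g y", OF integrable_mehler_obs_score[OF s]] by simp
    then show "(\<integral>x. mehler s x y * (g y \<bullet> obs_score s x y) \<partial>\<mu>) = dens s y *\<^sub>R (g y \<bullet> score s y)"
      using dens_pos[OF s, of y] by (simp add: score_def)
  qed
  also have "\<dots> = (\<integral>p. g (chan s p) \<bullet> score s (chan s p) \<partial>P)"
    by (subst integral_chan(1)[OF s]) auto
  finally show ?thesis .
qed

end

lemma exp_diff_conv: "exp (a - b) = exp a * exp (- b)" for a b :: real
  by (simp flip: exp_add)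

section \<open>Linear growth of the score, and the score as a gradient\<close>

context centered_prob
begin

text \<open>Markov's inequality. A ball carrying half of the mass yields a lower bound for
  \<open>dens\<close>.\<close>

lemma exists_half_ball: "\<exists>R\<ge>0. 1 / 2 \<le> measure \<mu> {x. norm x \<le> R}"
proof -
  define m where "m = (\<integral>x. (norm x)\<^sup>2 \<partial>\<mu>)"
  have m: "0 \<le> m" by (simp add: m_def)
  define R where "R = sqrt (2 * m) + 1"
  have R: "0 < R" "2 * m \<le> R\<^sup>2"
    using m by (auto simp: R_def power2_sum add_nonneg_pos)
  have "measure \<mu> {x. \<not> norm x \<le> R} = (\<integral>x. indicator {x. \<not> norm x \<le> R} x \<partial>\<mu>)"
    by simp
  also have "\<dots> \<le> (\<integral>x. (norm x)\<^sup>2 / R\<^sup>2 \<partial>\<mu>)"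
  proof (rule integral_mono)
    show "indicator {x. \<not> norm x \<le> R} x \<le> (norm x)\<^sup>2 / R\<^sup>2" for x :: 'a
      using R power_mono[of R "norm x" 2] by (auto simp: indicator_def)
  qed (use integrable_norm_sq in \<open>auto simp: emeasure_eq_measure\<close>)
  also have "\<dots> \<le> 1 / 2" using R by (simp add: m_def[symmetric] field_simps)
  finally have "measure \<mu> {x. \<not> norm x \<le> R} \<le> 1 / 2" .
  moreover have "measure \<mu> (space \<mu> - {x. norm x \<le> R}) = 1 - measure \<mu> {x. norm x \<le> R}"
    by (rule prob_compl) simp
  moreover have "space \<mu> - {x. norm x \<le> R} = {x. \<not> norm x \<le> R}" by auto
  ultimately show ?thesis using R by (intro exI[of _ R]) auto
qed

text \<open>The score is governed by the posterior mean of the distance from y to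
  \<open>sqrt s *\<^sub>R x\<close>. Distances up to \<open>L + 1\<close> contribute at most that
  length; the rest is at most a multiple of \<open>eL\<close>, and \<open>eL\<close> is at most
  twice the density because half of the mass lies in the ball of radius R.\<close>

lemma score_bound: "\<exists>A\<ge>0. \<forall>s y. 0 \<le> s \<longrightarrow> s < 1 \<longrightarrow> norm (score s y) \<le> (A + 2 * norm y) / (1 - s)"
proof -
  obtain R where R: "0 \<le> R" "1 / 2 \<le> measure \<mu> {x. norm x \<le> R}" using exists_half_ball by blast
  have "norm (score s y) \<le> (R + 5 + 2 * norm y) / (1 - s)" if s: "0 \<le> s" "s < 1" for s y
  proof -
    define L where "L = norm y + R"
    define K where "K = inverse (sqrt (1 - s)) ^ DIM('a) * exp ((norm y)\<^sup>2 / 2)"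
    \<comment> \<open>\<open>L\<close> bounds the distance from y to
      \<open>sqrt s *\<^sub>R x\<close> for all x in the ball, so \<open>eL\<close> bounds the
      kernel from below there.\<close>
    define eL where "eL = K * exp (- L\<^sup>2 / (2 * (1 - s)))"
    have L: "0 \<le> L" using R by (simp add: L_def)
    have K: "0 < K" using s by (simp add: K_def)
    have meh: "mehler s x y = K * exp (- (norm (y - sqrt s *\<^sub>R x))\<^sup>2 / (2 * (1 - s)))" for x
      by (simp add: mehler_def K_def exp_diff_conv)
    have half: "eL \<le> 2 * dens s y"
    proof -
      have "eL / 2 \<le> eL * measure \<mu> {x. norm x \<le> R}"
        using R(2) K by (simp add: eL_def field_simps)
      also have "\<dots> = (\<integral>x. eL * indicator {x. norm x \<le> R} x \<partial>\<mu>)" by simp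
      also have "\<dots> \<le> dens s y" unfolding dens_def
      proof (rule integral_mono)
        fix x
        show "eL * indicator {x. norm x \<le> R} x \<le> mehler s x y"
        proof (cases "norm x \<le> R")
          case True
          have "norm (y - sqrt s *\<^sub>R x) \<le> norm y + sqrt s * norm x"
            using norm_triangle_ineq4[of y "sqrt s *\<^sub>R x"] s by simp
          also have "sqrt s * norm x \<le> 1 * R" using True s by (intro mult_mono) auto
          finally have "(norm (y - sqrt s *\<^sub>R x))\<^sup>2 \<le> L\<^sup>2" by (intro power_mono) (auto simp: L_def)
          then have "eL \<le> mehler s x y"
            unfolding meh eL_def using K s by (auto intro!: divide_right_mono)
          then show ?thesis using True by simp
        next
          case False
          then show ?thesis using mehler_pos[OF s(2), of x y] by simp
        qed
      qed (use s in \<open>auto simp: integrable_mehler emeasure_eq_measure\<close>)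
      finally show ?thesis by simp
    qed
    define c where "c = 1 / (1 - s)"
    have c: "1 \<le> c" using s by (simp add: c_def)
    have pt: "norm (mehler s x y *\<^sub>R obs_score s x y) \<le> (norm y + c * (L + 1)) * mehler s x y + c * (2 * eL)" for x
    proof -
      let ?z = "norm (y - sqrt s *\<^sub>R x)"
      have "norm (obs_score s x y) \<le> norm y + c * ?z"
        unfolding obs_score_alt[OF s(2)] using norm_triangle_ineq4[of y "(1 / (1 - s)) *\<^sub>R (y - sqrt s *\<^sub>R x)"] s
        by (simp add: c_def)
      then have "norm (mehler s x y *\<^sub>R obs_score s x y) \<le> mehler s x y * (norm y + c * ?z)"
        using mehler_pos[OF s(2), of x y] by simp
      also have "\<dots> = norm y * mehler s x y + c * (K * (?z * exp (- ?z\<^sup>2 / (2 * (1 - s)))))"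
        by (simp add: meh algebra_simps)
      also have "\<dots> \<le> norm y * mehler s x y + c * (K * ((L + 1) * exp (- ?z\<^sup>2 / (2 * (1 - s))) + 2 * exp (- L\<^sup>2 / (2 * (1 - s)))))"
        using gauss_moment_truncation[of ?z L "1 - s"] L s c K
        by (intro add_left_mono mult_left_mono) auto
      also have "\<dots> = (norm y + c * (L + 1)) * mehler s x y + c * (2 * eL)"
        by (simp add: meh eL_def algebra_simps)
      finally show ?thesis .
    qed
    have "norm (\<integral>x. mehler s x y *\<^sub>R obs_score s x y \<partial>\<mu>) \<le> (\<integral>x. norm (mehler s x y *\<^sub>R obs_score s x y) \<partial>\<mu>)"
      by (rule integral_norm_bound)
    also have "\<dots> \<le> (\<integral>x. (norm y + c * (L + 1)) * mehler s x y + c * (2 * eL) \<partial>\<mu>)"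
      by (intro integral_mono pt Bochner_Integration.integrable_add integrable_mult_right
          Bochner_Integration.integrable_norm integrable_mehler integrable_mehler_obs_score s) simp
    also have "\<dots> = (norm y + c * (L + 1)) * dens s y + c * (2 * eL)"
      using integrable_mehler[OF s(2), of y] by (simp add: dens_def)
    also have "\<dots> \<le> (norm y + c * (L + 1)) * dens s y + c * (4 * dens s y)"
      using half c by (intro add_left_mono mult_left_mono) auto
    also have "\<dots> = (norm y + c * (L + 5)) * dens s y" by (simp add: algebra_simps)
    finally have "norm (score s y) \<le> norm y + c * (L + 5)"
      using dens_pos[OF s(2), of y] by (simp add: score_def pos_divide_le_eq)
    also have "norm y \<le> c * norm y" using c mult_right_mono[of 1 c "norm y"] by simp
    finally show ?thesis by (simp add: c_def L_def algebra_simps add_divide_distrib)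
  qed
  then show ?thesis using R(1) by (intro exI[of _ "R + 5"]) (auto simp: add.commute)
qed

text \<open>One constant for all s and y. The dependence on s stays explicit as
  \<open>1 / (1 - s)\<close>, so later bounds are uniform for s in \<open>{0..b}\<close> with
  \<open>b < 1\<close>.\<close>

definition score_const :: real where
  "score_const = (SOME A. 0 \<le> A \<and> (\<forall>s y. 0 \<le> s \<longrightarrow> s < 1 \<longrightarrow> norm (score s y) \<le> (A + 2 * norm y) / (1 - s)))"

lemma score_const_nonneg: "0 \<le> score_const"
  and norm_score_le: "0 \<le> s \<Longrightarrow> s < 1 \<Longrightarrow> norm (score s y) \<le> (score_const + 2 * norm y) / (1 - s)"
  using someI_ex[OF score_bound[unfolded Bex_def]] unfolding score_const_def[symmetric] by auto

text \<open>Splitting off the growing factor \<open>exp (y \<bullet> y / 2)\<close> leaves the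
  average \<open>p\<close> of a bounded Gaussian kernel \<open>Q\<close>, to which the uniform
  remainder bound applies; the product rule restores the factor.\<close>

lemma dens_has_derivative:
  assumes s: "0 \<le> s" "s < 1"
  shows "(dens s has_derivative (\<lambda>h. dens s y * (score s y \<bullet> h))) (at y)"
proof -
  define v where "v = sqrt (1 - s)"
  have v: "0 < v" "v\<^sup>2 = 1 - s" using s by (auto simp: v_def)
  define Q where "Q u = exp (- (norm u)\<^sup>2 / 2)" for u :: 'a
  have [measurable]: "Q \<in> borel_measurable borel" unfolding Q_def by measurable
  define U where "U x y = (1 / v) *\<^sub>R (y - sqrt s *\<^sub>R x)" for x y :: 'a
  have [measurable]: "(\<lambda>x. U x y) \<in> borel_measurable borel" for y unfolding U_def by measurable
  define c where "c = inverse v ^ DIM('a)"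
  define p where "p y = (\<integral>x. Q (U x y) \<partial>\<mu>)" for y
  have Q1: "0 < Q u" "Q u \<le> 1" for u by (auto simp: Q_def)
  have meh: "mehler s x y = c * exp (y \<bullet> y / 2) * Q (U x y)" for x y
  proof -
    have "- (norm (U x y))\<^sup>2 / 2 = - ((norm (y - sqrt s *\<^sub>R x))\<^sup>2 / (2 * (1 - s)))"
      using v(1) unfolding v(2)[symmetric] by (simp add: U_def power_divide)
    then show ?thesis
      unfolding mehler_def c_def v_def[symmetric] Q_def exp_diff_conv
      by (simp only: power2_norm_eq_inner[of y] mult.assoc)
  qed
  have iQ: "integrable \<mu> (\<lambda>x. Q (U x y))" for y
    by (rule integrable_const_bound[where B=1]) (auto simp: Q1 less_imp_le)
  have iQU: "integrable \<mu> (\<lambda>x. Q (U x y) *\<^sub>R U x y)" for y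
  proof (rule Bochner_Integration.integrable_bound)
    show "integrable \<mu> (\<lambda>x. (1 / v) * (norm y + sqrt s * norm x))" using integrable_norm_mu by simp
    show "AE x in \<mu>. norm (Q (U x y) *\<^sub>R U x y) \<le> norm ((1 / v) * (norm y + sqrt s * norm x))"
    proof (rule AE_I2)
      fix x
      have "norm (Q (U x y) *\<^sub>R U x y) \<le> 1 * norm (U x y)"
        using Q1[of "U x y"] by (simp add: mult_left_le_one_le)
      also have "\<dots> \<le> (1 / v) * (norm y + sqrt s * norm x)"
        using norm_triangle_ineq4[of y "sqrt s *\<^sub>R x"] s v by (simp add: U_def divide_right_mono)
      finally show "norm (Q (U x y) *\<^sub>R U x y) \<le> norm ((1 / v) * (norm y + sqrt s * norm x))"
        by (metis abs_ge_self order_trans real_norm_def)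
    qed
  qed simp
  define gr where "gr = - (1 / v) *\<^sub>R (\<integral>x. Q (U x y) *\<^sub>R U x y \<partial>\<mu>)"
  have dp: "(p has_derivative (\<lambda>h. gr \<bullet> h)) (at y)"
  proof (rule has_derivative_quadratic_remainder[of v _ _ _ "3 / (1 - s)"])
    fix h :: 'a assume h: "norm h \<le> v"
    define h' where "h' = (1 / v) *\<^sub>R h"
    have nh: "norm h' \<le> 1" "(norm h')\<^sup>2 = (norm h)\<^sup>2 / (1 - s)"
      using h v by (auto simp: h'_def power_divide)
    have Uh: "U x (y + h) = U x y + h'" for x by (simp add: U_def h'_def algebra_simps)
    have iI: "integrable \<mu> (\<lambda>x. Q (U x y) * (U x y \<bullet> h'))"
      using integrable_inner_left[of h', OF iQU[of y]] by simp
    have "gr \<bullet> h = - (\<integral>x. Q (U x y) *\<^sub>R U x y \<partial>\<mu>) \<bullet> h'"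
      by (simp add: gr_def h'_def)
    also have "\<dots> = - (\<integral>x. Q (U x y) * (U x y \<bullet> h') \<partial>\<mu>)"
      using integral_inner_left[of h', OF iQU[of y]] by simp
    finally have eq: "p (y + h) - p y - gr \<bullet> h
        = (\<integral>x. Q (U x y + h') - Q (U x y) + Q (U x y) * (U x y \<bullet> h') \<partial>\<mu>)"
      using iQ[of "y + h"] iQ[of y] iI by (simp add: p_def Uh)
    have "\<bar>p (y + h) - p y - gr \<bullet> h\<bar> \<le> (\<integral>x. \<bar>Q (U x y + h') - Q (U x y) + Q (U x y) * (U x y \<bullet> h')\<bar> \<partial>\<mu>)"
      unfolding eq using integral_norm_bound[of \<mu> "\<lambda>x. Q (U x y + h') - Q (U x y) + Q (U x y) * (U x y \<bullet> h')"] by simp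
    also have "\<dots> \<le> (\<integral>x. 3 * (norm h')\<^sup>2 \<partial>\<mu>)"
    proof (rule integral_mono)
      show "integrable \<mu> (\<lambda>x. \<bar>Q (U x y + h') - Q (U x y) + Q (U x y) * (U x y \<bullet> h')\<bar>)"
        using iQ[of "y + h"] iQ[of y] iI by (simp add: Uh)
      show "\<bar>Q (U x y + h') - Q (U x y) + Q (U x y) * (U x y \<bullet> h')\<bar> \<le> 3 * (norm h')\<^sup>2" for x
        unfolding Q_def by (rule gauss_kernel_remainder[OF nh(1)])
    qed simp
    finally show "\<bar>p (y + h) - p y - gr \<bullet> h\<bar> \<le> 3 / (1 - s) * (norm h)\<^sup>2" by (simp add: nh(2))
  qed (rule v)
  have dens_eq: "dens s = (\<lambda>y. c * exp (y \<bullet> y / 2) * p y)"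
    unfolding dens_def p_def meh by (simp add: fun_eq_iff)
  have "(dens s has_derivative (\<lambda>h. c * exp (y \<bullet> y / 2) * (p y * (y \<bullet> h) + gr \<bullet> h))) (at y)"
    unfolding dens_eq by (auto intro!: derivative_eq_intros dp simp: algebra_simps inner_commute)
  moreover have "c * exp (y \<bullet> y / 2) * (p y * (y \<bullet> h) + gr \<bullet> h) = dens s y * (score s y \<bullet> h)" for h
  proof -
    have "(1 / (1 - s)) *\<^sub>R (y - sqrt s *\<^sub>R x) = (1 / v) *\<^sub>R U x y" for x
      using v(2) by (simp add: U_def power2_eq_square)
    then have "mehler s x y *\<^sub>R obs_score s x y
        = (c * exp (y \<bullet> y / 2)) *\<^sub>R (Q (U x y) *\<^sub>R y - (1 / v) *\<^sub>R (Q (U x y) *\<^sub>R U x y))" for x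
      unfolding meh obs_score_alt[OF s(2)]
      by (simp add: scaleR_right_diff_distrib mult.commute mult.left_commute)
    moreover have split: "(\<integral>x. Q (U x y) *\<^sub>R y - (1 / v) *\<^sub>R (Q (U x y) *\<^sub>R U x y) \<partial>\<mu>) = p y *\<^sub>R y + gr"
    proof -
      have "(\<integral>x. Q (U x y) *\<^sub>R y - (1 / v) *\<^sub>R (Q (U x y) *\<^sub>R U x y) \<partial>\<mu>)
          = (\<integral>x. Q (U x y) *\<^sub>R y \<partial>\<mu>) - (\<integral>x. (1 / v) *\<^sub>R (Q (U x y) *\<^sub>R U x y) \<partial>\<mu>)"
        by (intro Bochner_Integration.integral_diff integrable_scaleR_left integrable_scaleR_right iQ iQU)
      also have "\<dots> = p y *\<^sub>R y - (1 / v) *\<^sub>R (\<integral>x. Q (U x y) *\<^sub>R U x y \<partial>\<mu>)"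
        unfolding integral_scaleR_right using iQ[of y] by (simp add: p_def)
      finally show ?thesis by (simp add: gr_def)
    qed
    ultimately have "(\<integral>x. mehler s x y *\<^sub>R obs_score s x y \<partial>\<mu>) = (c * exp (y \<bullet> y / 2)) *\<^sub>R (p y *\<^sub>R y + gr)"
      by (simp only: integral_scaleR_right split)
    then show ?thesis
      using dens_pos[OF s(2), of y] by (simp add: score_def inner_add_left)
  qed
  ultimately show ?thesis by simp
qed

lemma ln_dens_has_derivative:
  assumes s: "0 \<le> s" "s < 1"
  shows "((\<lambda>y. ln (dens s y)) has_derivative (\<lambda>h. score s y \<bullet> h)) (at y)"
  using dens_pos[OF s(2), of y]
  by (auto intro!: derivative_eq_intros dens_has_derivative[OF s] simp: field_simps)

lemma integrable_mult_linear_growth: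
  fixes F G :: "'a \<times> 'a \<Rightarrow> 'b::euclidean_space"
  assumes [measurable]: "F \<in> borel_measurable (borel \<Otimes>\<^sub>M borel)" "G \<in> borel_measurable (borel \<Otimes>\<^sub>M borel)"
    and F: "\<And>p. norm (F p) \<le> a * (1 + norm (fst p) + norm (snd p))"
    and G: "\<And>p. norm (G p) \<le> b * (1 + norm (fst p) + norm (snd p))"
  shows "integrable P (\<lambda>p. F p \<bullet> G p)"
proof (rule integrable_P_quadratic)
  fix p :: "'a \<times> 'a"
  let ?t = "1 + norm (fst p) + norm (snd p)"
  have "0 \<le> norm (F 0)" by simp
  also have "\<dots> \<le> a" using F[of 0] by simp
  finally have a: "0 \<le> a" .
  have "0 \<le> norm (G 0)" by simp
  also have "\<dots> \<le> b" using G[of 0] by simp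
  finally have b: "0 \<le> b" .
  have "norm (F p \<bullet> G p) \<le> norm (F p) * norm (G p)" using Cauchy_Schwarz_ineq2 by simp
  also have "\<dots> \<le> (a * ?t) * (b * ?t)" using F G a by (intro mult_mono) auto
  also have "\<dots> = (a * b) * ?t\<^sup>2" by (simp add: power2_eq_square)
  also have "?t\<^sup>2 \<le> 2 * (1\<^sup>2 + (norm (fst p) + norm (snd p))\<^sup>2)"
    using sum_sq_le[of 1 "norm (fst p) + norm (snd p)"] by (simp add: add.assoc)
  also have "\<dots> \<le> 2 + 4 * ((norm (fst p))\<^sup>2 + (norm (snd p))\<^sup>2)"
    using sum_sq_le[of "norm (fst p)" "norm (snd p)"] by simp
  finally show "norm (F p \<bullet> G p) \<le> a * b * 2 + (a * b * 4) * ((norm (fst p))\<^sup>2 + (norm (snd p))\<^sup>2)"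
    using a b by (simp add: mult_left_mono distrib_left mult.assoc)
qed measurable

lemma score_growth:
  assumes s: "0 \<le> s" "s < 1" and r: "0 \<le> r" "r \<le> 1"
  shows "norm (score s (chan r p)) \<le> ((score_const + 2) / (1 - s)) * (1 + norm (fst p) + norm (snd p))"
proof -
  have "norm (score s (chan r p)) \<le> (score_const + 2 * norm (chan r p)) / (1 - s)" by (rule norm_score_le[OF s])
  also have "\<dots> \<le> (score_const + 2 * (norm (fst p) + norm (snd p))) / (1 - s)"
    using norm_chan_le[OF r, of p] s by (intro divide_right_mono add_left_mono mult_left_mono) auto
  also have "\<dots> \<le> ((score_const + 2) * (1 + norm (fst p) + norm (snd p))) / (1 - s)"
    using s score_const_nonneg by (intro divide_right_mono) (auto simp: algebra_simps)
  finally show ?thesis by simp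
qed

lemma obs_score_growth:
  fixes p :: "'a \<times> 'a"
  assumes s: "0 \<le> s" "s < 1"
  shows "norm (obs_score s (fst p) (chan s p)) \<le> (2 / (1 - s)) * (1 + norm (fst p) + norm (snd p))"
proof -
  have "norm (obs_score s (fst p) (chan s p)) \<le> (sqrt s * norm (fst p) + s * norm (chan s p)) / (1 - s)"
    unfolding obs_score_def using norm_triangle_ineq4[of "sqrt s *\<^sub>R fst p" "s *\<^sub>R chan s p"] s
    by (simp add: divide_right_mono)
  also have "\<dots> \<le> (1 * norm (fst p) + 1 * (norm (fst p) + norm (snd p))) / (1 - s)"
    using norm_chan_le[of s p] s by (intro divide_right_mono add_mono mult_mono) auto
  also have "\<dots> \<le> (2 * (1 + norm (fst p) + norm (snd p))) / (1 - s)"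
    using s by (intro divide_right_mono) auto
  finally show ?thesis by simp
qed

end

text \<open>The exchange of the two time scales: results on the heat flow at noise variance
  \<open>1 / s - 1\<close> become results on the channel at s.\<close>

lemma chan_eq_heat:
  assumes s: "0 < s" "s < 1"
  shows "chan s p = sqrt s *\<^sub>R (fst p + sqrt (1 / s - 1) *\<^sub>R snd p)"
proof -
  have "sqrt s * sqrt (1 / s - 1) = sqrt (1 - s)"
    using s by (simp add: real_sqrt_mult[symmetric] right_diff_distrib)
  then show ?thesis by (simp add: chan_def scaleR_add_right)
qed

section \<open>From the correlation bound to the monotonicity of Fisher information\<close>

context centered_prob
begin

lemma integral_heat:
  assumes h: "bdd_meas h"
  shows "(\<integral>p. h (fst p + sqrt r *\<^sub>R snd p) \<partial>P) = (\<integral>x. heat r h x \<partial>\<mu>)"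
proof -
  note [measurable] = bdd_meas_measurable[OF h]
  have "integrable P (\<lambda>p. h (fst p + sqrt r *\<^sub>R snd p))"
    by (rule P.bdd_meas_integrable[OF h]) measurable
  from P.integral_fst'[OF this] show ?thesis by (simp add: heat_def)
qed

text \<open>Integrating out the noise first turns its linear term into \<open>heat_grad\<close>, so
  the pairing depends on h only through \<open>heat T h\<close>. This makes pairings at different
  noise levels comparable.\<close>

lemma integral_heat_obs_score:
  assumes h: "bdd_meas h" and s: "0 < s" "s < 1"
  defines "T \<equiv> 1 / s - 1"
  shows "integrable P (\<lambda>p. h (fst p + sqrt T *\<^sub>R snd p) * (b \<bullet> obs_score s (fst p) (chan s p)))"
    and "(\<integral>p. h (fst p + sqrt T *\<^sub>R snd p) * (b \<bullet> obs_score s (fst p) (chan s p)) \<partial>P)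
      = sqrt s * (\<integral>x. (b \<bullet> x) * heat T h x - b \<bullet> heat_grad T h x \<partial>\<mu>)"
proof -
  note [measurable] = bdd_meas_measurable[OF h]
  have T: "0 < T" using s by (simp add: T_def)
  \<comment> \<open>Matches the noise coefficient in \<open>obs_score_chan\<close> with the factor
    \<open>1 / sqrt T\<close> in \<open>heat_grad\<close>.\<close>
  have sT: "s / sqrt (1 - s) = sqrt s / sqrt T"
  proof -
    have "T = (1 - s) / s" using s by (simp add: T_def diff_divide_distrib)
    then show ?thesis using s by (simp add: real_sqrt_divide)
  qed
  obtain B where B: "0 \<le> B" "\<And>x. \<bar>h x\<bar> \<le> B" using h by (rule bdd_meas_bound) blast
  let ?F = "\<lambda>p. h (fst p + sqrt T *\<^sub>R snd p) * (b \<bullet> obs_score s (fst p) (chan s p))"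
  have "integrable P (\<lambda>p. (h (fst p + sqrt T *\<^sub>R snd p) *\<^sub>R b) \<bullet> obs_score s (fst p) (chan s p))"
  proof (rule integrable_mult_linear_growth)
    fix p :: "'a \<times> 'a"
    have "norm (h (fst p + sqrt T *\<^sub>R snd p) *\<^sub>R b) \<le> B * norm b * 1" using B by (simp add: mult_right_mono)
    also have "\<dots> \<le> B * norm b * (1 + norm (fst p) + norm (snd p))" using B by (intro mult_left_mono) auto
    finally show "norm (h (fst p + sqrt T *\<^sub>R snd p) *\<^sub>R b) \<le> B * norm b * (1 + norm (fst p) + norm (snd p))" .
    show "norm (obs_score s (fst p) (chan s p)) \<le> (2 / (1 - s)) * (1 + norm (fst p) + norm (snd p))"
      using obs_score_growth s by simp
  qed (simp_all add: obs_score_def)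
  then show int: "integrable P ?F" by simp
  have "(\<integral>p. ?F p \<partial>P) = (\<integral>x. \<integral>z. ?F (x, z) \<partial>std_gauss \<partial>\<mu>)"
    using P.integral_fst'[OF int] by simp
  also have "\<dots> = (\<integral>x. sqrt s * ((b \<bullet> x) * heat T h x - b \<bullet> heat_grad T h x) \<partial>\<mu>)"
  proof (rule Bochner_Integration.integral_cong[OF refl])
    fix x
    have hx: "bdd_meas (\<lambda>z. h (x + sqrt T *\<^sub>R z))" by (rule bdd_meas_comp_affine[OF h])
    note iz = integrable_bdd_times_id[OF hx]
    have i1: "integrable std_gauss (\<lambda>z. h (x + sqrt T *\<^sub>R z))" by (rule std_gauss.bdd_meas_integrable[OF h]) auto
    have i2: "integrable std_gauss (\<lambda>z. h (x + sqrt T *\<^sub>R z) * (b \<bullet> z))"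
      using integrable_inner_right[of b, OF iz] by simp
    have "?F (x, z) = (sqrt s * (b \<bullet> x)) * h (x + sqrt T *\<^sub>R z) - (sqrt s / sqrt T) * (h (x + sqrt T *\<^sub>R z) * (b \<bullet> z))" for z
    proof -
      have o: "obs_score s x (chan s (x, z)) = sqrt s *\<^sub>R x - (sqrt s / sqrt T) *\<^sub>R z"
        using obs_score_chan[of s "(x, z)"] s sT by simp
      show ?thesis
        by (simp only: o fst_conv snd_conv inner_diff_right inner_scaleR_right) (simp add: algebra_simps)
    qed
    then have "(\<integral>z. ?F (x, z) \<partial>std_gauss) = (sqrt s * (b \<bullet> x)) * heat T h x - (sqrt s / sqrt T) * (\<integral>z. h (x + sqrt T *\<^sub>R z) * (b \<bullet> z) \<partial>std_gauss)"
      using i1 i2 by (simp add: heat_def)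
    also have "(\<integral>z. h (x + sqrt T *\<^sub>R z) * (b \<bullet> z) \<partial>std_gauss) = b \<bullet> (\<integral>z. h (x + sqrt T *\<^sub>R z) *\<^sub>R z \<partial>std_gauss)"
      using integral_inner_right[of b, OF iz] by simp
    finally show "(\<integral>z. ?F (x, z) \<partial>std_gauss) = sqrt s * ((b \<bullet> x) * heat T h x - b \<bullet> heat_grad T h x)"
      by (simp add: heat_grad_def right_diff_distrib mult.assoc)
  qed
  finally show "(\<integral>p. ?F p \<partial>P) = sqrt s * (\<integral>x. (b \<bullet> x) * heat T h x - b \<bullet> heat_grad T h x \<partial>\<mu>)"
    by simp
qed

lemma integrable_score_inner_sq:
  assumes s: "0 \<le> s" "s < 1"
  shows "integrable P (\<lambda>p. (b \<bullet> score s (chan s p))\<^sup>2)"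
proof -
  have "integrable P (\<lambda>p. (b \<bullet> score s (chan s p)) \<bullet> (b \<bullet> score s (chan s p)))"
  proof (rule integrable_mult_linear_growth)
    fix p :: "'a \<times> 'a"
    have "norm (b \<bullet> score s (chan s p)) \<le> norm b * norm (score s (chan s p))"
      using Cauchy_Schwarz_ineq2 by simp
    also have "\<dots> \<le> norm b * (((score_const + 2) / (1 - s)) * (1 + norm (fst p) + norm (snd p)))"
      using score_growth[OF s s(1), of p] s by (intro mult_left_mono) auto
    finally show "norm (b \<bullet> score s (chan s p)) \<le> (norm b * ((score_const + 2) / (1 - s))) * (1 + norm (fst p) + norm (snd p))"
      "norm (b \<bullet> score s (chan s p)) \<le> (norm b * ((score_const + 2) / (1 - s))) * (1 + norm (fst p) + norm (snd p))"
      by (simp_all add: mult.assoc)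
  qed simp_all
  then show ?thesis by (simp add: power2_eq_square)
qed

text \<open>Truncating the score keeps the test function bounded, so that \<open>poincare_correlation\<close> applies.
  The score at \<open>s\<close> is linked to the one at \<open>t\<close> because both pairings in \<open>integral_heat_obs_score\<close> reduce to
  the same integral over \<open>\<mu>\<close>.\<close>

lemma truncated_score_le:
  fixes b :: 'a and n :: real
  assumes C: "poincare_ineq \<mu> C" "0 \<le> C" and s: "0 < s" "s < t" "t < 1" and n: "0 \<le> n"
  defines "\<kappa> \<equiv> \<lambda>y. max (- n) (min n (b \<bullet> score s y))"
  shows "(\<integral>p. (\<kappa> (chan s p))\<^sup>2 \<partial>P)
    \<le> (s / t) * ((C + (1 / t - 1)) / (C + (1 / s - 1))) * (\<integral>p. (b \<bullet> score t (chan t p))\<^sup>2 \<partial>P)"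
proof -
  define T r where "T = 1 / s - 1" and "r = 1 / t - 1"
  have st: "0 \<le> s" "s < 1" "0 < t" "0 \<le> t" using s by auto
  have T: "0 < T" "0 < r" "r \<le> T" using s by (auto simp: T_def r_def field_simps)
  \<comment> \<open>\<open>a\<close> is the ratio of the factors \<open>sqrt s\<close> and
    \<open>sqrt t\<close> in front of the common integral \<open>Z\<close>; \<open>\<rho>\<close> is
    the bound on the squared maximal correlation.\<close>
  define a \<rho> where "a = sqrt (s / t)" and "\<rho> = (C + r) / (C + T)"
  have a\<rho>: "0 < a" "0 < \<rho>" "a\<^sup>2 = s / t" using s T C by (auto simp: a_def \<rho>_def)
  have [measurable]: "\<kappa> \<in> borel_measurable borel" unfolding \<kappa>_def by measurable
  have \<kappa>: "\<bar>\<kappa> y\<bar> \<le> n" for y using n by (auto simp: \<kappa>_def)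
  define h where "h y = \<kappa> (0 + sqrt s *\<^sub>R y)" for y
  have "bdd_meas \<kappa>" unfolding bdd_meas_def using \<kappa> by auto
  then have h: "bdd_meas h" unfolding h_def[abs_def] by (rule bdd_meas_comp_affine)
  \<comment> \<open>\<open>U\<close> is the conditional expectation of the truncated score at s
    given the output at t, in the coupling by independent increments. \<open>P\<close> does not
    carry that coupling, as both channels share one noise vector; each integral below involves only
    one of the two outputs, so marginal laws suffice.\<close>
  define u where "u = heat (T - r) h"
  have u: "bdd_meas u" unfolding u_def by (rule heat_bdd_meas[OF h])
  define U where "U y = u (0 + (1 / sqrt t) *\<^sub>R y)" for y
  have U: "bdd_meas U" unfolding U_def[abs_def] by (rule bdd_meas_comp_affine[OF u])
  note [measurable] = bdd_meas_measurable[OF U] bdd_meas_measurable[OF u]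
  have hs: "h (fst p + sqrt T *\<^sub>R snd p) = \<kappa> (chan s p)" for p
    using chan_eq_heat[of s p] s by (simp add: h_def T_def)
  have us: "u (fst p + sqrt r *\<^sub>R snd p) = U (chan t p)" for p
    using chan_eq_heat[of t p] s by (simp add: U_def r_def)
  define Z where "Z = (\<integral>x. (b \<bullet> x) * heat T h x - b \<bullet> heat_grad T h x \<partial>\<mu>)"
  define w where "w p = b \<bullet> score t (chan t p)" for p
  have [measurable]: "w \<in> borel_measurable (borel \<Otimes>\<^sub>M borel)" unfolding w_def[abs_def] by measurable
  have iw2: "integrable P (\<lambda>p. (w p)\<^sup>2)" unfolding w_def by (rule integrable_score_inner_sq) (use s in auto)
  have iw: "integrable P w" by (rule P.square_integrable_imp_integrable[OF _ iw2]) simp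
  define m where "m = (\<integral>x. heat T h x \<partial>\<mu>)"
  define K where "K = (\<integral>p. (\<kappa> (chan s p))\<^sup>2 \<partial>P)"
  define W where "W = (\<integral>p. (w p)\<^sup>2 \<partial>P)"
  have uT: "heat r u = heat T h" 
    unfolding u_def using heat_heat[OF h, of r "T - r"] T by (simp add: fun_eq_iff)
  have ugT: "heat_grad r u = heat_grad T h"
    unfolding u_def using heat_grad_heat[OF h, of r "T - r"] T by simp

  have K1: "K = (\<integral>x. heat T (\<lambda>y. (h y)\<^sup>2) x \<partial>\<mu>)"
    using integral_heat[OF bdd_meas_power2[OF h], of T] by (simp add: K_def hs)
  \<comment> \<open>Truncation keeps the sign and does not enlarge the modulus, so the square of the
    truncated score is at most its product with the full one.\<close>
  have "K \<le> (\<integral>p. \<kappa> (chan s p) * (b \<bullet> score s (chan s p)) \<partial>P)"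
    unfolding K_def
  proof (rule integral_mono)
    show "integrable P (\<lambda>p. (\<kappa> (chan s p))\<^sup>2)"
      by (rule integrable_bounded[where B="n\<^sup>2"]) (use \<kappa> n power_mono[OF \<kappa>, of _ 2] in auto)
    have ib: "integrable P (\<lambda>p. b \<bullet> score s (chan s p))"
      by (rule P.square_integrable_imp_integrable[OF _ integrable_score_inner_sq[OF st(1,2)]]) simp
    show "integrable P (\<lambda>p. \<kappa> (chan s p) * (b \<bullet> score s (chan s p)))"
    proof (rule Bochner_Integration.integrable_bound)
      show "integrable P (\<lambda>p. n * \<bar>b \<bullet> score s (chan s p)\<bar>)" using ib by (intro integrable_mult_right integrable_abs)
      show "AE p in P. norm (\<kappa> (chan s p) * (b \<bullet> score s (chan s p))) \<le> norm (n * \<bar>b \<bullet> score s (chan s p)\<bar>)"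
        using \<kappa> n by (auto simp: abs_mult mult_right_mono)
    qed measurable
    show "(\<kappa> (chan s p))\<^sup>2 \<le> \<kappa> (chan s p) * (b \<bullet> score s (chan s p))" for p
    proof -
      have "0 \<le> \<kappa> (chan s p) * (b \<bullet> score s (chan s p) - \<kappa> (chan s p))"
        unfolding \<kappa>_def using n by (auto simp: max_def min_def mult_nonneg_nonpos)
      then show ?thesis by (simp add: power2_eq_square algebra_simps)
    qed
  qed
  also have "\<dots> = (\<integral>p. (\<kappa> (chan s p) *\<^sub>R b) \<bullet> score s (chan s p) \<partial>P)" by simp
  also have "\<dots> = (\<integral>p. (\<kappa> (chan s p) *\<^sub>R b) \<bullet> obs_score s (fst p) (chan s p) \<partial>P)"
    using integral_heat_obs_score(1)[OF h, of s b] s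
    by (intro score_tower[symmetric, of s "\<lambda>y. \<kappa> y *\<^sub>R b"]) (auto simp: T_def[symmetric] hs)
  also have "\<dots> = sqrt s * Z"
    using integral_heat_obs_score(2)[OF h, of s b] s by (simp add: T_def[symmetric] hs Z_def)
  finally have KZ: "K \<le> sqrt s * Z" .

  have "(\<integral>p. U (chan t p) * w p \<partial>P) = (\<integral>p. (U (chan t p) *\<^sub>R b) \<bullet> score t (chan t p) \<partial>P)" by (simp add: w_def)
  also have "\<dots> = (\<integral>p. (U (chan t p) *\<^sub>R b) \<bullet> obs_score t (fst p) (chan t p) \<partial>P)"
    using integral_heat_obs_score(1)[OF u, of t b] s
    by (intro score_tower[symmetric, of t "\<lambda>y. U y *\<^sub>R b"]) (auto simp: r_def[symmetric] us)
  also have "\<dots> = sqrt t * Z"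
    using integral_heat_obs_score(2)[OF u, of t b] s by (simp add: r_def[symmetric] us Z_def uT ugT)
  finally have UZ: "(\<integral>p. U (chan t p) * w p \<partial>P) = sqrt t * Z" .

  have one: "bdd_meas (\<lambda>_::'a. 1)" by (auto simp: bdd_meas_def)
  have h1: "heat r (\<lambda>_. 1) x = 1" for x :: 'a by (simp add: heat_def)
  have g1: "heat_grad r (\<lambda>_. 1) x = 0" for x :: 'a by (simp add: heat_grad_def std_gauss_mean_zero)
  \<comment> \<open>The score has mean zero because X is centered. This permits replacing
    \<open>U\<close> by \<open>U - m\<close>, whose square mean the correlation bound
    controls.\<close>
  have "(\<integral>p. w p \<partial>P) = (\<integral>p. b \<bullet> obs_score t (fst p) (chan t p) \<partial>P)"
    unfolding w_def using integral_heat_obs_score(1)[OF one, of t b] s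
    by (intro score_tower[symmetric, of t "\<lambda>y. b"]) auto
  also have "\<dots> = 0"
    using integral_heat_obs_score(2)[OF one, of t b] s integrable_id mean_zero
    by (simp add: r_def[symmetric] h1 g1)
  finally have w0: "(\<integral>p. w p \<partial>P) = 0" .

  have iU: "integrable P (\<lambda>p. U (chan t p))" "integrable P (\<lambda>p. (U (chan t p))\<^sup>2)"
    using P.bdd_meas_integrable[OF U, of "chan t"] P.bdd_meas_integrable[OF bdd_meas_power2[OF U], of "chan t"] by auto
  have iUw: "integrable P (\<lambda>p. U (chan t p) * w p)"
  proof -
    obtain B where B: "0 \<le> B" "\<And>x. \<bar>U x\<bar> \<le> B" using U by (rule bdd_meas_bound) blast
    show ?thesis
    proof (rule Bochner_Integration.integrable_bound)
      show "integrable P (\<lambda>p. B * \<bar>w p\<bar>)" using iw by (intro integrable_mult_right integrable_abs)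
      show "AE p in P. norm (U (chan t p) * w p) \<le> norm (B * \<bar>w p\<bar>)"
        using B by (auto simp: abs_mult mult_right_mono)
    qed measurable
  qed
  have EU: "(\<integral>p. U (chan t p) \<partial>P) = m"
    using integral_heat[OF u, of r] by (simp add: us uT m_def)
  have EU2: "(\<integral>p. (U (chan t p))\<^sup>2 \<partial>P) = (\<integral>x. heat r (\<lambda>y. (u y)\<^sup>2) x \<partial>\<mu>)"
    using integral_heat[OF bdd_meas_power2[OF u], of r] by (simp add: us)
  have "(\<integral>p. (U (chan t p) - m)\<^sup>2 \<partial>P) = (\<integral>p. (U (chan t p))\<^sup>2 \<partial>P) - m\<^sup>2"
    using P.variance_eq[OF iU] unfolding EU .
  moreover have "(C + T) * ((\<integral>p. (U (chan t p))\<^sup>2 \<partial>P) - m\<^sup>2) \<le> (C + r) * (K - m\<^sup>2)"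
    using poincare_correlation[OF h T(1) C T(2,3)] unfolding EU2 K1 m_def u_def .
  moreover have "(C + r) * (K - m\<^sup>2) \<le> (C + r) * K"
    using C T by (intro mult_left_mono) auto
  ultimately have "(C + T) * (\<integral>p. (U (chan t p) - m)\<^sup>2 \<partial>P) \<le> (C + r) * K" by (simp only: order_trans)
  then have VU: "(\<integral>p. (U (chan t p) - m)\<^sup>2 \<partial>P) \<le> \<rho> * K"
    using C T by (simp add: \<rho>_def field_simps)

  have "K \<le> a * (\<integral>p. U (chan t p) * w p \<partial>P)"
    unfolding UZ using KZ s by (simp add: a_def real_sqrt_divide)
  also have "(\<integral>p. U (chan t p) * w p \<partial>P) = (\<integral>p. (U (chan t p) - m) * w p \<partial>P)"
    using iUw iw by (simp add: left_diff_distrib w0)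
  also have "a * \<dots> = (\<integral>p. (U (chan t p) - m) * (a * w p) \<partial>P)"
    by (subst integral_mult_right_zero[symmetric]) (simp add: ac_simps)
  \<comment> \<open>Cauchy-Schwarz as a weighted mean inequality. With weight \<open>\<rho>\<close>
    the variance of \<open>U\<close> contributes at most \<open>K / 2\<close>, which is then
    absorbed on the left.\<close>
  also have "\<dots> \<le> (\<integral>p. (1 / \<rho> * (U (chan t p) - m)\<^sup>2 + a\<^sup>2 * \<rho> * (w p)\<^sup>2) / 2 \<partial>P)"
  proof (rule integral_mono)
    show "integrable P (\<lambda>p. (U (chan t p) - m) * (a * w p))"
      using integrable_mult_right[of a, OF Bochner_Integration.integrable_diff[OF iUw integrable_mult_right[of m, OF iw]]]
      by (simp add: algebra_simps)
    show "integrable P (\<lambda>p. (1 / \<rho> * (U (chan t p) - m)\<^sup>2 + a\<^sup>2 * \<rho> * (w p)\<^sup>2) / 2)"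
      using iU iw2 by (simp add: power2_diff)
    fix p
    have "(U (chan t p) - m) * (a * w p) = ((U (chan t p) - m) / sqrt \<rho>) * (sqrt \<rho> * (a * w p))"
      using a\<rho> by simp
    also have "\<dots> \<le> (((U (chan t p) - m) / sqrt \<rho>)\<^sup>2 + (sqrt \<rho> * (a * w p))\<^sup>2) / 2"
      by (rule mult_le_half_squares)
    also have "\<dots> = (1 / \<rho> * (U (chan t p) - m)\<^sup>2 + a\<^sup>2 * \<rho> * (w p)\<^sup>2) / 2"
      using a\<rho>(2) by (simp add: power_divide power_mult_distrib)
    finally show "(U (chan t p) - m) * (a * w p) \<le> (1 / \<rho> * (U (chan t p) - m)\<^sup>2 + a\<^sup>2 * \<rho> * (w p)\<^sup>2) / 2" .
  qed
  also have "\<dots> = (1 / \<rho> * (\<integral>p. (U (chan t p) - m)\<^sup>2 \<partial>P) + a\<^sup>2 * \<rho> * W) / 2"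
    using iU iw2 by (simp add: power2_diff W_def)
  also have "\<dots> \<le> (1 / \<rho> * (\<rho> * K) + a\<^sup>2 * \<rho> * W) / 2"
    using VU a\<rho> by (intro divide_right_mono add_right_mono mult_left_mono) auto
  finally have "K \<le> a\<^sup>2 * \<rho> * W" using a\<rho>(2) by simp
  then show ?thesis by (simp add: K_def W_def a\<rho>(3) \<rho>_def T_def r_def w_def)
qed

definition fisher :: "real \<Rightarrow> real" where
  "fisher s = (\<integral>p. (norm (score s (chan s p)))\<^sup>2 \<partial>P)"

text \<open>Dominated convergence removes the truncation in each direction, and the directions are
  summed over the basis. The weight equals \<open>(1 + s (C - 1)) / s\<^sup>2\<close>.\<close>

lemma fisher_mono:
  assumes C: "poincare_ineq \<mu> C" "0 \<le> C" and s: "0 < s" "s \<le> t" "t < 1"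
  shows "fisher s * ((C + (1 / s - 1)) / s) \<le> fisher t * ((C + (1 / t - 1)) / t)"
proof (cases "s = t")
  case False
  with s have st: "s < t" by simp
  define c where "c = (s / t) * ((C + (1 / t - 1)) / (C + (1 / s - 1)))"
  have comp: "(\<integral>p. (b \<bullet> score s (chan s p))\<^sup>2 \<partial>P) \<le> c * (\<integral>p. (b \<bullet> score t (chan t p))\<^sup>2 \<partial>P)" for b
  proof (rule LIMSEQ_le_const2)
    let ?k = "\<lambda>n y. max (- real n) (min (real n) (b \<bullet> score s y))"
    show "(\<lambda>n. \<integral>p. (?k n (chan s p))\<^sup>2 \<partial>P) \<longlonglongrightarrow> (\<integral>p. (b \<bullet> score s (chan s p))\<^sup>2 \<partial>P)"
    proof (rule integral_dominated_convergence)
      show "integrable P (\<lambda>p. (b \<bullet> score s (chan s p))\<^sup>2)"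
        by (rule integrable_score_inner_sq) (use s in auto)
      have "\<bar>max (- real n) (min (real n) v)\<bar> \<le> \<bar>v\<bar>" for n v by auto
      then show "AE p in P. norm ((?k n (chan s p))\<^sup>2) \<le> (b \<bullet> score s (chan s p))\<^sup>2" for n
        by (auto simp: abs_le_square_iff)
      show "AE p in P. (\<lambda>n. (?k n (chan s p))\<^sup>2) \<longlonglongrightarrow> (b \<bullet> score s (chan s p))\<^sup>2"
      proof (rule AE_I2)
        fix p
        obtain N where N: "\<bar>b \<bullet> score s (chan s p)\<bar> \<le> real N" using real_arch_simple by blast
        have "(?k n (chan s p))\<^sup>2 = (b \<bullet> score s (chan s p))\<^sup>2" if "N \<le> n" for n
          using N that by (auto simp: max_def min_def)
        then show "(\<lambda>n. (?k n (chan s p))\<^sup>2) \<longlonglongrightarrow> (b \<bullet> score s (chan s p))\<^sup>2"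
          by (intro tendsto_eventually eventually_sequentiallyI[of N])
      qed
    qed measurable
    show "\<exists>N. \<forall>n\<ge>N. (\<integral>p. (?k n (chan s p))\<^sup>2 \<partial>P) \<le> c * (\<integral>p. (b \<bullet> score t (chan t p))\<^sup>2 \<partial>P)"
      unfolding c_def using truncated_score_le[OF C s(1) st s(3)] by auto
  qed
  have fs: "fisher q = (\<Sum>b\<in>Basis. \<integral>p. (b \<bullet> score q (chan q p))\<^sup>2 \<partial>P)" if "0 \<le> q" "q < 1" for q
  proof -
    have "(norm x)\<^sup>2 = (\<Sum>b\<in>Basis. (b \<bullet> x)\<^sup>2)" for x :: 'a
      unfolding power2_norm_eq_inner by (subst euclidean_inner) (simp add: power2_eq_square inner_commute)
    then show ?thesis unfolding fisher_def
      using integrable_score_inner_sq[OF that] by (simp add: Bochner_Integration.integral_sum)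
  qed
  have "fisher s \<le> c * fisher t"
    using s by (simp add: fs sum_distrib_left comp sum_mono)
  moreover have pos: "0 < C + (1 / s - 1)" using C s by (simp add: add_nonneg_pos)
  ultimately have "fisher s * ((C + (1 / s - 1)) / s) \<le> c * fisher t * ((C + (1 / s - 1)) / s)"
    using s by (intro mult_right_mono) auto
  also have "\<dots> = fisher t * ((C + (1 / t - 1)) / t)"
    using pos s unfolding c_def by (simp add: divide_simps)
  finally show ?thesis .
qed simp

end

section \<open>Entropy along the channel\<close>

text \<open>A mean value comparison for a D not known to be differentiable: at each s it has a
  differentiable minorant \<open>E s\<close> touching at s, and m stands for the quotient of the
  derivatives of D and \<open>\<phi>\<close>. As m is nondecreasing, slopes relative to
  \<open>\<phi>\<close> are at most \<open>m b\<close> before b and at least \<open>m b\<close>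
  after it.\<close>

lemma touching_below:
  fixes D \<phi> \<phi>' m :: "real \<Rightarrow> real" and E :: "real \<Rightarrow> real \<Rightarrow> real"
  assumes D: "\<And>b. 0 \<le> b \<Longrightarrow> b < 1 \<Longrightarrow> continuous_on {0..b} D"
    and \<phi>0: "\<And>b. 0 \<le> b \<Longrightarrow> b < 1 \<Longrightarrow> continuous_on {0..b} \<phi>"
    and touch: "\<And>s. 0 < s \<Longrightarrow> s < 1 \<Longrightarrow> E s s = D s"
    and below: "\<And>s r. 0 < s \<Longrightarrow> s < 1 \<Longrightarrow> 0 \<le> r \<Longrightarrow> r < 1 \<Longrightarrow> E s r \<le> D r"
    and E: "\<And>s. 0 < s \<Longrightarrow> s < 1 \<Longrightarrow> (E s has_real_derivative m s * \<phi>' s) (at s)"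
    and \<phi>: "\<And>s. 0 < s \<Longrightarrow> s < 1 \<Longrightarrow> (\<phi> has_real_derivative \<phi>' s) (at s)"
    and pos: "\<And>s. 0 < s \<Longrightarrow> s < 1 \<Longrightarrow> 0 < \<phi>' s"
    and mono: "\<And>s t. 0 < s \<Longrightarrow> s \<le> t \<Longrightarrow> t < 1 \<Longrightarrow> m s \<le> m t"
  shows "0 < b \<Longrightarrow> b < 1 \<Longrightarrow> D b - D 0 \<le> m b * (\<phi> b - \<phi> 0)"
    and "0 < b \<Longrightarrow> b \<le> c \<Longrightarrow> c < 1 \<Longrightarrow> m b * (\<phi> c - \<phi> b) \<le> D c - D b"
proof -
  assume b: "0 < b" "b < 1"
  have "D b - D 0 \<le> (m b + \<epsilon>) * (\<phi> b - \<phi> 0)" if \<epsilon>: "0 < \<epsilon>" for \<epsilon>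
  proof -
    define N where "N u = D u - (m b + \<epsilon>) * \<phi> u" for u
    have "continuous_on {0..b} N"
      unfolding N_def using b by (intro continuous_intros D \<phi>0) auto
    then obtain u where u: "u \<in> {0..b}" "\<And>v. v \<in> {0..b} \<Longrightarrow> N v \<le> N u"
      using continuous_attains_sup[of "{0..b}" N] b by auto
    \<comment> \<open>At a maximiser \<open>u > 0\<close> the minorant minus
      \<open>(m b + \<epsilon>) * \<phi>\<close> strictly decreases at u, so some point to the left
      beats the maximum. Only left neighbours are used, which also rules out \<open>u = b\<close>;
      \<open>\<epsilon>\<close> makes the sign strict.\<close>
    have "u = 0"
    proof (rule ccontr)
      assume "u \<noteq> 0"
      with u b have u01: "0 < u" "u < 1" "u \<le> b" by auto
      have "m u * \<phi>' u - (m b + \<epsilon>) * \<phi>' u = (m u - m b - \<epsilon>) * \<phi>' u" by (simp add: algebra_simps)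
      also have "\<dots> < 0" using mono[OF u01(1,3) b(2)] \<epsilon> pos[OF u01(1,2)] by (intro mult_neg_pos) auto
      finally have neg: "m u * \<phi>' u - (m b + \<epsilon>) * \<phi>' u < 0" .
      have "((\<lambda>r. E u r - (m b + \<epsilon>) * \<phi> r) has_real_derivative (m u * \<phi>' u - (m b + \<epsilon>) * \<phi>' u)) (at u)"
        by (intro DERIV_diff E DERIV_cmult \<phi> u01)
      from DERIV_neg_dec_left[OF this neg] obtain d where d: "0 < d"
        "\<And>h. 0 < h \<Longrightarrow> h < d \<Longrightarrow> E u u - (m b + \<epsilon>) * \<phi> u < E u (u - h) - (m b + \<epsilon>) * \<phi> (u - h)" by blast
      define h where "h = min (d / 2) u"
      have h: "0 < h" "h < d" "h \<le> u" using d u01 by (auto simp: h_def)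
      have "N u < E u (u - h) - (m b + \<epsilon>) * \<phi> (u - h)" using d(2)[OF h(1,2)] touch u01 by (simp add: N_def)
      also have "\<dots> \<le> N (u - h)" using below[of u "u - h"] u01 h by (simp add: N_def)
      also have "\<dots> \<le> N u" using u01 h by (intro u(2)) auto
      finally show False by simp
    qed
    then have "N b \<le> N 0" using u(2)[of b] b by simp
    then show ?thesis by (simp add: N_def algebra_simps)
  qed
  then have "\<forall>\<^sub>F \<epsilon> in at_right 0. D b - D 0 \<le> (m b + \<epsilon>) * (\<phi> b - \<phi> 0)"
    by (simp add: eventually_at_right_less eventually_mono[OF eventually_at_right_less])
  moreover have "((\<lambda>\<epsilon>. (m b + \<epsilon>) * (\<phi> b - \<phi> 0)) \<longlongrightarrow> (m b + 0) * (\<phi> b - \<phi> 0)) (at_right 0)"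
    by (intro tendsto_intros)
  ultimately show "D b - D 0 \<le> m b * (\<phi> b - \<phi> 0)"
    using tendsto_lowerbound[of "\<lambda>\<epsilon>. (m b + \<epsilon>) * (\<phi> b - \<phi> 0)" _ "at_right 0" "D b - D 0"] by simp
next
  assume b: "0 < b" "b \<le> c" "c < 1"
  have "(m b - \<epsilon>) * (\<phi> c - \<phi> b) \<le> D c - D b" if \<epsilon>: "0 < \<epsilon>" for \<epsilon>
  proof -
    define N where "N u = D u - (m b - \<epsilon>) * \<phi> u" for u
    have "continuous_on {b..c} N"
      unfolding N_def using b
      by (intro continuous_intros continuous_on_subset[OF D[of c]] continuous_on_subset[OF \<phi>0[of c]]) auto
    then obtain u where u: "u \<in> {b..c}" "\<And>v. v \<in> {b..c} \<Longrightarrow> N v \<le> N u"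
      using continuous_attains_sup[of "{b..c}" N] b by auto
    \<comment> \<open>The mirror image: a strict increase at u produces a better point to the right,
      so \<open>u = b\<close> is ruled out as well.\<close>
    have "u = c"
    proof (rule ccontr)
      assume "u \<noteq> c"
      with u b have u01: "0 < u" "u < 1" "b \<le> u" "u < c" by auto
      have "0 < (m u - m b + \<epsilon>) * \<phi>' u" using mono[OF b(1) u01(3,2)] \<epsilon> pos[OF u01(1,2)] by (intro mult_pos_pos) auto
      also have "\<dots> = m u * \<phi>' u - (m b - \<epsilon>) * \<phi>' u" by (simp add: algebra_simps)
      finally have p: "0 < m u * \<phi>' u - (m b - \<epsilon>) * \<phi>' u" .
      have "((\<lambda>r. E u r - (m b - \<epsilon>) * \<phi> r) has_real_derivative (m u * \<phi>' u - (m b - \<epsilon>) * \<phi>' u)) (at u)"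
        by (intro DERIV_diff E DERIV_cmult \<phi> u01)
      from DERIV_pos_inc_right[OF this p] obtain d where d: "0 < d"
        "\<And>h. 0 < h \<Longrightarrow> h < d \<Longrightarrow> E u u - (m b - \<epsilon>) * \<phi> u < E u (u + h) - (m b - \<epsilon>) * \<phi> (u + h)" by blast
      define h where "h = min (d / 2) (c - u)"
      have h: "0 < h" "h < d" "u + h \<le> c" using d u01 by (auto simp: h_def)
      have "N u < E u (u + h) - (m b - \<epsilon>) * \<phi> (u + h)" using d(2)[OF h(1,2)] touch u01 by (simp add: N_def)
      also have "\<dots> \<le> N (u + h)" using below[of u "u + h"] u01 h b by (simp add: N_def)
      also have "\<dots> \<le> N u" using u01 h by (intro u(2)) auto
      finally show False by simp
    qed
    then have "N b \<le> N c" using u(2)[of b] b by simp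
    then show ?thesis by (simp add: N_def algebra_simps)
  qed
  then have "\<forall>\<^sub>F \<epsilon> in at_right 0. (m b - \<epsilon>) * (\<phi> c - \<phi> b) \<le> D c - D b"
    by (simp add: eventually_at_right_less eventually_mono[OF eventually_at_right_less])
  moreover have "((\<lambda>\<epsilon>. (m b - \<epsilon>) * (\<phi> c - \<phi> b)) \<longlongrightarrow> (m b - 0) * (\<phi> c - \<phi> b)) (at_right 0)"
    by (intro tendsto_intros)
  ultimately show "m b * (\<phi> c - \<phi> b) \<le> D c - D b"
    using tendsto_upperbound[of "\<lambda>\<epsilon>. (m b - \<epsilon>) * (\<phi> c - \<phi> b)" _ "at_right 0" "D c - D b"] by simp
qed

lemma abs_sqrt_diff_le:
  assumes "0 \<le> r" "0 < s"
  shows "\<bar>sqrt r - sqrt s\<bar> \<le> \<bar>r - s\<bar> / sqrt s"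
proof -
  have "(sqrt r - sqrt s) * (sqrt r + sqrt s) = r - s" using assms by (simp add: algebra_simps)
  then have "\<bar>sqrt r - sqrt s\<bar> * (sqrt r + sqrt s) = \<bar>r - s\<bar>"
    using assms abs_mult[of "sqrt r - sqrt s" "sqrt r + sqrt s"] by simp
  moreover have "\<bar>sqrt r - sqrt s\<bar> * sqrt s \<le> \<bar>sqrt r - sqrt s\<bar> * (sqrt r + sqrt s)"
    using assms by (intro mult_left_mono) auto
  ultimately show ?thesis using assms by (simp add: pos_le_divide_eq)
qed

section \<open>Continuity and weak differentiability of the entropy\<close>

context centered_prob
begin

lemma ln_dens_diff:
  assumes s: "0 \<le> s" "s < 1"
  shows "\<bar>ln (dens s y) - ln (dens s x)\<bar> \<le> (score_const + 2 * (norm x + norm y)) / (1 - s) * norm (y - x)"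
proof -
  let ?B = "(score_const + 2 * (norm x + norm y)) / (1 - s)"
  have "norm (ln (dens s y) - ln (dens s x)) \<le> ?B * norm (y - x)"
  proof (rule differentiable_bound[where S="closed_segment x y" and f'="\<lambda>z h. score s z \<bullet> h"])
    fix z assume z: "z \<in> closed_segment x y"
    show "((\<lambda>y. ln (dens s y)) has_derivative (\<lambda>h. score s z \<bullet> h)) (at z within closed_segment x y)"
      by (rule has_derivative_at_withinI[OF ln_dens_has_derivative[OF s]])
    from z obtain u where u: "0 \<le> u" "u \<le> 1" "z = (1 - u) *\<^sub>R x + u *\<^sub>R y"
      by (auto simp: closed_segment_def)
    have "norm z \<le> (1 - u) * norm x + u * norm y"
      unfolding u(3) using norm_triangle_ineq[of "(1 - u) *\<^sub>R x" "u *\<^sub>R y"] u by simp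
    also have "\<dots> \<le> 1 * norm x + 1 * norm y" using u by (intro add_mono mult_right_mono) auto
    finally have nz: "norm z \<le> norm x + norm y" by simp
    show "onorm (\<lambda>h. score s z \<bullet> h) \<le> ?B"
    proof (rule onorm_bound)
      show "0 \<le> ?B" using s score_const_nonneg by simp
      fix h
      have "norm (score s z) \<le> ?B"
        using norm_score_le[OF s, of z] nz s by (elim order_trans) (auto intro!: divide_right_mono)
      then show "norm (score s z \<bullet> h) \<le> ?B * norm h"
        using order_trans[OF Cauchy_Schwarz_ineq2[of "score s z" h] mult_right_mono[OF _ norm_ge_zero]]
        unfolding real_norm_def by blast
    qed
  qed auto
  then show ?thesis by simp
qed

text \<open>Linear growth of the score means quadratic growth of the log density, which finite
  second moments integrate.\<close>

lemma integrable_ln_dens: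
  assumes s: "0 \<le> s" "s < 1" and r: "0 \<le> r" "r \<le> 1"
  shows "integrable P (\<lambda>p. ln (dens s (chan r p)))"
proof (rule integrable_P_quadratic)
  fix p :: "'a \<times> 'a"
  let ?t = "norm (fst p) + norm (snd p)"
  define c where "c = 1 / (1 - s)"
  have c: "0 < c" using s by (simp add: c_def)
  have "\<bar>ln (dens s (chan r p)) - ln (dens s 0)\<bar> \<le> (score_const + 2 * norm (chan r p)) / (1 - s) * norm (chan r p)"
    using ln_dens_diff[OF s, of "chan r p" 0] by simp
  also have "\<dots> \<le> (score_const + 2 * ?t) / (1 - s) * ?t"
    using norm_chan_le[OF r, of p] s score_const_nonneg by (intro mult_mono divide_right_mono) auto
  also have "\<dots> = c * (score_const * ?t + 2 * ?t\<^sup>2)" by (simp add: c_def power2_eq_square add_divide_distrib algebra_simps)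
  also have "score_const * ?t \<le> (score_const\<^sup>2 + ?t\<^sup>2) / 2" by (rule mult_le_half_squares)
  finally have "\<bar>ln (dens s (chan r p)) - ln (dens s 0)\<bar> \<le> c * ((score_const\<^sup>2 + ?t\<^sup>2) / 2 + 2 * ?t\<^sup>2)"
    using c by (simp add: mult_left_mono)
  also have "\<dots> \<le> c * (score_const\<^sup>2 + 5 * ((norm (fst p))\<^sup>2 + (norm (snd p))\<^sup>2))"
  proof (rule mult_left_mono)
    show "(score_const\<^sup>2 + ?t\<^sup>2) / 2 + 2 * ?t\<^sup>2 \<le> score_const\<^sup>2 + 5 * ((norm (fst p))\<^sup>2 + (norm (snd p))\<^sup>2)"
    proof -
      have "(A + T) / 2 + 2 * T \<le> A + 5 * S" if "T \<le> 2 * S" "0 \<le> A" for A T S :: real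
        using that by (simp add: field_simps)
      then show ?thesis using sum_sq_le zero_le_power2 by blast
    qed
  qed (use c in simp)
  finally have "\<bar>ln (dens s (chan r p))\<bar> \<le> \<bar>ln (dens s 0)\<bar> + c * (score_const\<^sup>2 + 5 * ((norm (fst p))\<^sup>2 + (norm (snd p))\<^sup>2))"
    by linarith
  then show "norm (ln (dens s (chan r p))) \<le> (\<bar>ln (dens s 0)\<bar> + c * score_const\<^sup>2) + (c * 5) * ((norm (fst p))\<^sup>2 + (norm (snd p))\<^sup>2)"
    by (simp add: algebra_simps)
qed measurable

text \<open>The diagonal \<open>cross s s\<close> is the entropy \<open>D(s)\<close>; off the
  diagonal these are the touching functions for \<open>touching_below\<close>.\<close>

definition cross :: "real \<Rightarrow> real \<Rightarrow> real" where
  "cross s r = (\<integral>p. ln (dens s (chan r p)) \<partial>P)"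

lemma integral_dens_ratio:
  assumes s: "s < 1" "r < 1"
  shows "integrable P (\<lambda>p. dens s (chan r p) / dens r (chan r p))"
    and "(\<integral>p. dens s (chan r p) / dens r (chan r p) \<partial>P) = 1"
proof -
  have eq: "dens r y *\<^sub>R (dens s y / dens r y) = dens s y *\<^sub>R 1" for y
    using dens_pos[OF s(2), of y] by simp
  show "integrable P (\<lambda>p. dens s (chan r p) / dens r (chan r p))"
    using integral_chan(2)[OF s(2), of "\<lambda>y. dens s y / dens r y"] integral_chan(2)[OF s(1), of "\<lambda>y. 1::real"]
    unfolding eq by simp
  show "(\<integral>p. dens s (chan r p) / dens r (chan r p) \<partial>P) = 1"
    using integral_chan(1)[OF s(2), of "\<lambda>y. dens s y / dens r y"] integral_chan(1)[OF s(1), of "\<lambda>y. 1::real"]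
    unfolding eq by simp
qed

lemma gibbs:
  assumes s: "0 \<le> s" "s < 1" and r: "0 \<le> r" "r < 1"
  shows "cross s r \<le> cross r r"
proof -
  have "cross s r - cross r r = (\<integral>p. ln (dens s (chan r p)) - ln (dens r (chan r p)) \<partial>P)"
    unfolding cross_def using s r by (simp add: integrable_ln_dens)
  also have "\<dots> \<le> (\<integral>p. dens s (chan r p) / dens r (chan r p) - 1 \<partial>P)"
  proof (rule integral_mono)
    show "integrable P (\<lambda>p. ln (dens s (chan r p)) - ln (dens r (chan r p)))"
      using s r by (simp add: integrable_ln_dens)
    show "integrable P (\<lambda>p. dens s (chan r p) / dens r (chan r p) - 1)"
      using integral_dens_ratio(1)[OF s(2) r(2)] by simp
    show "ln (dens s (chan r p)) - ln (dens r (chan r p)) \<le> dens s (chan r p) / dens r (chan r p) - 1" for p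
      using ln_le_minus_one[of "dens s (chan r p) / dens r (chan r p)"]
        dens_pos[OF s(2), of "chan r p"] dens_pos[OF r(2), of "chan r p"]
      by (simp add: ln_div)
  qed
  also have "\<dots> = 0" using integral_dens_ratio[OF s(2) r(2)] by simp
  finally show ?thesis by simp
qed

lemma cross_0: "cross 0 0 = 0"
  by (simp add: cross_def dens_def mehler_def)

lemma ln_dens_chan_diff:
  assumes q: "0 \<le> q" "q < 1" and r: "0 \<le> r" "r \<le> 1" and s: "0 \<le> s" "s \<le> 1"
  shows "\<bar>ln (dens q (chan r p)) - ln (dens q (chan s p))\<bar>
    \<le> (\<bar>sqrt r - sqrt s\<bar> + \<bar>sqrt (1 - r) - sqrt (1 - s)\<bar>) / (1 - q)
      * ((score_const + 4 * (norm (fst p) + norm (snd p))) * (norm (fst p) + norm (snd p)))"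
proof -
  let ?t = "norm (fst p) + norm (snd p)" and ?w = "\<bar>sqrt r - sqrt s\<bar> + \<bar>sqrt (1 - r) - sqrt (1 - s)\<bar>"
  have "\<bar>ln (dens q (chan r p)) - ln (dens q (chan s p))\<bar>
      \<le> (score_const + 2 * (norm (chan s p) + norm (chan r p))) / (1 - q) * norm (chan r p - chan s p)"
    by (rule ln_dens_diff[OF q])
  also have "\<dots> \<le> (score_const + 4 * ?t) / (1 - q) * (?w * ?t)"
    using norm_chan_diff[of r p s] norm_chan_le[OF r, of p] norm_chan_le[OF s, of p] q score_const_nonneg
    by (intro mult_mono divide_right_mono) auto
  finally show ?thesis by (simp add: mult.commute mult.left_commute)
qed

lemma integrable_growth: "integrable P (\<lambda>p. (score_const + 4 * (norm (fst p) + norm (snd p))) * (norm (fst p) + norm (snd p)))"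
proof -
  have "integrable P (\<lambda>p. (score_const + 4 * (norm (fst p) + norm (snd p))) \<bullet> (norm (fst p) + norm (snd p)))"
  proof (rule integrable_mult_linear_growth)
    fix p :: "'a \<times> 'a"
    show "norm (score_const + 4 * (norm (fst p) + norm (snd p))) \<le> (score_const + 4) * (1 + norm (fst p) + norm (snd p))"
      using score_const_nonneg by (simp add: algebra_simps)
    show "norm (norm (fst p) + norm (snd p)) \<le> 1 * (1 + norm (fst p) + norm (snd p))" by simp
  qed simp_all
  then show ?thesis by simp
qed

text \<open>Replacing \<open>cross s s\<close> by the smaller \<open>cross r s\<close> leaves a
  single log density evaluated at two nearby outputs, where a Lipschitz bound applies. Exchanging r
  and s gives the opposite sign.\<close>

lemma continuous_on_entropy:
  assumes b: "0 \<le> b" "b < 1"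
  shows "continuous_on {0..b} (\<lambda>s. cross s s)"
proof -
  define M where "M = (\<integral>p. (score_const + 4 * (norm (fst p) + norm (snd p))) * (norm (fst p) + norm (snd p)) \<partial>P)"
  have M: "0 \<le> M" unfolding M_def using score_const_nonneg by (intro Bochner_Integration.integral_nonneg) simp
  let ?w = "\<lambda>r s. \<bar>sqrt r - sqrt s\<bar> + \<bar>sqrt (1 - r) - sqrt (1 - s)\<bar>"
  have step: "cross r r - cross s s \<le> ?w r s / (1 - b) * M" if "r \<in> {0..b}" "s \<in> {0..b}" for r s
  proof -
    have r: "0 \<le> r" "r < 1" "r \<le> b" and s: "0 \<le> s" "s < 1" using that b by auto
    have "cross r r - cross s s \<le> cross r r - cross r s" using gibbs[OF r(1,2) s] by simp
    also have "\<dots> = (\<integral>p. ln (dens r (chan r p)) - ln (dens r (chan s p)) \<partial>P)"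
      unfolding cross_def using r s by (simp add: integrable_ln_dens)
    also have "\<dots> \<le> (\<integral>p. ?w r s / (1 - r) * ((score_const + 4 * (norm (fst p) + norm (snd p))) * (norm (fst p) + norm (snd p))) \<partial>P)"
    proof (rule integral_mono)
      show "integrable P (\<lambda>p. ln (dens r (chan r p)) - ln (dens r (chan s p)))"
        using r s by (simp add: integrable_ln_dens)
      show "integrable P (\<lambda>p. ?w r s / (1 - r) * ((score_const + 4 * (norm (fst p) + norm (snd p))) * (norm (fst p) + norm (snd p))))"
        by (intro integrable_mult_right integrable_growth)
      show "ln (dens r (chan r p)) - ln (dens r (chan s p)) \<le> ?w r s / (1 - r) * ((score_const + 4 * (norm (fst p) + norm (snd p))) * (norm (fst p) + norm (snd p)))" for p
        using ln_dens_chan_diff[of r r s p] r s by linarith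
    qed
    also have "\<dots> = ?w r s / (1 - r) * M" by (simp add: M_def)
    also have "\<dots> \<le> ?w r s / (1 - b) * M"
      using r b M by (intro mult_right_mono divide_left_mono) auto
    finally show ?thesis .
  qed
  have lim: "((\<lambda>r. cross r r) \<longlongrightarrow> cross s s) (at s within {0..b})" if s: "s \<in> {0..b}" for s
  proof -
    have "((\<lambda>r. ?w r s / (1 - b) * M) \<longlongrightarrow> ?w s s / (1 - b) * M) (at s within {0..b})"
      using b by (intro tendsto_intros) auto
    then have z: "((\<lambda>r. ?w r s / (1 - b) * M) \<longlongrightarrow> 0) (at s within {0..b})" by simp
    have "\<forall>\<^sub>F r in at s within {0..b}. norm (cross r r - cross s s) \<le> ?w r s / (1 - b) * M"
    proof (unfold eventually_at_filter, rule always_eventually, intro allI impI)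
      fix r assume "r \<in> {0..b}"
      moreover have "?w s r = ?w r s" by simp
      ultimately show "norm (cross r r - cross s s) \<le> ?w r s / (1 - b) * M"
        using step[of r s] step[of s r] s by (simp add: abs_le_iff)
    qed
    from Lim_null_comparison[OF this z] show ?thesis by (simp add: LIM_zero_iff)
  qed
  then show ?thesis by (simp add: continuous_on_def)
qed

text \<open>The density stays fixed and only its argument moves, so dominated convergence needs just
  the Lipschitz bound for \<open>ln (dens s)\<close>. The chain rule pairs the score with the
  velocity of the channel, and \<open>score_tower\<close> turns the pairing into
  \<open>fisher s\<close>.\<close>

lemma cross_has_derivative:
  assumes s: "0 < s" "s < 1"
  shows "(cross s has_real_derivative fisher s / (2 * s)) (at s)"
proof -
  \<comment> \<open>An open neighbourhood of s inside the unit interval, so that the channel bounds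
    hold along every approximating sequence.\<close>
  define S where "S = {s / 2 <..< 1}"
  have S: "open S" "s \<in> S" using s by (auto simp: S_def)
  define c where "c = (1 / sqrt s + 1 / sqrt (1 - s)) / (1 - s)"
  let ?g = "\<lambda>p. (score_const + 4 * (norm (fst p) + norm (snd p))) * (norm (fst p) + norm (snd p :: 'a))"
  \<comment> \<open>The vector on the right is the derivative of the channel in s, rewritten through
    the observation score.\<close>
  have obs: "(1 / (2 * s)) * (score s (chan s p) \<bullet> obs_score s (fst p) (chan s p))
      = score s (chan s p) \<bullet> ((1 / (2 * sqrt s)) *\<^sub>R fst p - (1 / (2 * sqrt (1 - s))) *\<^sub>R snd p)" for p :: "'a \<times> 'a"
  proof -
    have "(1 / (2 * s)) * sqrt s = 1 / (2 * sqrt s)"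
      using s by (simp add: field_simps)
    then show ?thesis
      using s by (simp add: obs_score_chan inner_diff_right right_diff_distrib mult.assoc[symmetric])
  qed
  have lim: "(\<lambda>i. (cross s (X i) - cross s s) / (X i - s)) \<longlonglongrightarrow> (\<integral>p. (1 / (2 * s)) * (score s (chan s p) \<bullet> obs_score s (fst p) (chan s p)) \<partial>P)"
    if X: "\<forall>i. X i \<in> S - {s}" "X \<longlonglongrightarrow> s" for X
  proof -
    have Xi: "0 \<le> X i" "X i < 1" "X i \<noteq> s" for i using X(1) s by (auto simp: S_def dest!: spec[of _ i])
    have "(cross s (X i) - cross s s) / (X i - s)
        = (\<integral>p. (ln (dens s (chan (X i) p)) - ln (dens s (chan s p))) / (X i - s) \<partial>P)" for i
      unfolding cross_def using s Xi[of i] by (simp add: integrable_ln_dens)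
    moreover have "(\<lambda>i. \<integral>p. (ln (dens s (chan (X i) p)) - ln (dens s (chan s p))) / (X i - s) \<partial>P)
        \<longlonglongrightarrow> (\<integral>p. (1 / (2 * s)) * (score s (chan s p) \<bullet> obs_score s (fst p) (chan s p)) \<partial>P)"
    proof (rule integral_dominated_convergence)
      show "integrable P (\<lambda>p. c * ?g p)" by (intro integrable_mult_right integrable_growth)
      show "AE p in P. norm ((ln (dens s (chan (X i) p)) - ln (dens s (chan s p))) / (X i - s)) \<le> c * ?g p" for i
      proof (rule AE_I2)
        fix p :: "'a \<times> 'a"
        have "\<bar>sqrt (X i) - sqrt s\<bar> + \<bar>sqrt (1 - X i) - sqrt (1 - s)\<bar>
            \<le> \<bar>X i - s\<bar> / sqrt s + \<bar>(1 - X i) - (1 - s)\<bar> / sqrt (1 - s)"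
          using Xi[of i] s by (intro add_mono abs_sqrt_diff_le) auto
        also have "\<dots> = (1 / sqrt s + 1 / sqrt (1 - s)) * \<bar>X i - s\<bar>"
          by (simp add: distrib_right abs_minus_commute)
        finally have w: "(\<bar>sqrt (X i) - sqrt s\<bar> + \<bar>sqrt (1 - X i) - sqrt (1 - s)\<bar>) / (1 - s) \<le> c * \<bar>X i - s\<bar>"
          using s by (simp add: c_def divide_right_mono)
        have "\<bar>ln (dens s (chan (X i) p)) - ln (dens s (chan s p))\<bar>
            \<le> (\<bar>sqrt (X i) - sqrt s\<bar> + \<bar>sqrt (1 - X i) - sqrt (1 - s)\<bar>) / (1 - s) * ?g p"
          using Xi[of i] s by (intro ln_dens_chan_diff) auto
        also have "\<dots> \<le> (c * \<bar>X i - s\<bar>) * ?g p"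
          using w score_const_nonneg by (intro mult_right_mono) auto
        finally show "norm ((ln (dens s (chan (X i) p)) - ln (dens s (chan s p))) / (X i - s)) \<le> c * ?g p"
          using Xi(3)[of i] by (simp add: pos_divide_le_eq mult_ac)
      qed
      show "AE p in P. (\<lambda>i. (ln (dens s (chan (X i) p)) - ln (dens s (chan s p))) / (X i - s))
          \<longlonglongrightarrow> (1 / (2 * s)) * (score s (chan s p) \<bullet> obs_score s (fst p) (chan s p))"
      proof (rule AE_I2)
        fix p :: "'a \<times> 'a"
        define V where "V = (1 / (2 * sqrt s)) *\<^sub>R fst p - (1 / (2 * sqrt (1 - s))) *\<^sub>R snd p"
        have "((\<lambda>r. chan r p) has_derivative (\<lambda>h. h *\<^sub>R V)) (at s)"
          unfolding chan_def V_def using s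
          by (auto intro!: derivative_eq_intros simp: fun_eq_iff scaleR_diff_right field_simps)
        then have "((\<lambda>r. ln (dens s (chan r p))) has_derivative (\<lambda>h. score s (chan s p) \<bullet> (h *\<^sub>R V))) (at s)"
          by (rule has_derivative_compose[where g="\<lambda>y. ln (dens s y)"]) (use ln_dens_has_derivative s in auto)
        then have "((\<lambda>r. ln (dens s (chan r p))) has_real_derivative (score s (chan s p) \<bullet> V)) (at s)"
          by (simp add: has_field_derivative_def mult_commute_abs)
        then have "((\<lambda>r. (ln (dens s (chan r p)) - ln (dens s (chan s p))) / (r - s)) \<longlongrightarrow> score s (chan s p) \<bullet> V) (at s)"
          by (simp add: has_field_derivative_iff)
        moreover have "filterlim X (at s) sequentially"
          using X(2) Xi(3) by (simp add: filterlim_at)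
        ultimately show "(\<lambda>i. (ln (dens s (chan (X i) p)) - ln (dens s (chan s p))) / (X i - s))
          \<longlonglongrightarrow> (1 / (2 * s)) * (score s (chan s p) \<bullet> obs_score s (fst p) (chan s p))"
          unfolding obs V_def by (rule filterlim_compose)
      qed
    qed (simp_all add: obs_score_def)
    ultimately show ?thesis by (simp only:)
  qed
  have "(\<integral>p. (1 / (2 * s)) * (score s (chan s p) \<bullet> obs_score s (fst p) (chan s p)) \<partial>P)
      = (1 / (2 * s)) * (\<integral>p. score s (chan s p) \<bullet> obs_score s (fst p) (chan s p) \<partial>P)"
    by simp
  also have "(\<integral>p. score s (chan s p) \<bullet> obs_score s (fst p) (chan s p) \<partial>P) = (\<integral>p. score s (chan s p) \<bullet> score s (chan s p) \<partial>P)"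
  proof (rule score_tower)
    show "integrable P (\<lambda>p. score s (chan s p) \<bullet> obs_score s (fst p) (chan s p))"
    proof (rule integrable_mult_linear_growth)
      show "norm (score s (chan s p)) \<le> ((score_const + 2) / (1 - s)) * (1 + norm (fst p) + norm (snd p))" for p
        using s by (intro score_growth) auto
      show "norm (obs_score s (fst p) (chan s p)) \<le> (2 / (1 - s)) * (1 + norm (fst p) + norm (snd p))" for p :: "'a \<times> 'a"
        using s by (intro obs_score_growth) auto
    qed (simp_all add: obs_score_def)
  qed (use s in auto)
  finally have val: "(\<integral>p. (1 / (2 * s)) * (score s (chan s p) \<bullet> obs_score s (fst p) (chan s p)) \<partial>P) = fisher s / (2 * s)"
    by (simp add: fisher_def power2_norm_eq_inner)
  have "((\<lambda>r. (cross s r - cross s s) / (r - s)) \<longlongrightarrow> fisher s / (2 * s)) (at s within S)"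
    unfolding tendsto_at_iff_sequentially comp_def using lim unfolding val by blast
  then show ?thesis
    unfolding has_field_derivative_iff by (simp only: at_within_open[OF S(2,1)])
qed

end

text \<open>\<open>rel_entropy\<close> uses \<open>RN_deriv\<close>, fixed only up to null sets, and
  a difference of two nonnegative integrals. Integrability of the logarithm makes both
  finite.\<close>

lemma rel_entropy_density:
  fixes g :: "'a::euclidean_space \<Rightarrow> real"
  assumes [measurable]: "g \<in> borel_measurable borel" and g: "\<And>x. 0 \<le> g x"
    and \<nu>: "\<nu> = density std_gauss g" and int: "integrable \<nu> (\<lambda>x. ln (g x))"
  shows "rel_entropy \<nu> std_gauss = ereal (\<integral>x. ln (g x) \<partial>\<nu>)"
proof -
  have ac: "absolutely_continuous std_gauss \<nu>" unfolding \<nu> by (rule absolutely_continuousI_density) simp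
  have "AE x in std_gauss. g x = RN_deriv std_gauss \<nu> x"
    by (rule std_gauss.RN_deriv_unique) (auto simp: \<nu>)
  then have "AE x in \<nu>. RN_deriv std_gauss \<nu> x = ennreal (g x)"
    unfolding \<nu> by (subst AE_density) auto
  then have ae: "AE x in \<nu>. ln (enn2real (RN_deriv std_gauss \<nu> x)) = ln (g x)"
    by eventually_elim (simp add: g)
  have e: "ennreal (max 0 u) = ennreal u" for u :: real by (simp add: max_def ennreal_neg)
  have [simp]: "sets \<nu> = sets borel" by (simp add: \<nu>)
  have p: "(\<integral>\<^sup>+x. ennreal (max 0 (ln (enn2real (RN_deriv std_gauss \<nu> x)))) \<partial>\<nu>) = (\<integral>\<^sup>+x. ennreal (ln (g x)) \<partial>\<nu>)"
    and n: "(\<integral>\<^sup>+x. ennreal (max 0 (- ln (enn2real (RN_deriv std_gauss \<nu> x)))) \<partial>\<nu>) = (\<integral>\<^sup>+x. ennreal (- ln (g x)) \<partial>\<nu>)"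
    unfolding e by (rule nn_integral_cong_AE, use ae in eventually_elim, simp)+
  have fin: "(\<integral>\<^sup>+x. ennreal (ln (g x)) \<partial>\<nu>) \<noteq> \<infinity>" "(\<integral>\<^sup>+x. ennreal (- ln (g x)) \<partial>\<nu>) \<noteq> \<infinity>"
    using int by (auto simp: real_integrable_def)
  have "rel_entropy \<nu> std_gauss
      = enn2ereal (\<integral>\<^sup>+x. ennreal (ln (g x)) \<partial>\<nu>) - enn2ereal (\<integral>\<^sup>+x. ennreal (- ln (g x)) \<partial>\<nu>)"
    using ac unfolding rel_entropy_def Let_def p n by simp
  also have "\<dots> = ereal (enn2real (\<integral>\<^sup>+x. ennreal (ln (g x)) \<partial>\<nu>) - enn2real (\<integral>\<^sup>+x. ennreal (- ln (g x)) \<partial>\<nu>))"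
    using fin by (cases "\<integral>\<^sup>+x. ennreal (ln (g x)) \<partial>\<nu>"; cases "\<integral>\<^sup>+x. ennreal (- ln (g x)) \<partial>\<nu>") auto
  also have "\<dots> = ereal (\<integral>x. ln (g x) \<partial>\<nu>)"
    using real_lebesgue_integral_def[OF int] by simp
  finally show ?thesis .
qed

section \<open>Consequences of finite entropy, and the Poincare constant\<close>

context borel_prob
begin

lemma integrable_fst_P:
  fixes h :: "'a \<Rightarrow> real"
  assumes h: "integrable \<mu> h"
  shows "integrable P (\<lambda>p. h (fst p))"
proof (rule integrableI_bounded)
  have [measurable]: "h \<in> borel_measurable \<mu>" using h by simp
  show "(\<lambda>p. h (fst p)) \<in> borel_measurable P" by measurable
  have "(\<integral>\<^sup>+p. ennreal (norm (h (fst p))) \<partial>P) = (\<integral>\<^sup>+x. ennreal (norm (h x)) \<partial>\<mu>)"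
    by (subst std_gauss.nn_integral_fst[symmetric]) (auto simp: std_gauss.emeasure_space_1[simplified])
  also have "\<dots> < \<infinity>" using h by (simp add: integrable_iff_bounded)
  finally show "(\<integral>\<^sup>+p. ennreal (norm (h (fst p))) \<partial>P) < \<infinity>" .
qed

lemma integral_fst_P:
  fixes h :: "'a \<Rightarrow> real"
  assumes h: "integrable \<mu> h"
  shows "(\<integral>p. h (fst p) \<partial>P) = (\<integral>x. h x \<partial>\<mu>)"
  using P.integral_fst'[OF integrable_fst_P[OF h]] by simp

text \<open>Since \<open>- t ln t \<le> 1\<close>, the negative part of the logarithm always has a
  finite integral, so finite entropy means an integrable logarithm.\<close>

lemma finite_rel_entropyD:
  assumes fin: "rel_entropy \<mu> std_gauss \<noteq> \<infinity>"
  obtains f where "f \<in> borel_measurable borel" "\<And>x. 0 \<le> f x" "\<mu> = density std_gauss (\<lambda>x. ennreal (f x))"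
    "integrable \<mu> (\<lambda>x. ln (f x))"
proof -
  define f where "f x = enn2real (RN_deriv std_gauss \<mu> x)" for x
  have [measurable]: "f \<in> borel_measurable borel" unfolding f_def[abs_def] by measurable
  have f0: "0 \<le> f x" for x by (simp add: f_def)
  have ac: "absolutely_continuous std_gauss \<mu>" using fin unfolding rel_entropy_def by meson
  have "AE x in std_gauss. RN_deriv std_gauss \<mu> x \<noteq> \<infinity>"
    by (rule std_gauss.RN_deriv_finite) (auto simp: ac sigma_finite_measure_axioms)
  then have ae: "AE x in std_gauss. RN_deriv std_gauss \<mu> x = ennreal (f x)"
    by eventually_elim (simp add: f_def less_top)
  have "\<mu> = density std_gauss (RN_deriv std_gauss \<mu>)"
    by (rule std_gauss.density_RN_deriv[symmetric]) (auto simp: ac)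
  also have "\<dots> = density std_gauss (\<lambda>x. ennreal (f x))"
    by (rule density_cong) (use ae in auto)
  finally have \<mu>f: "\<mu> = density std_gauss (\<lambda>x. ennreal (f x))" .
  have e: "ennreal (max 0 u) = ennreal u" for u :: real by (simp add: max_def ennreal_neg)
  have "rel_entropy \<mu> std_gauss = enn2ereal (\<integral>\<^sup>+x. ennreal (ln (f x)) \<partial>\<mu>) - enn2ereal (\<integral>\<^sup>+x. ennreal (- ln (f x)) \<partial>\<mu>)"
    using ac by (simp add: rel_entropy_def e f_def)
  \<comment> \<open>In \<open>ereal\<close> the difference \<open>\<infinity> - x\<close> is
    \<open>\<infinity>\<close> for every x, even for \<open>\<infinity>\<close> itself, so an
    infinite positive part would make the entropy infinite.\<close>
  with fin have pos: "(\<integral>\<^sup>+x. ennreal (ln (f x)) \<partial>\<mu>) \<noteq> \<infinity>" by auto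
  have "(\<integral>\<^sup>+x. ennreal (- ln (f x)) \<partial>\<mu>) = (\<integral>\<^sup>+x. ennreal (f x) * ennreal (- ln (f x)) \<partial>std_gauss)"
    by (subst \<mu>f, subst nn_integral_density) auto
  also have "\<dots> \<le> (\<integral>\<^sup>+x. 1 \<partial>(std_gauss :: 'a measure))"
  proof (rule nn_integral_mono)
    fix x
    have "f x * (- ln (f x)) \<le> 1"
    proof (cases "f x = 0")
      case False
      with f0[of x] have p: "0 < f x" by simp
      then have "- ln (f x) \<le> 1 / f x - 1"
        using ln_le_minus_one[of "1 / f x"] by (simp add: ln_div)
      then have "f x * (- ln (f x)) \<le> f x * (1 / f x - 1)" using p by (intro mult_left_mono) auto
      also have "\<dots> \<le> 1" using p by (simp add: right_diff_distrib)
      finally show ?thesis .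
    qed simp
    then show "ennreal (f x) * ennreal (- ln (f x)) \<le> 1"
      using f0[of x] by (simp add: ennreal_mult'[symmetric])
  qed
  also have "\<dots> = 1" by (simp add: std_gauss.emeasure_space_1[simplified])
  finally have neg: "(\<integral>\<^sup>+x. ennreal (- ln (f x)) \<partial>\<mu>) \<noteq> \<infinity>" by (auto simp: top_unique)
  have "integrable \<mu> (\<lambda>x. ln (f x))"
    using pos neg by (simp add: real_integrable_def)
  then show ?thesis using that[of f] f0 \<mu>f by simp
qed

text \<open>Young's inequality: \<open>f * u \<le> exp (u + u)\<close> if
  \<open>f \<le> exp u\<close>, and otherwise \<open>u \<le> ln f\<close>. With
  \<open>u = (norm x)\<^sup>2 / 8\<close> the exponential is the Gaussian-integrable
  \<open>exp ((norm x)\<^sup>2 / 4)\<close>.\<close>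

lemma integrable_norm_sq_of_entropy:
  assumes [measurable]: "f \<in> borel_measurable borel" and f0: "\<And>x. 0 \<le> f x"
    and \<mu>f: "\<mu> = density std_gauss (\<lambda>x. ennreal (f x))" and int: "integrable \<mu> (\<lambda>x. ln (f x))"
  shows "integrable \<mu> (\<lambda>x. (norm x)\<^sup>2)"
proof -
  have "integrable \<mu> (\<lambda>x. max 0 (ln (f x)))" using int by simp
  then have "integrable std_gauss (\<lambda>x. f x *\<^sub>R max 0 (ln (f x)))"
    unfolding \<mu>f by (subst (asm) integrable_density) (auto simp: f0)
  then have "integrable std_gauss (\<lambda>x. f x *\<^sub>R max 0 (ln (f x)) + exp ((norm x)\<^sup>2 / 4))"
    by (intro Bochner_Integration.integrable_add integrable_std_gauss_exp_norm)
  then have "integrable std_gauss (\<lambda>x. f x *\<^sub>R ((norm x)\<^sup>2 / 8))"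
  proof (rule Bochner_Integration.integrable_bound)
    show "AE x in std_gauss. norm (f x *\<^sub>R ((norm x)\<^sup>2 / 8)) \<le> norm (f x *\<^sub>R max 0 (ln (f x)) + exp ((norm x)\<^sup>2 / 4))"
    proof (rule AE_I2)
      fix x :: 'a
      define u where "u = (norm x)\<^sup>2 / 8"
      have u: "0 \<le> u" "(norm x)\<^sup>2 / 4 = u + u" by (simp_all add: u_def)
      have "f x * u \<le> f x * max 0 (ln (f x)) + exp (u + u)"
      proof (cases "f x \<le> exp u")
        case True
        then have "f x * u \<le> exp u * exp u"
          using u exp_ge_add_one_self[of u] f0[of x] by (intro mult_mono; linarith)
        moreover have "0 \<le> f x * max 0 (ln (f x))" using f0[of x] by simp
        ultimately show ?thesis unfolding exp_add by linarith
      next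
        case False
        then have "u \<le> ln (f x)" using f0[of x] by (metis exp_gt_zero less_eq_real_def less_trans ln_exp ln_mono not_le)
        then have "f x * u \<le> f x * max 0 (ln (f x))" using f0[of x] by (intro mult_left_mono) auto
        then show ?thesis by (simp add: add_increasing2)
      qed
      moreover have "0 \<le> f x * u" using f0[of x] u by simp
      ultimately show "norm (f x *\<^sub>R ((norm x)\<^sup>2 / 8)) \<le> norm (f x *\<^sub>R max 0 (ln (f x)) + exp ((norm x)\<^sup>2 / 4))"
        unfolding u(2) u_def[symmetric] by simp
    qed
  qed measurable
  then have "integrable \<mu> (\<lambda>x. (norm x)\<^sup>2 / 8)"
    unfolding \<mu>f by (subst integrable_density) (auto simp: f0)
  then have "integrable \<mu> (\<lambda>x. 8 * ((norm x)\<^sup>2 / 8))" by (rule integrable_mult_right)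
  then show ?thesis by simp
qed

text \<open>For each test function the inequality is a linear lower bound on C, and such bounds pass
  to the infimum. Replacing C by \<open>max 0 C\<close> shows that the infimum is over a nonempty
  set, as the real \<open>Inf\<close> requires.\<close>

lemma poincare_const_attained:
  assumes "\<exists>C. poincare_ineq \<mu> C"
  shows "poincare_ineq \<mu> (poincare_const \<mu>)" "0 \<le> poincare_const \<mu>"
proof -
  let ?S = "{C. C \<ge> 0 \<and> poincare_ineq \<mu> C}"
  obtain C where C: "poincare_ineq \<mu> C" using assms by blast
  have up: "poincare_ineq \<mu> (max 0 C)"
    unfolding poincare_ineq_def
  proof (intro allI impI)
    fix \<psi> :: "'a \<Rightarrow> real" and g :: "'a \<Rightarrow> 'a" assume "poincare_test \<mu> \<psi> g"
    with C have "(\<integral>x. (\<psi> x - (\<integral>y. \<psi> y \<partial>\<mu>))\<^sup>2 \<partial>\<mu>) \<le> C * (\<integral>x. (norm (g x))\<^sup>2 \<partial>\<mu>)"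
      by (simp add: poincare_ineq_def)
    also have "\<dots> \<le> max 0 C * (\<integral>x. (norm (g x))\<^sup>2 \<partial>\<mu>)" by (intro mult_right_mono) auto
    finally show "(\<integral>x. (\<psi> x - (\<integral>y. \<psi> y \<partial>\<mu>))\<^sup>2 \<partial>\<mu>) \<le> max 0 C * (\<integral>x. (norm (g x))\<^sup>2 \<partial>\<mu>)" .
  qed
  then have "max 0 C \<in> ?S" by simp
  then have ne: "?S \<noteq> {}" by blast
  show "0 \<le> poincare_const \<mu>" unfolding poincare_const_def using ne by (intro cInf_greatest) auto
  show "poincare_ineq \<mu> (poincare_const \<mu>)"
    unfolding poincare_ineq_def
  proof (intro allI impI)
    fix \<psi> :: "'a \<Rightarrow> real" and g :: "'a \<Rightarrow> 'a" assume t: "poincare_test \<mu> \<psi> g"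
    define V E where "V = (\<integral>x. (\<psi> x - (\<integral>y. \<psi> y \<partial>\<mu>))\<^sup>2 \<partial>\<mu>)" and "E = (\<integral>x. (norm (g x))\<^sup>2 \<partial>\<mu>)"
    have le: "V \<le> C * E" if "C \<in> ?S" for C
      using that t by (simp add: poincare_ineq_def V_def E_def)
    have E0: "0 \<le> E" by (simp add: E_def)
    have "V \<le> poincare_const \<mu> * E"
    proof (cases "E = 0")
      case True
      then show ?thesis using le ne by auto
    next
      case False
      with E0 have E: "0 < E" by simp
      have "V / E \<le> Inf ?S"
        using ne le E by (intro cInf_greatest) (auto simp: pos_divide_le_eq)
      then show ?thesis using E by (simp add: poincare_const_def pos_divide_le_eq)
    qed
    then show "(\<integral>x. (\<psi> x - (\<integral>y. \<psi> y \<partial>\<mu>))\<^sup>2 \<partial>\<mu>) \<le> poincare_const \<mu> * (\<integral>x. (norm (g x))\<^sup>2 \<partial>\<mu>)"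
      by (simp add: V_def E_def)
  qed
qed

end

section \<open>Comparison with the entropy of X itself\<close>

context centered_prob
begin

text \<open>With constant 0 every coordinate would be almost surely constant, so the law would sit
  on a hyperplane, a Lebesgue null set. Positivity makes \<open>ln C\<close> meaningful and keeps
  \<open>1 + s (C - 1)\<close> positive up to \<open>s = 1\<close>.\<close>

lemma poincare_const_positive:
  assumes ac: "absolutely_continuous std_gauss \<mu>" and C: "poincare_ineq \<mu> C" "0 \<le> C"
  shows "0 < C"
proof (rule ccontr)
  assume "\<not> 0 < C"
  with C have C0: "poincare_ineq \<mu> 0" by simp
  obtain b :: 'a where b: "b \<in> Basis" using nonempty_Basis by blast
  have b1: "norm b = 1" using b by simp
  define m where "m = (\<integral>y. b \<bullet> y \<partial>\<mu>)"
  have ib: "integrable \<mu> (\<lambda>x. b \<bullet> x)" using integrable_inner_right[of b, OF integrable_id] by simp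
  have ib2: "integrable \<mu> (\<lambda>x. (b \<bullet> x)\<^sup>2)"
  proof (rule Bochner_Integration.integrable_bound[OF integrable_norm_sq])
    show "AE x in \<mu>. norm ((b \<bullet> x)\<^sup>2) \<le> norm ((norm x)\<^sup>2)"
      using Cauchy_Schwarz_ineq2[of b] b1 by (auto simp: abs_le_square_iff[symmetric])
  qed measurable
  have test: "poincare_test \<mu> (\<lambda>x. b \<bullet> x) (\<lambda>_. b)"
    unfolding poincare_test_def using ib2 has_derivative_inner_right[OF has_derivative_ident, of b] by auto
  have "(\<integral>x. (b \<bullet> x - m)\<^sup>2 \<partial>\<mu>) \<le> 0"
    using C0[unfolded poincare_ineq_def, rule_format, OF test] by (simp add: m_def)
  moreover have "0 \<le> (\<integral>x. (b \<bullet> x - m)\<^sup>2 \<partial>\<mu>)" by simp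
  ultimately have "(\<integral>x. (b \<bullet> x - m)\<^sup>2 \<partial>\<mu>) = 0" by linarith
  moreover have "integrable \<mu> (\<lambda>x. (b \<bullet> x - m)\<^sup>2)"
    using ib ib2 unfolding power2_diff by simp
  ultimately have ae: "AE x in \<mu>. b \<bullet> x = m"
    by (subst (asm) integral_nonneg_eq_0_iff_AE) auto
  have S: "{x. b \<bullet> x = m} \<in> sets borel" by (intro borel_closed closed_hyperplane)
  have "negligible {x. b \<bullet> x = m}" using b by (intro negligible_hyperplane) auto
  then have "{x. b \<bullet> x = m} \<in> null_sets lborel"
    using S by (simp add: negligible_iff_null_sets null_sets_completion_iff)
  moreover have "absolutely_continuous lborel (std_gauss :: 'a measure)"
    unfolding std_gauss_def by (rule absolutely_continuousI_density) simp
  ultimately have "{x. b \<bullet> x = m} \<in> null_sets \<mu>" using ac unfolding absolutely_continuous_def by blast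
  then have "AE x in \<mu>. \<not> (b \<bullet> x = m)" by (rule AE_I'[OF _]) auto
  with ae have "AE x in \<mu>. False" by eventually_elim simp
  then show False by simp
qed

text \<open>Apply \<open>ln q \<le> q - 1\<close> to the quotient of the output density by the input
  density. Its mean is at most 1: the weight \<open>f\<close> cancels the denominator and the
  channel preserves the Gaussian. The lemma replaces continuity of the entropy at 1.\<close>

lemma data_processing:
  assumes [measurable]: "f \<in> borel_measurable borel" and f0: "\<And>x. 0 \<le> f x"
    and \<mu>f: "\<mu> = density std_gauss (\<lambda>x. ennreal (f x))" and int: "integrable \<mu> (\<lambda>x. ln (f x))"
    and c: "0 \<le> c" "c < 1"
  shows "cross c c \<le> (\<integral>x. ln (f x) \<partial>\<mu>)"
proof -
  let ?q = "\<lambda>p. dens c (chan c p) / f (fst p)"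
  have d0: "0 \<le> dens c y" for y using dens_pos[OF c(2), of y] by simp
  have "(\<integral>\<^sup>+p. ennreal (?q p) \<partial>P) = (\<integral>\<^sup>+x. (\<integral>\<^sup>+z. ennreal (?q (x, z)) \<partial>std_gauss) \<partial>\<mu>)"
    by (subst std_gauss.nn_integral_fst[symmetric]) auto
  also have "\<dots> = (\<integral>\<^sup>+x. ennreal (f x) * (\<integral>\<^sup>+z. ennreal (?q (x, z)) \<partial>std_gauss) \<partial>std_gauss)"
    by (subst \<mu>f, subst nn_integral_density) auto
  also have "\<dots> = (\<integral>\<^sup>+x. (\<integral>\<^sup>+z. ennreal (f x) * ennreal (?q (x, z)) \<partial>std_gauss) \<partial>std_gauss)"
    by (simp add: nn_integral_cmult)
  \<comment> \<open>Only an inequality: where \<open>f x = 0\<close>, division by zero makes the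
    quotient 0.\<close>
  also have "\<dots> \<le> (\<integral>\<^sup>+x. (\<integral>\<^sup>+z. ennreal (dens c (chan c (x, z))) \<partial>std_gauss) \<partial>std_gauss)"
    by (intro nn_integral_mono) (use d0 f0 in \<open>auto simp: ennreal_mult'[symmetric]\<close>)
  also have "\<dots> = (\<integral>\<^sup>+p. ennreal (dens c (chan c p)) \<partial>(std_gauss \<Otimes>\<^sub>M std_gauss))"
    by (subst std_gauss.nn_integral_fst[symmetric]) auto
  also have "\<dots> = (\<integral>\<^sup>+y. ennreal (dens c y) \<partial>distr (std_gauss \<Otimes>\<^sub>M std_gauss) borel (chan c))"
    by (subst nn_integral_distr) auto
  also have "\<dots> = (\<integral>\<^sup>+y. ennreal (dens c y) \<partial>std_gauss)"
    by (simp add: G.distr_chan[OF c(2)] dens_std_gauss[OF c] density_1)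
  also have "\<dots> = emeasure (distr P borel (chan c)) UNIV"
    unfolding distr_chan[OF c(2)] by (simp add: emeasure_density)
  also have "\<dots> = 1"
    by (subst emeasure_distr) (auto simp: P.emeasure_space_1[simplified])
  finally have le1: "(\<integral>\<^sup>+p. ennreal (?q p) \<partial>P) \<le> 1" .
  have iq: "integrable P ?q"
    by (rule integrableI_nonneg) (use le1 d0 f0 in \<open>auto intro: le_less_trans\<close>)
  have q1: "(\<integral>p. ?q p \<partial>P) \<le> 1"
    using le1 nn_integral_eq_integral[OF iq] d0 f0 by simp
  have "AE x in \<mu>. 0 < f x"
    unfolding \<mu>f by (subst AE_density) (auto simp: ennreal_eq_0_iff not_le)
  moreover have "{p \<in> space P. 0 < f (fst p)} \<in> sets P" by measurable
  ultimately have fpos: "AE p in P. 0 < f (fst p)"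
    by (intro P.AE_pair_measure) auto
  have il: "integrable P (\<lambda>p. ln (f (fst p)))"
    using integrable_fst_P[OF int] .
  have "cross c c \<le> (\<integral>p. ln (f (fst p)) - 1 + ?q p \<partial>P)"
    unfolding cross_def
  proof (rule integral_mono_AE)
    show "integrable P (\<lambda>p. ln (dens c (chan c p)))" using c by (simp add: integrable_ln_dens)
    show "integrable P (\<lambda>p. ln (f (fst p)) - 1 + ?q p)" using il iq by simp
    show "AE p in P. ln (dens c (chan c p)) \<le> ln (f (fst p)) - 1 + ?q p"
      using fpos
    proof eventually_elim
      case (elim p)
      then show ?case
        using ln_le_minus_one[of "?q p"] dens_pos[OF c(2), of "chan c p"] by (simp add: ln_div)
    qed
  qed
  also have "\<dots> = (\<integral>x. ln (f x) \<partial>\<mu>) - 1 + (\<integral>p. ?q p \<partial>P)"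
    using il iq integral_fst_P[OF int] by simp
  finally show ?thesis using q1 by simp
qed

text \<open>On both sides of b the slope relative to \<open>\<phi>\<close> is compared with the same
  number \<open>m b\<close>. Eliminating it bounds \<open>cross b b * \<phi> c\<close> by
  \<open>\<phi> b * cross c c\<close> for c < 1.\<close>

lemma entropy_decay:
  assumes [measurable]: "f \<in> borel_measurable borel" and f0: "\<And>x. 0 \<le> f x"
    and \<mu>f: "\<mu> = density std_gauss (\<lambda>x. ennreal (f x))" and int: "integrable \<mu> (\<lambda>x. ln (f x))"
    and C: "poincare_ineq \<mu> C" "0 < C" "C \<noteq> 1" and b: "0 < b" "b < 1"
  shows "cross b b * (C - ln C - 1) \<le> (b * (C - 1) - ln (b * (C - 1) + 1)) * (\<integral>x. ln (f x) \<partial>\<mu>)"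
proof -
  define \<phi> where "\<phi> s = s * (C - 1) - ln (s * (C - 1) + 1)" for s
  define \<phi>' where "\<phi>' s = (C - 1)\<^sup>2 * s / (s * (C - 1) + 1)" for s
  \<comment> \<open>The quotient of \<open>fisher s / (2 * s)\<close> by \<open>\<phi>' s\<close>,
    with the weight written as in \<open>fisher_mono\<close>.\<close>
  define m where "m s = fisher s * ((C + (1 / s - 1)) / s) / (2 * (C - 1)\<^sup>2)" for s
  define D1 where "D1 = (\<integral>x. ln (f x) \<partial>\<mu>)"
  have den: "0 < s * (C - 1) + 1" if "0 \<le> s" "s \<le> 1" for s
  proof -
    have "0 < s * C + (1 - s)"
      using that C(2) by (cases "s = 1") (auto intro: add_nonneg_pos)
    then show ?thesis by (simp add: algebra_simps)
  qed
  have contS: "continuous_on {0..1} \<phi>"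
    unfolding \<phi>_def using den by (intro continuous_intros) (auto simp: less_imp_neq[symmetric])
  have \<phi>d: "(\<phi> has_real_derivative \<phi>' s) (at s)" if "0 < s" "s < 1" for s
  proof -
    have p: "0 < s * (C - 1) + 1" using den that by simp
    have "(\<phi> has_real_derivative ((C - 1) - (C - 1) / (s * (C - 1) + 1))) (at s)"
      unfolding \<phi>_def using p by (auto intro!: derivative_eq_intros)
    also have "(C - 1) - (C - 1) / (s * (C - 1) + 1) = \<phi>' s"
      using p by (simp add: \<phi>'_def field_simps power2_eq_square)
    finally show ?thesis .
  qed
  have m\<phi>: "fisher s / (2 * s) = m s * \<phi>' s" if "0 < s" "s < 1" for s
  proof -
    have p: "0 < s * (C - 1) + 1" using den that by simp
    have "(C + (1 / s - 1)) / s = (s * (C - 1) + 1) / s\<^sup>2"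
      using that by (simp add: field_simps power2_eq_square)
    then have "m s * \<phi>' s = fisher s * ((s * (C - 1) + 1) / s\<^sup>2) / (2 * (C - 1)\<^sup>2) * ((C - 1)\<^sup>2 * s / (s * (C - 1) + 1))"
      by (simp add: m_def \<phi>'_def)
    also have "\<dots> = fisher s / (2 * s)"
    proof -
      define w k where "w = s * (C - 1) + 1" and "k = (C - 1)\<^sup>2"
      have "w \<noteq> 0" "k \<noteq> 0" "s \<noteq> 0" using p C(3) that by (auto simp: w_def k_def)
      then show ?thesis unfolding w_def[symmetric] k_def[symmetric] by (simp add: power2_eq_square)
    qed
    finally show ?thesis ..
  qed
  have \<phi>0: "\<phi> 0 = 0" by (simp add: \<phi>_def)
  have \<phi>b: "0 \<le> \<phi> b"
    using ln_le_minus_one[of "b * (C - 1) + 1"] den[of b] b by (simp add: \<phi>_def)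
  have cd: "(cross s has_real_derivative m s * \<phi>' s) (at s)" if "0 < s" "s < 1" for s
    using cross_has_derivative[OF that] m\<phi>[OF that] by simp
  have pos: "0 < \<phi>' s" if "0 < s" "s < 1" for s
    unfolding \<phi>'_def using that den[of s] C(3) by (intro divide_pos_pos mult_pos_pos) auto
  have mono: "m s \<le> m t" if "0 < s" "s \<le> t" "t < 1" for s t
    unfolding m_def using fisher_mono[OF C(1) _ that] C by (intro divide_right_mono) auto
  have c\<phi>: "continuous_on {0..b} \<phi>" if "0 \<le> b" "b < 1" for b
    by (rule continuous_on_subset[OF contS]) (use that in auto)
  have below: "cross s r \<le> cross r r" if "0 < s" "s < 1" "0 \<le> r" "r < 1" for s r
    using gibbs that by simp
  note touch = touching_below[where D="\<lambda>s. cross s s" and E=cross and \<phi>=\<phi> and \<phi>'=\<phi>' and m=m]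
  have "cross b b - cross 0 0 \<le> m b * (\<phi> b - \<phi> 0)"
    by (rule touch(1)) (assumption | intro continuous_on_entropy c\<phi> refl below cd \<phi>d pos mono b)+
  then have low: "cross b b \<le> m b * \<phi> b" by (simp add: \<phi>0 cross_0)
  have high: "m b * (\<phi> c - \<phi> b) \<le> cross c c - cross b b" if "b \<le> c" "c < 1" for c
    by (rule touch(2)) (assumption | intro continuous_on_entropy c\<phi> refl below cd \<phi>d pos mono b that)+
  have *: "cross b b * \<phi> c \<le> \<phi> b * D1" if c: "b \<le> c" "c < 1" for c
  proof -
    have mc: "\<phi> b \<le> \<phi> c"
    proof (rule DERIV_nonneg_imp_nondecreasing[OF c(1)])
      fix x assume "b \<le> x" "x \<le> c"
      then have "0 < x" "x < 1" using b c by auto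
      then show "\<exists>y. DERIV \<phi> x :> y \<and> 0 \<le> y" using \<phi>d pos by (meson less_imp_le)
    qed
    have "cross b b * \<phi> c = \<phi> b * cross b b + cross b b * (\<phi> c - \<phi> b)" by (simp add: algebra_simps)
    also have "\<dots> \<le> \<phi> b * cross b b + (m b * \<phi> b) * (\<phi> c - \<phi> b)"
      using low mc by (intro add_left_mono mult_right_mono) auto
    also have "\<dots> = \<phi> b * (cross b b + m b * (\<phi> c - \<phi> b))" by (simp add: algebra_simps)
    also have "\<dots> \<le> \<phi> b * cross c c"
      using high[OF c] \<phi>b by (intro mult_left_mono) auto
    also have "\<dots> \<le> \<phi> b * D1"
      unfolding D1_def using data_processing[OF assms(1-4), of c] b c \<phi>b by (intro mult_left_mono) auto
    finally show ?thesis .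
  qed
  \<comment> \<open>The bound over c no longer contains the entropy at c, so only the explicit
    function \<open>\<phi>\<close> has to converge at 1.\<close>
  have "(\<phi> \<longlongrightarrow> \<phi> 1) (at 1 within {0..1})" using contS by (auto simp: continuous_on_def)
  then have "(\<phi> \<longlongrightarrow> \<phi> 1) (at 1 within {b<..<1})" by (rule tendsto_within_subset) (use b in auto)
  then have "((\<lambda>c. cross b b * \<phi> c) \<longlongrightarrow> cross b b * \<phi> 1) (at 1 within {b<..<1})"
    by (intro tendsto_intros)
  then have "cross b b * \<phi> 1 \<le> \<phi> b * D1"
  proof (rule tendsto_upperbound)
    show "\<forall>\<^sub>F c in at 1 within {b<..<1}. cross b b * \<phi> c \<le> \<phi> b * D1"
      by (auto simp: eventually_at_filter intro!: always_eventually *)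
    show "at 1 within {b<..<1} \<noteq> bot"
      using b by (simp add: at_within_eq_bot_iff)
  qed
  then show ?thesis by (simp add: \<phi>_def D1_def algebra_simps)
qed

end

theorem theorem1p5:
  fixes M :: "'w measure" and X G :: "'w \<Rightarrow> 'a::euclidean_space" and lam :: real
  assumes "prob_space M"
    and "X \<in> borel_measurable M" and "G \<in> borel_measurable M"
    and "distr M borel G = std_gauss"
    and "prob_space.indep_var M borel X borel G"
    and "integrable M X" and "(\<integral>\<omega>. X \<omega> \<partial>M) = 0"
    and "\<exists>C. poincare_ineq (distr M borel X) C"
    and "poincare_const (distr M borel X) \<noteq> 1"
    and "0 < lam" and "lam < 1"
  shows "ereal lam * rel_entropy (distr M borel X) std_gauss
           - rel_entropy (distr M borel (\<lambda>\<omega>. sqrt lam *\<^sub>R X \<omega> + sqrt (1 - lam) *\<^sub>R G \<omega>)) std_gauss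
         \<ge> ereal (lam - (lam * (poincare_const (distr M borel X) - 1)
                          - ln (lam * (poincare_const (distr M borel X) - 1) + 1))
                        / (poincare_const (distr M borel X) - ln (poincare_const (distr M borel X)) - 1))
           * rel_entropy (distr M borel X) std_gauss"
proof -
  interpret M: prob_space M by fact
  note [measurable] = assms(2,3)
  define \<mu> where "\<mu> = distr M borel X"
  define C where "C = poincare_const \<mu>"
  interpret borel_prob \<mu>
    unfolding borel_prob_def borel_prob_axioms_def \<mu>_def by (simp add: M.prob_space_distr)
  have joint: "distr M (borel \<Otimes>\<^sub>M borel) (\<lambda>\<omega>. (X \<omega>, G \<omega>)) = P"
    using M.indep_var_distribution_eq[of borel X borel G] assms(4,5) by (simp add: \<mu>_def)
  have "distr M borel (\<lambda>\<omega>. sqrt lam *\<^sub>R X \<omega> + sqrt (1 - lam) *\<^sub>R G \<omega>)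
      = distr (distr M (borel \<Otimes>\<^sub>M borel) (\<lambda>\<omega>. (X \<omega>, G \<omega>))) borel (chan lam)"
    by (subst distr_distr) (auto simp: comp_def chan_def)
  then have law: "distr M borel (\<lambda>\<omega>. sqrt lam *\<^sub>R X \<omega> + sqrt (1 - lam) *\<^sub>R G \<omega>) = density std_gauss (dens lam)"
    unfolding joint using distr_chan[OF assms(11)] by simp
  have mean: "(\<integral>x. x \<partial>\<mu>) = 0" unfolding \<mu>_def by (subst integral_distr) (auto simp: assms(7))
  have Cp: "poincare_ineq \<mu> C" "0 \<le> C"
    using poincare_const_attained assms(8) by (auto simp: C_def \<mu>_def)
  show ?thesis
  proof (cases "rel_entropy \<mu> std_gauss = \<infinity>")
    \<comment> \<open>With infinite entropy the left side is \<open>\<infinity>\<close> by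
      \<open>ereal\<close> arithmetic, since \<open>lam > 0\<close> and
      \<open>\<infinity> - x = \<infinity>\<close>.\<close>
    case True
    then show ?thesis using assms(10) by (simp add: \<mu>_def)
  next
    case False
    obtain f where f: "f \<in> borel_measurable borel" "\<And>x. 0 \<le> f x" "\<mu> = density std_gauss (\<lambda>x. ennreal (f x))"
      "integrable \<mu> (\<lambda>x. ln (f x))" using finite_rel_entropyD[OF False] by blast
    interpret centered_prob \<mu>
      by unfold_locales (fact integrable_norm_sq_of_entropy[OF f] mean)+
    have "absolutely_continuous std_gauss \<mu>"
      by (subst f(3), rule absolutely_continuousI_density) (use f(1) in simp)
    then have C0: "0 < C" using poincare_const_positive Cp by blast
    have C1: "C \<noteq> 1" using assms(9) by (simp add: C_def \<mu>_def)
    define D1 where "D1 = (\<integral>x. ln (f x) \<partial>\<mu>)"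
    have D1: "rel_entropy \<mu> std_gauss = ereal D1"
      unfolding D1_def by (rule rel_entropy_density[OF f])
    have lint: "integrable (density std_gauss (dens lam)) (\<lambda>y. ln (dens lam y))"
      using integrable_ln_dens[of lam lam] integral_chan(2)[OF assms(11), of "\<lambda>y. ln (dens lam y)"] assms(10,11)
        dens_pos[OF assms(11)] by (subst integrable_density) (auto simp: less_imp_le)
    have Dlam: "rel_entropy (density std_gauss (dens lam)) std_gauss = ereal (cross lam lam)"
    proof -
      have "(\<integral>y. ln (dens lam y) \<partial>density std_gauss (dens lam)) = cross lam lam"
        unfolding cross_def using integral_chan(1)[OF assms(11), of "\<lambda>y. ln (dens lam y)"] dens_pos[OF assms(11)]
        by (subst integral_density) (auto simp: less_imp_le)
      then show ?thesis
        using rel_entropy_density[OF _ _ refl lint] dens_pos[OF assms(11)] by (simp add: less_imp_le)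
    qed
    define p where "p = lam * (C - 1) - ln (lam * (C - 1) + 1)"
    \<comment> \<open>Equality in \<open>ln C \<le> C - 1\<close> holds only at
      \<open>C = 1\<close>, so excluding that value makes the denominator positive.\<close>
    have "ln C \<noteq> C - 1" using ln_eq_minus_one[OF C0] C1 by blast
    then have pos: "0 < C - ln C - 1" using ln_le_minus_one[OF C0] by linarith
    have "cross lam lam * (C - ln C - 1) \<le> p * D1"
      unfolding p_def D1_def by (rule entropy_decay[OF f Cp(1) C0 C1 assms(10,11)])
    then have "cross lam lam \<le> p / (C - ln C - 1) * D1"
      using pos by (simp add: pos_le_divide_eq)
    then have "(lam - p / (C - ln C - 1)) * D1 \<le> lam * D1 - cross lam lam" by (simp add: left_diff_distrib)
    then show ?thesis
      unfolding law \<mu>_def[symmetric] C_def[symmetric] D1 Dlam p_def[symmetric] by simp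
  qed
qed

end
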